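(* Let $J$ be any constant antisymmetric real matrix and let $H$ be a smooth Hamiltonian such that the generalized Hamiltonian system $J\dot z=\nabla H(z)$ has index 1, i.e., such that when the system is written in Darboux coordinates $(q,p,\lambda)$, the constraint $H_\lambda(q,p,\lambda)=0$ has a unique solution $\lambda=\tilde\lambda(q,p)$ for all $q$ and $p$. Then any symplectic Runge--Kutta method applied to $J\dot z=\nabla H(z)$ is well defined for sufficiently small $\Delta t$, is convergent of the same order as the Runge--Kutta method, preserves the constraint submanifold $C=\{(q,p,\lambda): \lambda=\tilde\lambda(q,p)\}$, and preserves the symplectic form on the constraint submanifold (the restriction of $\frac12 dz\wedge J\,dz$ to $C$).
   Context: Notation: $dz\wedge J\,dz:=\sum_{i,j}J_{ij}\,dz_i\wedge dz_j$. Darboux coordinates are linear coordinates $z=(q,p,\lambda)$, $q,p\in\mathbb{R}^n$, $\lambda\in\mathbb{R}^k$, in which $$J=\begin{pmatrix}0&-I_n&0\\ I_n&0&0\\ 0&0&0_{k\times k}\end{pmatrix},$$ so that the system reads $\dot q=H_p$, $\dot p=-H_q$, $0=H_\lambda$. Up to the sign convention, $\frac12 dz\wedge J\,dz$ is then $dq\wedge dp=\sum_i dq_i\wedge dp_i$. Standing assumption: the constraint set $C=\{H_\lambda=0\}$ is a smooth submanifold on which the restriction of $\frac12dz\wedge J\,dz$ is nondegenerate (so $C$ is a symplectic manifold); $C$ is the graph $\lambda=\tilde\lambda(q,p)$ over $(q,p)$, with $\tilde\lambda$ smooth. A Runge--Kutta method with coefficients $a_{ij},b_i$ ($1\le i,j\le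 s$) is symplectic if $b_ib_j-b_ja_{ji}-b_ia_{ij}=0$ for all $i,j$. Applied to $J\dot z=\nabla H(z)$ with time step $\Delta t$, it relates $z_0$ to $z_1$ by $$JZ_i=Jz_0+\Delta t\sum_{j=1}^s a_{ij}JF_j,\qquad Jz_1=Jz_0+\Delta t\sum_{j=1}^s b_jJF_j,\qquad JF_j=\nabla H(Z_j).$$ These equations do not involve the $\lambda$-components of $z_0,z_1$; by convention the endpoint multipliers are fixed by $\lambda_0=\tilde\lambda(q_0,p_0)$ and $\lambda_1=\tilde\lambda(q_1,p_1)$, which does not affect the method. "The order of the Runge--Kutta method" is its classical order for smooth ordinary differential equations; convergence refers to approximation of solutions of $J\dot z=\nabla H(z)$ starting on $C$, over bounded time intervals, as $\Delta t\to0$. As usual for implicit Runge--Kutta methods, well-definedness means local existence, and uniqueness of the solution with stages near $z_0$, for sufficiently small $\Delta t$. *)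

theory Defs
  imports "HOL-Analysis.Analysis"
begin

section \<open>Smooth functions and gradients\<close>

text \<open>In finite dimension, \<open>C_k k f\<close> is the usual notion of a \<open>k\<close> times continuously
  differentiable function; directional derivatives are used to stay within one type.\<close>

primrec C_k :: "nat \<Rightarrow> ('a::real_normed_vector \<Rightarrow> 'b::real_normed_vector) \<Rightarrow> bool" where
  "C_k 0 f \<longleftrightarrow> continuous_on UNIV f"
| "C_k (Suc k) f \<longleftrightarrow> (\<forall>x. f differentiable (at x)) \<and>
     (\<forall>v. C_k k (\<lambda>x. frechet_derivative f (at x) v))"

definition smooth :: "('a::real_normed_vector \<Rightarrow> 'b::real_normed_vector) \<Rightarrow> bool" where
  "smooth f \<longleftrightarrow> (\<forall>k. C_k k f)"

definition grad :: "(real^'m \<Rightarrow> real) \<Rightarrow> real^'m \<Rightarrow> real^'m" where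
  "grad H z = (\<chi> i. frechet_derivative H (at z) (axis i 1))"

section \<open>Darboux coordinates\<close>

text \<open>The coordinates are \<open>q\<^sub>i, p\<^sub>i\<close> for \<open>i < n\<close> and \<open>\<lambda>\<^sub>l\<close> for \<open>l < k\<close>. A labelling \<open>idx\<close> of the
  index type says which coordinate is which, so that \<open>n = 0\<close> (the case \<open>J = 0\<close>) and
  \<open>k = 0\<close> (the case \<open>J\<close> invertible) are included.\<close>

datatype darboux_index = Q_idx nat | P_idx nat | L_idx nat

definition canonical_J :: "('m::finite \<Rightarrow> darboux_index) \<Rightarrow> real^'m^'m" where
  "canonical_J idx = (\<chi> a c. case (idx a, idx c) of
       (Q_idx i, P_idx j) \<Rightarrow> (if i = j then - 1 else 0)
     | (P_idx i, Q_idx j) \<Rightarrow> (if i = j then 1 else 0)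
     | _ \<Rightarrow> 0)"

text \<open>The coordinate vector \<open>w = (q, p, \<lambda>)\<close> stands for the point \<open>z = S *v w\<close>. Substituting this
  into \<open>J z' = \<nabla>H(z)\<close> and multiplying by the transpose of \<open>S\<close> gives
  \<open>(S\<^sup>T J S) w' = \<nabla>(H \<circ> S)(w)\<close>, and \<open>dz \<and> J dz\<close> becomes \<open>dw \<and> (S\<^sup>T J S) dw\<close>.\<close>

definition darboux_coordinates ::
  "real^'m^'m \<Rightarrow> nat \<Rightarrow> nat \<Rightarrow> ('m::finite \<Rightarrow> darboux_index) \<Rightarrow> real^'m^'m \<Rightarrow> bool" where
  "darboux_coordinates J n k idx S \<longleftrightarrow>
     bij_betw idx UNIV (Q_idx ` {..<n} \<union> P_idx ` {..<n} \<union> L_idx ` {..<k}) \<and>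
     invertible S \<and> transpose S ** J ** S = canonical_J idx"

definition is_lambda :: "('m \<Rightarrow> darboux_index) \<Rightarrow> 'm \<Rightarrow> bool" where
  "is_lambda idx a \<longleftrightarrow> (\<exists>l. idx a = L_idx l)"

text \<open>The point \<open>(q, p, \<lambda>)\<close> is written as \<open>x + l\<close> with \<open>x = (q, p, 0)\<close> in \<open>qp_space\<close> and
  \<open>l = (0, 0, \<lambda>)\<close> in \<open>lambda_space\<close>; a function of \<open>(q, p)\<close> is a function on \<open>qp_space\<close>.\<close>

definition qp_space :: "('m::finite \<Rightarrow> darboux_index) \<Rightarrow> (real^'m) set" where
  "qp_space idx = {x. \<forall>a. is_lambda idx a \<longrightarrow> x $ a = 0}"

definition lambda_space :: "('m::finite \<Rightarrow> darboux_index) \<Rightarrow> (real^'m) set" where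
  "lambda_space idx = {l. \<forall>a. \<not> is_lambda idx a \<longrightarrow> l $ a = 0}"

definition qp_part :: "('m::finite \<Rightarrow> darboux_index) \<Rightarrow> real^'m \<Rightarrow> real^'m" where
  "qp_part idx w = (\<chi> a. if is_lambda idx a then 0 else w $ a)"

definition H_lambda_vanishes ::
  "(real^'m \<Rightarrow> real) \<Rightarrow> ('m::finite \<Rightarrow> darboux_index) \<Rightarrow> real^'m^'m \<Rightarrow> real^'m \<Rightarrow> bool" where
  "H_lambda_vanishes H idx S w \<longleftrightarrow>
     (\<forall>a. is_lambda idx a \<longrightarrow> grad (\<lambda>w. H (S *v w)) w $ a = 0)"

definition index_one ::
  "(real^'m \<Rightarrow> real) \<Rightarrow> ('m::finite \<Rightarrow> darboux_index) \<Rightarrow> real^'m^'m \<Rightarrow>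
   (real^'m \<Rightarrow> real^'m) \<Rightarrow> bool" where
  "index_one H idx S lam \<longleftrightarrow>
     (\<forall>x\<in>qp_space idx. lam x \<in> lambda_space idx \<and>
        (\<forall>l\<in>lambda_space idx. H_lambda_vanishes H idx S (x + l) \<longleftrightarrow> l = lam x))"

definition constraint_set ::
  "(real^'m \<Rightarrow> real) \<Rightarrow> ('m::finite \<Rightarrow> darboux_index) \<Rightarrow> real^'m^'m \<Rightarrow> (real^'m) set" where
  "constraint_set H idx S = {S *v w | w. H_lambda_vanishes H idx S w}"

definition multiplier_graph ::
  "('m::finite \<Rightarrow> darboux_index) \<Rightarrow> real^'m^'m \<Rightarrow> (real^'m \<Rightarrow> real^'m) \<Rightarrow> (real^'m) set" where
  "multiplier_graph idx S lam = {S *v (x + lam x) | x. x \<in> qp_space idx}"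

lemma constraint_set_eq_graph:
  assumes "index_one H idx S lam"
  shows "constraint_set H idx S = multiplier_graph idx S lam"
proof -
  have decomp: "\<exists>x\<in>qp_space idx. \<exists>l\<in>lambda_space idx. w = x + l" for w :: "real^'a"
    by (intro bexI[of _ "qp_part idx w"] bexI[of _ "w - qp_part idx w"])
       (auto simp: qp_space_def lambda_space_def qp_part_def)
  show ?thesis
    using assms unfolding constraint_set_def multiplier_graph_def index_one_def
    by (auto; metis decomp)
qed

section \<open>The symplectic form on the constraint set\<close>

text \<open>\<open>\<onehalf> dz \<and> J dz = \<onehalf> \<Sum>\<^sub>i\<^sub>j J\<^sub>i\<^sub>j dz\<^sub>i \<and> dz\<^sub>j\<close>, evaluated on two vectors.\<close>

definition J_form :: "real^'m^'m \<Rightarrow> real^'m \<Rightarrow> real^'m \<Rightarrow> real" where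
  "J_form J u v = 1/2 * (\<Sum>i\<in>UNIV. \<Sum>j\<in>UNIV. J $ i $ j * (u $ i * v $ j - u $ j * v $ i))"

definition tangent_space :: "'a::real_normed_vector set \<Rightarrow> 'a \<Rightarrow> 'a set" where
  "tangent_space C x = {v. \<exists>\<gamma>. \<gamma> (0::real) = x \<and> (\<forall>\<^sub>F t in nhds 0. \<gamma> t \<in> C) \<and>
     (\<gamma> has_vector_derivative v) (at 0)}"

text \<open>A derivative within a submanifold \<open>C\<close> is determined on the tangent space of \<open>C\<close>, where it is
  the differential of the restricted map.\<close>

definition preserves_form_at ::
  "real^'m^'m \<Rightarrow> (real^'m) set \<Rightarrow> (real^'m \<Rightarrow> real^'m) \<Rightarrow> real^'m \<Rightarrow> bool" where
  "preserves_form_at J C \<Phi> x \<longleftrightarrow> (\<exists>D. (\<Phi> has_derivative D) (at x within C) \<and>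
     (\<forall>u\<in>tangent_space C x. D u \<in> tangent_space C (\<Phi> x)) \<and>
     (\<forall>u\<in>tangent_space C x. \<forall>v\<in>tangent_space C x. J_form J (D u) (D v) = J_form J u v))"

section \<open>Runge--Kutta methods\<close>

definition symplectic_rk :: "real^'s^'s \<Rightarrow> real^'s \<Rightarrow> bool" where
  "symplectic_rk A b \<longleftrightarrow> (\<forall>i j. b $ i * b $ j - b $ j * A $ j $ i - b $ i * A $ i $ j = 0)"

text \<open>The classical order refers to ordinary differential equations in every dimension \<open>d\<close>. Since \<open>d\<close>
  is quantified here, vectors of \<open>\<real>\<^sup>d\<close> are functions on \<open>nat\<close> of which only the first \<open>d\<close> values
  matter, and smoothness is expressed by continuity of all iterated partial derivatives.\<close>

primrec C_k_partials :: "nat \<Rightarrow> nat \<Rightarrow> ((nat \<Rightarrow> real) \<Rightarrow> real) \<Rightarrow> bool" where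
  "C_k_partials d 0 g \<longleftrightarrow> continuous_on UNIV g"
| "C_k_partials d (Suc k) g \<longleftrightarrow> continuous_on UNIV g \<and>
     (\<forall>i<d. \<exists>g'. (\<forall>y. ((\<lambda>t. g (y(i := t))) has_real_derivative g' y) (at (y i))) \<and>
        C_k_partials d k g')"

definition smooth_field :: "nat \<Rightarrow> ((nat \<Rightarrow> real) \<Rightarrow> nat \<Rightarrow> real) \<Rightarrow> bool" where
  "smooth_field d f \<longleftrightarrow> (\<forall>j<d. (\<forall>y y'. (\<forall>i<d. y i = y' i) \<longrightarrow> f y j = f y' j) \<and>
     (\<forall>k. C_k_partials d k (\<lambda>y. f y j)))"

definition ode_solution ::
  "nat \<Rightarrow> ((nat \<Rightarrow> real) \<Rightarrow> nat \<Rightarrow> real) \<Rightarrow> real \<Rightarrow> (real \<Rightarrow> nat \<Rightarrow> real) \<Rightarrow> bool" where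
  "ode_solution d f T y \<longleftrightarrow> (\<forall>t\<in>{0..T}. \<forall>j<d.
     ((\<lambda>t. y t j) has_real_derivative f (y t) j) (at t within {0..T}))"

definition ode_rk_step ::
  "real^'s^'s \<Rightarrow> real^'s \<Rightarrow> nat \<Rightarrow> ((nat \<Rightarrow> real) \<Rightarrow> nat \<Rightarrow> real) \<Rightarrow> real \<Rightarrow>
   (nat \<Rightarrow> real) \<Rightarrow> ('s \<Rightarrow> nat \<Rightarrow> real) \<Rightarrow> (nat \<Rightarrow> real) \<Rightarrow> bool" where
  "ode_rk_step A b d f h y0 Y y1 \<longleftrightarrow>
     (\<forall>i. \<forall>j<d. Y i j = y0 j + h * (\<Sum>l\<in>UNIV. A $ i $ l * f (Y l) j)) \<and>
     (\<forall>j<d. y1 j = y0 j + h * (\<Sum>l\<in>UNIV. b $ l * f (Y l) j))"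

text \<open>The local error is \<open>O(h\<^bsup>p+1\<^esup>)\<close> for every smooth problem, where for implicit methods the
  solution of the stage equations is the one near the initial value.\<close>

definition rk_has_order :: "real^'s^'s \<Rightarrow> real^'s \<Rightarrow> nat \<Rightarrow> bool" where
  "rk_has_order A b p \<longleftrightarrow>
     (\<forall>d f T y. smooth_field d f \<and> 0 < T \<and> ode_solution d f T y \<longrightarrow>
       (\<exists>r>0. \<exists>h0>0. \<exists>M. h0 \<le> T \<and>
         (\<forall>h Y y1. 0 < h \<and> h < h0 \<and> (\<forall>i. \<forall>j<d. \<bar>Y i j - y 0 j\<bar> < r) \<and>
            ode_rk_step A b d f h (y 0) Y y1 \<longrightarrow>
            (\<forall>j<d. \<bar>y1 j - y h j\<bar> \<le> M * h ^ (p + 1)))))"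

section \<open>Runge--Kutta methods for generalized Hamiltonian systems\<close>

definition gen_hamiltonian_solution ::
  "real^'m^'m \<Rightarrow> (real^'m \<Rightarrow> real) \<Rightarrow> real \<Rightarrow> (real \<Rightarrow> real^'m) \<Rightarrow> bool" where
  "gen_hamiltonian_solution J H T z \<longleftrightarrow> (\<forall>t\<in>{0..T}. \<exists>z'.
     (z has_vector_derivative z') (at t within {0..T}) \<and> J *v z' = grad H (z t))"

definition rk_equations ::
  "real^'m^'m \<Rightarrow> (real^'m \<Rightarrow> real) \<Rightarrow> real^'s^'s \<Rightarrow> real^'s \<Rightarrow> real \<Rightarrow>
   real^'m \<Rightarrow> ('s \<Rightarrow> real^'m) \<Rightarrow> ('s \<Rightarrow> real^'m) \<Rightarrow> real^'m \<Rightarrow> bool" where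
  "rk_equations J H A b h z0 Z F z1 \<longleftrightarrow>
     (\<forall>i. J *v Z i = J *v z0 + h *\<^sub>R (\<Sum>j\<in>UNIV. A $ i $ j *\<^sub>R (J *v F j))) \<and>
     J *v z1 = J *v z0 + h *\<^sub>R (\<Sum>j\<in>UNIV. b $ j *\<^sub>R (J *v F j)) \<and>
     (\<forall>j. J *v F j = grad H (Z j))"

text \<open>The equations determine \<open>z1\<close> and the \<open>F j\<close> only up to the kernel of \<open>J\<close>. The convention
  \<open>\<lambda>\<^sub>1 = lam (q\<^sub>1, p\<^sub>1)\<close> is the condition that \<open>z1\<close> lies in the set \<open>G\<close>, the graph of \<open>lam\<close>; the
  \<open>F j\<close> enter only through \<open>J *v F j\<close>, so they are not part of the solution. The number \<open>r\<close> bounds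
  the distance of the stages from \<open>z0\<close>.\<close>

definition rk_solution ::
  "real^'m^'m \<Rightarrow> (real^'m \<Rightarrow> real) \<Rightarrow> (real^'m) set \<Rightarrow> real^'s^'s \<Rightarrow> real^'s \<Rightarrow> real \<Rightarrow> real \<Rightarrow>
   real^'m \<Rightarrow> ('s \<Rightarrow> real^'m) \<Rightarrow> real^'m \<Rightarrow> bool" where
  "rk_solution J H G A b r h z0 Z z1 \<longleftrightarrow>
     (\<forall>i. dist (Z i) z0 < r) \<and> (\<exists>F. rk_equations J H A b h z0 Z F z1) \<and> z1 \<in> G"

definition rk_map ::
  "real^'m^'m \<Rightarrow> (real^'m \<Rightarrow> real) \<Rightarrow> (real^'m) set \<Rightarrow> real^'s^'s \<Rightarrow> real^'s \<Rightarrow> real \<Rightarrow> real \<Rightarrow>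
   real^'m \<Rightarrow> real^'m" where
  "rk_map J H G A b r h z0 = (THE z1. \<exists>Z. rk_solution J H G A b r h z0 Z z1)"

definition rk_trajectory ::
  "real^'m^'m \<Rightarrow> (real^'m \<Rightarrow> real) \<Rightarrow> (real^'m) set \<Rightarrow> real^'s^'s \<Rightarrow> real^'s \<Rightarrow> real \<Rightarrow> real \<Rightarrow>
   real^'m \<Rightarrow> nat \<Rightarrow> (nat \<Rightarrow> real^'m) \<Rightarrow> bool" where
  "rk_trajectory J H G A b r h z0 N w \<longleftrightarrow> w 0 = z0 \<and>
     (\<forall>k<N. \<exists>Z. rk_solution J H G A b r h (w k) Z (w (Suc k)))"

definition rk_convergent ::
  "real^'m^'m \<Rightarrow> (real^'m \<Rightarrow> real) \<Rightarrow> (real^'m) set \<Rightarrow> (real^'m) set \<Rightarrow> real^'s^'s \<Rightarrow> real^'s \<Rightarrow>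
   nat \<Rightarrow> bool" where
  "rk_convergent J H C G A b p \<longleftrightarrow>
     (\<forall>T z. 0 < T \<and> gen_hamiltonian_solution J H T z \<and> z 0 \<in> C \<longrightarrow>
       (\<exists>r0>0. \<forall>r. 0 < r \<and> r \<le> r0 \<longrightarrow> (\<exists>h0>0. \<exists>M.
         \<forall>h N. 0 < h \<and> h < h0 \<and> real N * h \<le> T \<longrightarrow>
           (\<exists>w. rk_trajectory J H G A b r h (z 0) N w) \<and>
           (\<forall>w. rk_trajectory J H G A b r h (z 0) N w \<longrightarrow>
              (\<forall>k\<le>N. norm (w k - z (real k * h)) \<le> M * h ^ p)))))"

end

theory Submission
  imports Defs
begin

text \<open>In Darboux coordinates \<open>J F = \<nabla>H(Z)\<close> says that \<open>H\<^sub>\<lambda>\<close> vanishes at \<open>Z\<close>, i.e. that \<open>Z\<close> lies on the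
  graph of \<open>lam\<close>, and that the \<open>(q, p)\<close> part of \<open>F\<close> is the Hamiltonian vector field of the reduced
  Hamiltonian \<open>H(q, p, lam(q, p))\<close> at the \<open>(q, p)\<close> part of \<open>Z\<close> (\<open>J_eq_grad_iff\<close>). The multiplier does
  not contribute to the gradient of the reduced Hamiltonian, because \<open>H\<^sub>\<lambda>\<close> vanishes on the graph
  (\<open>grad_H_red\<close>). Since \<open>J\<close> ignores the \<open>\<lambda>\<close> components, the method applied to the constrained system is
  the same method applied to the reduced system, lifted to the graph (\<open>rk_solution_iff\<close>). Preservation of
  the constraint set is then immediate, and the other claims become statements about a smooth ordinary
  differential equation.

  Well-definedness: the stages solve \<open>X = c + h G(X)\<close> with a smooth \<open>G\<close>, so for small \<open>h\<close> they are given
  by the contraction principle, and their derivative with respect to the initial value satisfies the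
  linearised stage equations (\<open>implicit_equation_derivative\<close>).

  Symplecticity: the form is the canonical one in the \<open>(q, p)\<close> parts (\<open>J_form_eq\<close>), the linearised slopes
  are infinitesimally symplectic because second derivatives commute, and the quadratic terms cancel by
  the condition on the coefficients (\<open>symplectic_rk_preserves_bilinear\<close>).

  Convergence: the order of a method bounds the local error for each solution separately, whereas the
  summation of local errors needs a bound that is uniform along the solution. Uniformity is a matter of
  Taylor coefficients. Up to \<open>O(h\<^bsup>p+1\<^esup>)\<close> the local error equals a function of \<open>h\<close> whose first \<open>p + 1\<close>
  derivatives are bounded uniformly along the solution, because the stages may be replaced by Picard
  iterates. The order makes its Taylor polynomial of degree \<open>p\<close> vanish at every point, and the Taylor
  remainder is uniform (\<open>pointwise_order_imp_uniform\<close>, \<open>rk_local_error_uniform\<close>).\<close>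

section \<open>Calculus of smooth functions\<close>

lemma C_k_SucD: "C_k (Suc k) f \<Longrightarrow> C_k k f"
proof (induction k arbitrary: f)
  case 0
  then show ?case
    by (simp add: differentiable_imp_continuous_on differentiable_at_imp_differentiable_on)
next
  case (Suc k)
  from Suc.prems have "\<forall>v. C_k (Suc k) (\<lambda>x. frechet_derivative f (at x) v)"
    by (subst (asm) C_k.simps(2)) blast
  then have "\<forall>v. C_k k (\<lambda>x. frechet_derivative f (at x) v)"
    using Suc.IH by blast
  moreover have "\<forall>x. f differentiable (at x)"
    using Suc.prems by simp
  ultimately show ?case
    by simp
qed

lemma C_k_continuous: "C_k k f \<Longrightarrow> continuous_on UNIV f"
  by (induction k) (auto dest: C_k_SucD simp del: C_k.simps(2))

lemma C_k_has_derivative: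
  assumes "C_k (Suc k) f"
  shows "(f has_derivative frechet_derivative f (at x)) (at x)"
  using assms by (simp add: frechet_derivative_works[symmetric])

lemma C_k_SucI:
  assumes "\<And>x. (f has_derivative f' x) (at x)" and "\<And>v. C_k k (\<lambda>x. f' x v)"
  shows "C_k (Suc k) f"
proof -
  have "frechet_derivative f (at x) = f' x" for x
    using frechet_derivative_at[OF assms(1)] by simp
  then show ?thesis
    using assms by (auto simp: differentiable_def)
qed

lemma C_k_const: "C_k k (\<lambda>x. c)"
proof (induction k arbitrary: c)
  case (Suc k)
  show ?case
    by (rule C_k_SucI[where f' = "\<lambda>x v. 0"]) (use Suc in auto)
qed simp

lemma C_k_bounded_linear: "bounded_linear f \<Longrightarrow> C_k k f"
proof (cases k)
  case 0
  then show "bounded_linear f \<Longrightarrow> ?thesis"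
    by (simp add: linear_continuous_on)
next
  case (Suc k')
  assume "bounded_linear f"
  then show ?thesis unfolding Suc
    by (intro C_k_SucI[where f' = "\<lambda>x v. f v"]) (auto intro: C_k_const bounded_linear_imp_has_derivative)
qed

lemma C_k_bounded_linear_compose:
  assumes L: "bounded_linear L"
  shows "C_k k f \<Longrightarrow> C_k k (\<lambda>x. L (f x))"
proof (induction k arbitrary: f)
  case 0
  then show ?case
    using bounded_linear.continuous_on[OF L] by simp
next
  case (Suc k)
  show ?case
  proof (rule C_k_SucI)
    show "((\<lambda>x. L (f x)) has_derivative (\<lambda>v. L (frechet_derivative f (at x) v))) (at x)" for x
      using bounded_linear.has_derivative[OF L C_k_has_derivative[OF Suc.prems]] .
    show "C_k k (\<lambda>x. L (frechet_derivative f (at x) v))" for v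
      using Suc by simp
  qed
qed

lemma C_k_add: "C_k k f \<Longrightarrow> C_k k g \<Longrightarrow> C_k k (\<lambda>x. f x + g x)"
proof (induction k arbitrary: f g)
  case 0
  then show ?case by (auto intro: continuous_intros)
next
  case (Suc k)
  show ?case
  proof (rule C_k_SucI)
    show "((\<lambda>x. f x + g x) has_derivative
        (\<lambda>v. frechet_derivative f (at x) v + frechet_derivative g (at x) v)) (at x)" for x
      using Suc.prems by (intro has_derivative_add C_k_has_derivative)
    show "C_k k (\<lambda>x. frechet_derivative f (at x) v + frechet_derivative g (at x) v)" for v
      using Suc by simp
  qed
qed

lemma C_k_sum: "(\<And>i. i \<in> I \<Longrightarrow> C_k k (f i)) \<Longrightarrow> C_k k (\<lambda>x. \<Sum>i\<in>I. f i x)"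
  by (induction I rule: infinite_finite_induct) (auto intro: C_k_const C_k_add)

lemma C_k_scaleR: "C_k k f \<Longrightarrow> C_k k g \<Longrightarrow> C_k k (\<lambda>x. f x *\<^sub>R g x)"
proof (induction k arbitrary: f g)
  case 0
  then show ?case by (auto intro: continuous_intros)
next
  case (Suc k)
  have IH: "C_k k (\<lambda>x. f x *\<^sub>R frechet_derivative g (at x) v + frechet_derivative f (at x) v *\<^sub>R g x)" for v
    using Suc.prems C_k_SucD[OF Suc.prems(1)] C_k_SucD[OF Suc.prems(2)]
    by (intro C_k_add Suc.IH) auto
  have "((\<lambda>x. f x *\<^sub>R g x) has_derivative (\<lambda>v. f x *\<^sub>R frechet_derivative g (at x) v +
      frechet_derivative f (at x) v *\<^sub>R g x)) (at x)" for x
    using has_derivative_scaleR[OF C_k_has_derivative[OF Suc.prems(1)] C_k_has_derivative[OF Suc.prems(2)]] .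
  then show ?case
    by (rule C_k_SucI[OF _ IH])
qed

lemma linear_basis_expansion:
  fixes v :: "'a::euclidean_space"
  assumes "linear L"
  shows "L v = (\<Sum>b\<in>Basis. (v \<bullet> b) *\<^sub>R L b)"
  by (subst euclidean_representation[symmetric, of v])
     (simp only: linear_sum[OF assms] linear_scale[OF assms])

text \<open>In the chain rule the inner derivative is expanded in a basis, which leaves derivatives of
  the outer function in fixed directions only; these are again covered by the induction.\<close>

lemma C_k_compose:
  fixes g :: "'a::real_normed_vector \<Rightarrow> 'b::euclidean_space"
  shows "C_k k f \<Longrightarrow> C_k k g \<Longrightarrow> C_k k (\<lambda>x. f (g x))"
proof (induction k arbitrary: f)
  case 0
  then show ?case
    by (auto intro: continuous_on_compose2)
next
  case (Suc k)
  let ?f' = "\<lambda>y. frechet_derivative f (at y)" and ?g' = "\<lambda>x. frechet_derivative g (at x)"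
  have comp: "((\<lambda>x. f (g x)) has_derivative (\<lambda>v. ?f' (g x) (?g' x v))) (at x)" for x
    using has_derivative_compose[OF C_k_has_derivative[OF Suc.prems(2)] C_k_has_derivative[OF Suc.prems(1)]] .
  have lin: "linear (?f' y)" for y
    using C_k_has_derivative[OF Suc.prems(1)] has_derivative_linear by blast
  have expand: "?f' (g x) (?g' x v) = (\<Sum>b\<in>Basis. (?g' x v \<bullet> b) *\<^sub>R ?f' (g x) b)" for x v
    by (rule linear_basis_expansion[OF lin])
  have "C_k k (\<lambda>x. ?f' (g x) (?g' x v))" for v
    unfolding expand using Suc.prems C_k_SucD[OF Suc.prems(2)]
    by (intro C_k_sum C_k_scaleR Suc.IH C_k_bounded_linear_compose[OF bounded_linear_inner_left]) auto
  then show ?case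
    by (intro C_k_SucI[OF comp])
qed

lemma smooth_const: "smooth (\<lambda>x. c)"
  by (simp add: smooth_def C_k_const)

lemma smooth_bounded_linear: "bounded_linear f \<Longrightarrow> smooth f"
  by (simp add: smooth_def C_k_bounded_linear)

lemma smooth_add: "smooth f \<Longrightarrow> smooth g \<Longrightarrow> smooth (\<lambda>x. f x + g x)"
  by (simp add: smooth_def C_k_add)

lemma smooth_sum: "(\<And>i. i \<in> I \<Longrightarrow> smooth (f i)) \<Longrightarrow> smooth (\<lambda>x. \<Sum>i\<in>I. f i x)"
  by (simp add: smooth_def C_k_sum)

lemma smooth_scaleR: "smooth f \<Longrightarrow> smooth g \<Longrightarrow> smooth (\<lambda>x. f x *\<^sub>R g x)"
  by (simp add: smooth_def C_k_scaleR)

lemma smooth_compose: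
  fixes g :: "'a::real_normed_vector \<Rightarrow> 'b::euclidean_space"
  shows "smooth f \<Longrightarrow> smooth g \<Longrightarrow> smooth (\<lambda>x. f (g x))"
  by (simp add: smooth_def C_k_compose)

lemma smooth_has_derivative:
  "smooth f \<Longrightarrow> (f has_derivative frechet_derivative f (at x)) (at x)"
  unfolding smooth_def using C_k_has_derivative by blast

lemma smooth_linear_derivative: "smooth f \<Longrightarrow> linear (frechet_derivative f (at x))"
  using smooth_has_derivative has_derivative_linear by blast

lemma smooth_frechet_derivative: "smooth f \<Longrightarrow> smooth (\<lambda>x. frechet_derivative f (at x) v)"
  unfolding smooth_def by (metis C_k.simps(2))

lemma smooth_continuous_on: "smooth f \<Longrightarrow> continuous_on S f"
  unfolding smooth_def by (meson C_k_continuous continuous_on_subset subset_UNIV)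

lemma smooth_vec_lambda:
  fixes f :: "'i::finite \<Rightarrow> 'a::real_normed_vector \<Rightarrow> 'b::euclidean_space"
  assumes "\<And>i. smooth (f i)"
  shows "smooth (\<lambda>x. \<chi> i. f i x)"
proof -
  have ax: "bounded_linear (axis i :: 'b \<Rightarrow> 'b^'i)" for i
    by (auto intro!: linearI simp: linear_conv_bounded_linear[symmetric] axis_def vec_eq_iff)
  have "(\<lambda>x. \<chi> i. f i x) = (\<lambda>x. \<Sum>i\<in>UNIV. axis i (f i x))"
    by (auto simp: fun_eq_iff vec_eq_iff axis_def if_distrib sum.delta cong: if_cong)
  moreover have "smooth (\<lambda>x. axis i (f i x) :: 'b^'i)" for i
    using smooth_compose[OF smooth_bounded_linear[OF ax] assms] .
  ultimately show ?thesis
    by (auto intro: smooth_sum)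
qed

lemma bounded_on_cball:
  fixes f :: "'a::euclidean_space \<Rightarrow> 'b::real_normed_vector"
  assumes "continuous_on UNIV f"
  obtains M where "0 < M" "\<And>x. norm x \<le> R \<Longrightarrow> norm (f x) \<le> M"
proof -
  have "bounded (f ` cball 0 R)"
    by (intro compact_imp_bounded compact_continuous_image continuous_on_subset[OF assms]) auto
  then show ?thesis
    using that unfolding bounded_pos by (auto simp: image_iff)
qed

lemma smooth_lipschitz_on_cball:
  fixes f :: "'a::euclidean_space \<Rightarrow> 'b::real_normed_vector"
  assumes "smooth f"
  obtains L where "0 < L"
    "\<And>x v. norm x \<le> R \<Longrightarrow> norm (frechet_derivative f (at x) v) \<le> L * norm v"
    "\<And>x y. norm x \<le> R \<Longrightarrow> norm y \<le> R \<Longrightarrow> norm (f x - f y) \<le> L * norm (x - y)"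
proof -
  let ?f' = "\<lambda>x. frechet_derivative f (at x)"
  have "\<forall>b. \<exists>M>0. \<forall>x. norm x \<le> R \<longrightarrow> norm (?f' x b) \<le> M"
    using bounded_on_cball[OF smooth_continuous_on[OF smooth_frechet_derivative[OF assms]], where R = R]
    by metis
  then obtain M where M: "\<And>b. 0 < M b" "\<And>b x. norm x \<le> R \<Longrightarrow> norm (?f' x b) \<le> M b"
    by metis
  define L where "L = 1 + (\<Sum>b\<in>Basis. M b)"
  have L_pos: "0 < L"
    unfolding L_def using M(1) by (smt (verit) sum_nonneg)
  have bound: "norm (?f' x v) \<le> L * norm v" if "norm x \<le> R" for x v
  proof -
    have "norm (?f' x v) \<le> (\<Sum>b\<in>Basis. norm ((v \<bullet> b) *\<^sub>R ?f' x b))"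
      by (subst linear_basis_expansion[OF smooth_linear_derivative[OF assms]]) (rule norm_sum)
    also have "\<dots> \<le> (\<Sum>b\<in>Basis. norm v * M b)"
      using M that by (auto intro!: sum_mono mult_mono Basis_le_norm)
    also have "\<dots> \<le> L * norm v"
      unfolding L_def sum_distrib_left[symmetric] by (simp add: algebra_simps)
    finally show ?thesis .
  qed
  have "norm (f x - f y) \<le> L * norm (x - y)" if "norm x \<le> R" "norm y \<le> R" for x y
  proof (rule differentiable_bound[where S = "cball 0 R"])
    show "(f has_derivative ?f' z) (at z within cball 0 R)" for z
      using smooth_has_derivative[OF assms] has_derivative_at_withinI by blast
    show "onorm (?f' z) \<le> L" if "z \<in> cball 0 R" for z
      using bound that L_pos by (intro onorm_le) (auto simp: dist_norm)
  qed (use that in auto)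
  with L_pos bound that show ?thesis
    by blast
qed

section \<open>Symmetry of the second derivative\<close>

lemma smooth_line_derivative:
  fixes \<phi> :: "'a::real_normed_vector \<Rightarrow> real"
  assumes "smooth \<phi>"
  shows "((\<lambda>s. \<phi> (y + s *\<^sub>R u)) has_real_derivative frechet_derivative \<phi> (at (y + s *\<^sub>R u)) u) (at s)"
proof -
  have "((\<lambda>s. \<phi> (y + s *\<^sub>R u)) has_derivative (\<lambda>t. frechet_derivative \<phi> (at (y + s *\<^sub>R u)) (t *\<^sub>R u))) (at s)"
    by (rule has_derivative_compose[OF _ smooth_has_derivative[OF assms]]) (auto intro!: derivative_eq_intros)
  then show ?thesis
    by (simp add: has_field_derivative_def linear_scale[OF smooth_linear_derivative[OF assms]] mult.commute[of _ "frechet_derivative _ _ _"])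
qed

lemma second_difference_mean_value:
  fixes \<phi> :: "'a::real_normed_vector \<Rightarrow> real"
  assumes "smooth \<phi>" and "0 < h"
  obtains s t where "0 < s" "s < h" "0 < t" "t < h"
    "\<phi> (x + h *\<^sub>R u + h *\<^sub>R v) - \<phi> (x + h *\<^sub>R u) - \<phi> (x + h *\<^sub>R v) + \<phi> x =
      h * (h * frechet_derivative (\<lambda>x. frechet_derivative \<phi> (at x) u) (at (x + s *\<^sub>R u + t *\<^sub>R v)) v)"
proof -
  let ?d = "\<lambda>y. frechet_derivative \<phi> (at y) u"
  have "((\<lambda>s. \<phi> ((x + h *\<^sub>R v) + s *\<^sub>R u) - \<phi> (x + s *\<^sub>R u)) has_real_derivative
      (?d ((x + h *\<^sub>R v) + s *\<^sub>R u) - ?d (x + s *\<^sub>R u))) (at s)" for s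
    by (intro DERIV_diff smooth_line_derivative assms)
  from MVT2[OF assms(2) this]
  obtain s where s: "0 < s" "s < h"
    "\<phi> ((x + h *\<^sub>R v) + h *\<^sub>R u) - \<phi> (x + h *\<^sub>R u) - (\<phi> ((x + h *\<^sub>R v) + 0 *\<^sub>R u) - \<phi> (x + 0 *\<^sub>R u))
      = (h - 0) * (?d ((x + h *\<^sub>R v) + s *\<^sub>R u) - ?d (x + s *\<^sub>R u))"
    by blast
  have "((\<lambda>t. ?d ((x + s *\<^sub>R u) + t *\<^sub>R v)) has_real_derivative
      frechet_derivative ?d (at ((x + s *\<^sub>R u) + t *\<^sub>R v)) v) (at t)" for t
    by (intro smooth_line_derivative smooth_frechet_derivative assms)
  from MVT2[OF assms(2) this]
  obtain t where t: "0 < t" "t < h"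
    "?d ((x + s *\<^sub>R u) + h *\<^sub>R v) - ?d ((x + s *\<^sub>R u) + 0 *\<^sub>R v)
      = (h - 0) * frechet_derivative ?d (at ((x + s *\<^sub>R u) + t *\<^sub>R v)) v"
    by blast
  show ?thesis
    by (rule that[OF s(1,2) t(1,2)]) (use s(3) t(3) in \<open>simp add: algebra_simps\<close>)
qed

text \<open>Both orders of differentiation are limits of the same second difference quotient.\<close>

lemma smooth_second_derivative_symmetric:
  fixes \<phi> :: "'a::real_normed_vector \<Rightarrow> real"
  assumes "smooth \<phi>"
  shows "frechet_derivative (\<lambda>x. frechet_derivative \<phi> (at x) u) (at x) v =
    frechet_derivative (\<lambda>x. frechet_derivative \<phi> (at x) v) (at x) u" (is "?F x = ?G x")
proof (rule ccontr)
  assume "?F x \<noteq> ?G x"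
  then have e: "0 < \<bar>?F x - ?G x\<bar> / 2"
    by simp
  have cont: "isCont ?F x" "isCont ?G x"
    using smooth_continuous_on[OF smooth_frechet_derivative[OF smooth_frechet_derivative[OF assms]], of UNIV]
    by (auto simp: continuous_on_eq_continuous_at)
  obtain d1 where d1: "0 < d1" "\<And>y. dist y x < d1 \<Longrightarrow> dist (?F y) (?F x) < \<bar>?F x - ?G x\<bar> / 2"
    using cont(1) e unfolding continuous_at_eps_delta by blast
  obtain d2 where d2: "0 < d2" "\<And>y. dist y x < d2 \<Longrightarrow> dist (?G y) (?G x) < \<bar>?F x - ?G x\<bar> / 2"
    using cont(2) e unfolding continuous_at_eps_delta by blast
  \<comment> \<open>All points \<open>x + s u + t v\<close> with \<open>0 < s, t < h\<close> lie within both continuity radii.\<close>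
  define h where "h = min d1 d2 / (1 + norm u + norm v)"
  have pos: "0 < 1 + norm u + norm v"
    by (simp add: add_pos_nonneg)
  then have h: "0 < h"
    using d1(1) d2(1) by (simp add: h_def)
  have small: "h * (norm u + norm v) < min d1 d2"
  proof -
    have "h * (1 + norm u + norm v) = min d1 d2"
      using pos by (simp add: h_def)
    then show "h * (norm u + norm v) < min d1 d2"
      using \<open>0 < h\<close> by (simp add: algebra_simps del: min_less_iff_conj)
  qed
  have near: "dist (x + s *\<^sub>R u + t *\<^sub>R v) x < min d1 d2" if "0 < s" "s < h" "0 < t" "t < h" for s t
  proof -
    have "dist (x + s *\<^sub>R u + t *\<^sub>R v) x = norm (s *\<^sub>R u + t *\<^sub>R v)"
      by (simp add: dist_norm)
    also have "\<dots> \<le> s * norm u + t * norm v"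
      using that by (intro norm_triangle_le) simp
    also have "\<dots> \<le> h * norm u + h * norm v"
      using that by (intro add_mono mult_right_mono) auto
    finally show ?thesis
      using small by (simp add: algebra_simps)
  qed
  obtain s t where st: "0 < s" "s < h" "0 < t" "t < h"
    "\<phi> (x + h *\<^sub>R u + h *\<^sub>R v) - \<phi> (x + h *\<^sub>R u) - \<phi> (x + h *\<^sub>R v) + \<phi> x = h * (h * ?F (x + s *\<^sub>R u + t *\<^sub>R v))"
    by (rule second_difference_mean_value[OF assms h])
  obtain s' t' where st': "0 < s'" "s' < h" "0 < t'" "t' < h"
    "\<phi> (x + h *\<^sub>R v + h *\<^sub>R u) - \<phi> (x + h *\<^sub>R v) - \<phi> (x + h *\<^sub>R u) + \<phi> x = h * (h * ?G (x + s' *\<^sub>R v + t' *\<^sub>R u))"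
    by (rule second_difference_mean_value[OF assms h])
  have "h * (h * ?F (x + s *\<^sub>R u + t *\<^sub>R v)) = h * (h * ?G (x + t' *\<^sub>R u + s' *\<^sub>R v))"
    using st(5) st'(5) by (simp add: algebra_simps)
  then have "?F (x + s *\<^sub>R u + t *\<^sub>R v) = ?G (x + t' *\<^sub>R u + s' *\<^sub>R v)"
    using h by simp
  then show False
    using d1(2)[of "x + s *\<^sub>R u + t *\<^sub>R v"] d2(2)[of "x + t' *\<^sub>R u + s' *\<^sub>R v"]
      near[OF st(1-4)] near[OF st'(3,4,1,2)]
    by (simp add: dist_real_def) (smt (verit) field_sum_of_halves)
qed

section \<open>The equation X = c + h G(X) for small h\<close>

text \<open>For small \<open>h\<close> the right-hand side is a contraction of a ball around \<open>c\<close>; the constants only depend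
  on a bound for \<open>c\<close>.\<close>

lemma implicit_equation_exists:
  fixes G :: "'a::euclidean_space \<Rightarrow> 'a"
  assumes "smooth G" and "0 < \<rho>"
  obtains h0 where "0 < h0"
    "\<And>h c. 0 \<le> h \<Longrightarrow> h < h0 \<Longrightarrow> norm c \<le> R \<Longrightarrow> \<exists>X. norm (X - c) \<le> \<rho> \<and> X = c + h *\<^sub>R G X"
proof -
  obtain L where L: "0 < L"
    "\<And>X v. norm X \<le> R + \<rho> \<Longrightarrow> norm (frechet_derivative G (at X) v) \<le> L * norm v"
    "\<And>X Y. norm X \<le> R + \<rho> \<Longrightarrow> norm Y \<le> R + \<rho> \<Longrightarrow> norm (G X - G Y) \<le> L * norm (X - Y)"
    using smooth_lipschitz_on_cball[OF assms(1), where R = "R + \<rho>"] by metis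
  obtain M where M: "0 < M" "\<And>X. norm X \<le> R + \<rho> \<Longrightarrow> norm (G X) \<le> M"
    using bounded_on_cball[OF smooth_continuous_on[OF assms(1)], where R = "R + \<rho>"] by metis
  \<comment> \<open>The first bound keeps the ball invariant, the second one makes \<open>1/2\<close> a contraction constant.\<close>
  define h0 where "h0 = min (\<rho> / M) (1 / (2 * L))"
  show ?thesis
  proof
    show "0 < h0"
      using L M assms by (simp add: h0_def)
    fix h :: real and c :: 'a
    assume h: "0 \<le> h" "h < h0" and c: "norm c \<le> R"
    have hM: "h * M \<le> \<rho>" and hL: "h * L \<le> 1 / 2"
      using h L(1) M(1) by (auto simp: h0_def field_simps)
    have in_ball: "norm X \<le> R + \<rho>" if "X \<in> cball c \<rho>" for X :: 'a
      using that c norm_triangle_ineq2[of X c] by (simp add: dist_norm norm_minus_commute)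
    have "\<exists>!X\<in>cball c \<rho>. c + h *\<^sub>R G X = X"
    proof (rule Banach_fix[where c = "1/2"])
      show "complete (cball c \<rho>)" "cball c \<rho> \<noteq> {}"
        using assms(2) by (auto simp: complete_eq_closed)
      show "(\<lambda>X. c + h *\<^sub>R G X) ` cball c \<rho> \<subseteq> cball c \<rho>"
      proof clarify
        fix X assume "X \<in> cball c \<rho>"
        then have "h * norm (G X) \<le> h * M"
          using h(1) M(2) in_ball by (simp add: mult_left_mono)
        then show "c + h *\<^sub>R G X \<in> cball c \<rho>"
          using h(1) hM by (simp add: dist_norm)
      qed
      fix X Y assume XY: "X \<in> cball c \<rho>" "Y \<in> cball c \<rho>"
      have "dist (c + h *\<^sub>R G X) (c + h *\<^sub>R G Y) = h * norm (G X - G Y)"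
        using h(1) by (simp add: dist_norm scaleR_diff_right[symmetric])
      also have "\<dots> \<le> h * (L * norm (X - Y))"
        using h(1) L(3) in_ball XY by (intro mult_left_mono) auto
      also have "\<dots> \<le> 1/2 * norm (X - Y)"
        using mult_right_mono[OF hL norm_ge_zero[of "X - Y"]] by (simp add: mult.assoc)
      finally show "dist (c + h *\<^sub>R G X) (c + h *\<^sub>R G Y) \<le> 1/2 * dist X Y"
        by (simp add: dist_norm)
    qed auto
    then obtain X where X: "X \<in> cball c \<rho>" "c + h *\<^sub>R G X = X"
      by blast
    show "\<exists>X. norm (X - c) \<le> \<rho> \<and> X = c + h *\<^sub>R G X"
    proof (intro exI conjI)
      show "norm (X - c) \<le> \<rho>"
        using X(1) by (simp add: dist_norm norm_minus_commute)
      show "X = c + h *\<^sub>R G X"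
        using X(2) by simp
    qed
  qed
qed

text \<open>For \<open>c = c'\<close> this is uniqueness among all solutions of norm at most \<open>R\<close>.\<close>

lemma implicit_equation_stable:
  fixes G :: "'a::euclidean_space \<Rightarrow> 'a"
  assumes "smooth G"
  obtains h0 where "0 < h0"
    "\<And>h c c' X Y. \<lbrakk>0 \<le> h; h < h0; norm X \<le> R; norm Y \<le> R; X = c + h *\<^sub>R G X; Y = c' + h *\<^sub>R G Y\<rbrakk>
       \<Longrightarrow> norm (X - Y) \<le> 2 * norm (c - c')"
proof -
  obtain L where L: "0 < L"
    "\<And>X v. norm X \<le> R \<Longrightarrow> norm (frechet_derivative G (at X) v) \<le> L * norm v"
    "\<And>X Y. norm X \<le> R \<Longrightarrow> norm Y \<le> R \<Longrightarrow> norm (G X - G Y) \<le> L * norm (X - Y)"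
    using smooth_lipschitz_on_cball[OF assms(1), where R = "R"] by metis
  show ?thesis
  proof
    show "0 < 1 / (2 * L)"
      using L(1) by simp
    fix h :: real and c c' X Y :: 'a
    assume h: "0 \<le> h" "h < 1 / (2 * L)" and R: "norm X \<le> R" "norm Y \<le> R"
      and X: "X = c + h *\<^sub>R G X" and Y: "Y = c' + h *\<^sub>R G Y"
    have hL: "h * L \<le> 1/2"
      using h L(1) by (simp add: field_simps)
    have "X - Y = (c - c') + h *\<^sub>R (G X - G Y)"
      by (subst X, subst Y) (simp add: algebra_simps)
    then have "norm (X - Y) \<le> norm (c - c') + h * norm (G X - G Y)"
      using norm_triangle_ineq[of "c - c'" "h *\<^sub>R (G X - G Y)"] h(1) by simp
    also have "h * norm (G X - G Y) \<le> h * (L * norm (X - Y))"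
      using h(1) L(3)[OF R] by (rule mult_left_mono[rotated])
    also have "\<dots> \<le> 1/2 * norm (X - Y)"
      using mult_right_mono[OF hL norm_ge_zero[of "X - Y"]] by (simp add: mult.assoc)
    finally show "norm (X - Y) \<le> 2 * norm (c - c')"
      by simp
  qed
qed

text \<open>The solution operator is a right inverse of \<open>X \<mapsto> X - h G(X)\<close>, whose derivative is
  injective, hence invertible, when \<open>h\<close> is small. Differentiating the equation gives the
  linearised equation for the derivative of the solution operator.\<close>

lemma implicit_equation_derivative:
  fixes G :: "'a::euclidean_space \<Rightarrow> 'a"
  assumes "smooth G"
  obtains h0 where "0 < h0"
    "\<And>h g T c. \<lbrakk>0 \<le> h; h < h0; open T; c \<in> T; \<And>c'. c' \<in> T \<Longrightarrow> norm (g c') \<le> R;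
       \<And>c'. c' \<in> T \<Longrightarrow> g c' = c' + h *\<^sub>R G (g c')\<rbrakk>
     \<Longrightarrow> \<exists>D. (g has_derivative D) (at c) \<and>
           (\<forall>v. D v = v + h *\<^sub>R frechet_derivative G (at (g c)) (D v))"
proof -
  obtain L where L: "0 < L"
    "\<And>X v. norm X \<le> R \<Longrightarrow> norm (frechet_derivative G (at X) v) \<le> L * norm v"
    "\<And>X Y. norm X \<le> R \<Longrightarrow> norm Y \<le> R \<Longrightarrow> norm (G X - G Y) \<le> L * norm (X - Y)"
    using smooth_lipschitz_on_cball[OF assms, where R = "R"] by metis
  obtain h1 where h1: "0 < h1"
    "\<And>h c c' X Y. \<lbrakk>0 \<le> h; h < h1; norm X \<le> R; norm Y \<le> R; X = c + h *\<^sub>R G X; Y = c' + h *\<^sub>R G Y\<rbrakk>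
       \<Longrightarrow> norm (X - Y) \<le> 2 * norm (c - c')"
    using implicit_equation_stable[OF assms, where R = R] by metis
  show ?thesis
  proof
    show "0 < min h1 (1 / (2 * L))"
      using L(1) h1(1) by simp
    fix h :: real and g :: "'a \<Rightarrow> 'a" and T :: "'a set" and c :: 'a
    assume h: "0 \<le> h" "h < min h1 (1 / (2 * L))" and T: "open T" "c \<in> T"
      and R: "\<And>c'. c' \<in> T \<Longrightarrow> norm (g c') \<le> R" and g: "\<And>c'. c' \<in> T \<Longrightarrow> g c' = c' + h *\<^sub>R G (g c')"
    define \<Theta> where "\<Theta> v = v - h *\<^sub>R frechet_derivative G (at (g c)) v" for v
    have lin: "linear (frechet_derivative G (at (g c)))"
      by (rule smooth_linear_derivative[OF assms])
    have \<Theta>_lin: "linear \<Theta>"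
      unfolding \<Theta>_def by (intro linear_compose_sub linear_compose_scale_right lin linear_ident[unfolded id_def])
    have "v = 0" if "\<Theta> v = 0" for v
    proof -
      have "v = h *\<^sub>R frechet_derivative G (at (g c)) v"
        using that by (simp add: \<Theta>_def)
      then have "norm v = h * norm (frechet_derivative G (at (g c)) v)"
        using h(1) by (metis abs_of_nonneg norm_scaleR)
      also have "\<dots> \<le> h * (L * norm v)"
        using h(1) L(2)[OF R[OF T(2)]] by (rule mult_left_mono[rotated])
      also have "\<dots> \<le> 1/2 * norm v"
        using mult_right_mono[of "h * L" "1/2" "norm v"] h L(1) by (simp add: field_simps)
      finally show ?thesis
        by simp
    qed
    then have "inj \<Theta>"
      using linear_injective_0[OF \<Theta>_lin] by blast
    then obtain D where D: "linear D" "D \<circ> \<Theta> = id"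
      using linear_injective_left_inverse[OF \<Theta>_lin] by blast
    then have D': "\<Theta> \<circ> D = id"
      using linear_inverse_left[OF \<Theta>_lin D(1)] by blast
    have deriv: "((\<lambda>X. X - h *\<^sub>R G X) has_derivative \<Theta>) (at (g c))"
      unfolding \<Theta>_def[abs_def]
      by (intro has_derivative_diff has_derivative_scaleR_right has_derivative_ident
          smooth_has_derivative assms)
    have "(g has_derivative D) (at c)"
    proof (rule has_derivative_inverse_basic[where f' = \<Theta> and g' = D and T = T and f = "\<lambda>X. X - h *\<^sub>R G X"])
      show "((\<lambda>X. X - h *\<^sub>R G X) has_derivative \<Theta>) (at (g c))" "D \<circ> \<Theta> = id" "open T" "c \<in> T"
        by (fact deriv D(2) T)+
      show "bounded_linear D"
        using D(1) by (simp add: linear_conv_bounded_linear)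
      show "continuous (at c) g"
        unfolding continuous_at_eps_delta
      proof (intro allI impI)
        fix e :: real assume "0 < e"
        obtain d where d: "0 < d" "ball c d \<subseteq> T"
          using T open_contains_ball by blast
        have "dist (g c') (g c) < e" if "dist c' c < min d (e / 2)" for c'
        proof -
          have "c' \<in> T"
            using d(2) that by (auto simp: dist_commute)
          then have "norm (g c' - g c) \<le> 2 * norm (c' - c)"
            using h T(2) R g by (intro h1(2)[of h]) auto
          then show ?thesis
            using that by (simp add: dist_norm)
        qed
        then show "\<exists>d>0. \<forall>c'. dist c' c < d \<longrightarrow> dist (g c') (g c) < e"
          using d(1) \<open>0 < e\<close> by (intro exI[of _ "min d (e / 2)"]) auto
      qed
      show "g c' - h *\<^sub>R G (g c') = c'" if "c' \<in> T" for c'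
        using g[OF that] by (metis add_diff_cancel_right')
    qed
    moreover have "D v = v + h *\<^sub>R frechet_derivative G (at (g c)) (D v)" for v
      using fun_cong[OF D', of v] by (simp add: \<Theta>_def algebra_simps)
    ultimately show "\<exists>D. (g has_derivative D) (at c) \<and>
        (\<forall>v. D v = v + h *\<^sub>R frechet_derivative G (at (g c)) (D v))"
      by blast
  qed
qed

definition picard_iterate :: "('a::real_vector \<Rightarrow> 'a) \<Rightarrow> nat \<Rightarrow> 'a \<Rightarrow> real \<Rightarrow> 'a" where
  "picard_iterate G m c h = ((\<lambda>X. c + h *\<^sub>R G X) ^^ m) c"

lemma picard_iterate_simps [simp]:
  "picard_iterate G 0 c h = c"
  "picard_iterate G (Suc m) c h = c + h *\<^sub>R G (picard_iterate G m c h)"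
  by (simp_all add: picard_iterate_def)

text \<open>In contrast to the solution, the iterates are explicit in \<open>h\<close>; each iteration gains one power of
  \<open>h\<close>.\<close>

lemma picard_iterate_error:
  fixes G :: "'a::euclidean_space \<Rightarrow> 'a"
  assumes "smooth G"
  obtains h0 L where "0 < h0" "0 < L"
    "\<And>h c X m. \<lbrakk>0 \<le> h; h < h0; norm c \<le> R; norm (X - c) \<le> 1; X = c + h *\<^sub>R G X\<rbrakk>
       \<Longrightarrow> norm (picard_iterate G m c h) \<le> R + 1 \<and> norm (picard_iterate G m c h - X) \<le> (L * h) ^ m"
proof -
  obtain L where L: "0 < L"
    "\<And>X v. norm X \<le> R + 1 \<Longrightarrow> norm (frechet_derivative G (at X) v) \<le> L * norm v"
    "\<And>X Y. norm X \<le> R + 1 \<Longrightarrow> norm Y \<le> R + 1 \<Longrightarrow> norm (G X - G Y) \<le> L * norm (X - Y)"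
    using smooth_lipschitz_on_cball[OF assms(1), where R = "R + 1"] by metis
  obtain M where M: "0 < M" "\<And>X. norm X \<le> R + 1 \<Longrightarrow> norm (G X) \<le> M"
    using bounded_on_cball[OF smooth_continuous_on[OF assms(1)], where R = "R + 1"] by metis
  show ?thesis
  proof
    show "0 < 1 / M" "0 < L"
      using L M by auto
    fix h :: real and c X :: 'a and m :: nat
    assume h: "0 \<le> h" "h < 1 / M" and c: "norm c \<le> R" "norm (X - c) \<le> 1" and X: "X = c + h *\<^sub>R G X"
    have XR: "norm X \<le> R + 1"
      using c norm_triangle_ineq2[of X c] by simp
    show "norm (picard_iterate G m c h) \<le> R + 1 \<and> norm (picard_iterate G m c h - X) \<le> (L * h) ^ m"
    proof (induction m)
      case 0
      then show ?case
        using c by (simp add: norm_minus_commute)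
    next
      case (Suc m)
      let ?Y = "picard_iterate G m c h"
      have "norm (c + h *\<^sub>R G ?Y) \<le> norm c + h * norm (G ?Y)"
        using norm_triangle_ineq[of c "h *\<^sub>R G ?Y"] h(1) by simp
      also have "\<dots> \<le> R + h * M"
        using c Suc M(2) h(1) by (intro add_mono mult_left_mono) auto
      also have "\<dots> \<le> R + 1"
        using h M(1) by (simp add: field_simps)
      finally have 1: "norm (c + h *\<^sub>R G ?Y) \<le> R + 1" .
      have "c + h *\<^sub>R G ?Y - X = h *\<^sub>R (G ?Y - G X)"
        by (subst X) (simp add: algebra_simps)
      then have "norm (c + h *\<^sub>R G ?Y - X) = h * norm (G ?Y - G X)"
        using h(1) by simp
      also have "\<dots> \<le> h * (L * norm (?Y - X))"
        using h(1) L(3) Suc XR by (intro mult_left_mono) auto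
      also have "\<dots> \<le> h * (L * (L * h) ^ m)"
        using h(1) L(1) Suc by (intro mult_left_mono) auto
      also have "\<dots> = (L * h) ^ Suc m"
        by simp
      finally show ?case
        using 1 by simp
    qed
  qed
qed

section \<open>Taylor expansion with uniform remainder\<close>

text \<open>The parameter \<open>p\<close> will be a time along a solution and \<open>h\<close> the step size. The intervals \<open>[0, c p]\<close>
  depend on \<open>p\<close> because the solution ends at a fixed time, and derivatives are one-sided at their end
  points because the solution is not defined outside.\<close>

primrec uniformly_C_k ::
  "nat \<Rightarrow> 'p set \<Rightarrow> ('p \<Rightarrow> real) \<Rightarrow> ('p \<Rightarrow> real \<Rightarrow> 'a::real_normed_vector) \<Rightarrow> bool" where
  "uniformly_C_k 0 P c g \<longleftrightarrow> (\<exists>M. \<forall>p\<in>P. \<forall>h\<in>{0..c p}. norm (g p h) \<le> M)"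
| "uniformly_C_k (Suc k) P c g \<longleftrightarrow> (\<exists>M. \<forall>p\<in>P. \<forall>h\<in>{0..c p}. norm (g p h) \<le> M) \<and>
     (\<exists>g'. (\<forall>p\<in>P. \<forall>h\<in>{0..c p}. (g p has_vector_derivative g' p h) (at h within {0..c p})) \<and>
        uniformly_C_k k P c g')"

lemma uniformly_C_k_SucD: "uniformly_C_k (Suc k) P c g \<Longrightarrow> uniformly_C_k k P c g"
proof (induction k arbitrary: g)
  case (Suc k)
  then obtain g' where
    "\<forall>p\<in>P. \<forall>h\<in>{0..c p}. (g p has_vector_derivative g' p h) (at h within {0..c p})"
    "uniformly_C_k (Suc k) P c g'"
    unfolding uniformly_C_k.simps(2)[of "Suc k"] by blast
  moreover have "\<exists>M. \<forall>p\<in>P. \<forall>h\<in>{0..c p}. norm (g p h) \<le> M"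
    using Suc.prems by simp
  ultimately show ?case
    using Suc.IH[of g'] unfolding uniformly_C_k.simps(2)[of k P c g] by blast
qed simp

lemma uniformly_C_k_SucI:
  assumes "\<And>p h. p \<in> P \<Longrightarrow> h \<in> {0..c p} \<Longrightarrow> norm (g p h) \<le> M"
    and "\<And>p h. p \<in> P \<Longrightarrow> h \<in> {0..c p} \<Longrightarrow> (g p has_vector_derivative g' p h) (at h within {0..c p})"
    and "uniformly_C_k k P c g'"
  shows "uniformly_C_k (Suc k) P c g"
  using assms unfolding uniformly_C_k.simps(2) by blast

lemma uniformly_C_k_const:
  assumes "\<And>p. p \<in> P \<Longrightarrow> norm (a p) \<le> M"
  shows "uniformly_C_k k P c (\<lambda>p h. a p)"
proof -
  have zero: "uniformly_C_k k P c (\<lambda>p h. 0)" for k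
  proof (induction k)
    case (Suc k)
    show ?case
      by (rule uniformly_C_k_SucI[where g' = "\<lambda>p h. 0" and M = 0]) (use Suc in auto)
  qed auto
  show ?thesis
  proof (cases k)
    case (Suc k')
    show ?thesis unfolding Suc
      by (rule uniformly_C_k_SucI[where g' = "\<lambda>p h. 0" and M = M]) (use assms zero in auto)
  qed (use assms in auto)
qed

lemma uniformly_C_k_ident:
  assumes "\<And>p. p \<in> P \<Longrightarrow> c p \<le> C"
  shows "uniformly_C_k k P c (\<lambda>p h. h)"
proof -
  have bound: "norm h \<le> C" if "p \<in> P" "h \<in> {0..c p}" for p h
    using that assms[of p] by simp
  show ?thesis
  proof (cases k)
    case 0
    show ?thesis
      unfolding 0 uniformly_C_k.simps using bound by blast
  next
    case (Suc k')
    show ?thesis unfolding Suc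
      by (rule uniformly_C_k_SucI[where g' = "\<lambda>p h. 1" and M = C])
        (auto intro: order_trans[OF _ assms] has_vector_derivative_id uniformly_C_k_const[where a = "\<lambda>_. 1" and M = 1])
  qed
qed

lemma uniformly_C_k_add:
  "uniformly_C_k k P c f \<Longrightarrow> uniformly_C_k k P c g \<Longrightarrow> uniformly_C_k k P c (\<lambda>p h. f p h + g p h)"
proof (induction k arbitrary: f g)
  case 0
  then obtain M N where "\<forall>p\<in>P. \<forall>h\<in>{0..c p}. norm (f p h) \<le> M" "\<forall>p\<in>P. \<forall>h\<in>{0..c p}. norm (g p h) \<le> N"
    by auto
  then show ?case
    by (auto intro!: exI[of _ "M + N"] norm_triangle_mono)
next
  case (Suc k)
  obtain M N where "\<forall>p\<in>P. \<forall>h\<in>{0..c p}. norm (f p h) \<le> M" "\<forall>p\<in>P. \<forall>h\<in>{0..c p}. norm (g p h) \<le> N"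
    using Suc.prems unfolding uniformly_C_k.simps(2) by blast
  then have bound: "norm (f p h + g p h) \<le> M + N" if "p \<in> P" "h \<in> {0..c p}" for p h
    using that by (intro norm_triangle_mono) auto
  obtain f' where f': "\<forall>p\<in>P. \<forall>h\<in>{0..c p}. (f p has_vector_derivative f' p h) (at h within {0..c p})"
    "uniformly_C_k k P c f'"
    using Suc.prems(1) unfolding uniformly_C_k.simps(2) by blast
  obtain g' where g': "\<forall>p\<in>P. \<forall>h\<in>{0..c p}. (g p has_vector_derivative g' p h) (at h within {0..c p})"
    "uniformly_C_k k P c g'"
    using Suc.prems(2) unfolding uniformly_C_k.simps(2) by blast
  show ?case
    by (rule uniformly_C_k_SucI[OF bound _ Suc.IH[OF f'(2) g'(2)]])
       (use f' g' in \<open>auto intro: has_vector_derivative_add\<close>)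
qed

lemma uniformly_C_k_bounded_linear:
  assumes L: "bounded_linear L"
  shows "uniformly_C_k k P c g \<Longrightarrow> uniformly_C_k k P c (\<lambda>p h. L (g p h))"
proof (induction k arbitrary: g)
  case 0
  obtain K where "0 \<le> K" "\<And>x. norm (L x) \<le> norm x * K"
    using bounded_linear.nonneg_bounded[OF L] by blast
  moreover obtain M where "\<forall>p\<in>P. \<forall>h\<in>{0..c p}. norm (g p h) \<le> M"
    using 0 by auto
  ultimately show ?case
    by (auto intro!: exI[of _ "M * K"] intro: order_trans[OF _ mult_right_mono])
next
  case (Suc k)
  obtain K where K: "0 \<le> K" "\<And>x. norm (L x) \<le> norm x * K"
    using bounded_linear.nonneg_bounded[OF L] by blast
  obtain M where M: "\<forall>p\<in>P. \<forall>h\<in>{0..c p}. norm (g p h) \<le> M"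
    using Suc.prems unfolding uniformly_C_k.simps(2) by blast
  have bound: "norm (L (g p h)) \<le> M * K" if "p \<in> P" "h \<in> {0..c p}" for p h
    using M that K by (intro order_trans[OF K(2) mult_right_mono]) auto
  obtain g' where g': "\<forall>p\<in>P. \<forall>h\<in>{0..c p}. (g p has_vector_derivative g' p h) (at h within {0..c p})"
    "uniformly_C_k k P c g'"
    using Suc.prems unfolding uniformly_C_k.simps(2) by blast
  show ?case
    by (rule uniformly_C_k_SucI[OF bound _ Suc.IH[OF g'(2)]])
       (use g' in \<open>auto intro: bounded_linear.has_vector_derivative[OF L]\<close>)
qed

lemma uniformly_C_k_sum:
  assumes "\<And>i. i \<in> I \<Longrightarrow> uniformly_C_k k P c (f i)"
  shows "uniformly_C_k k P c (\<lambda>p h. \<Sum>i\<in>I. f i p h)"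
  using assms
  by (induction I rule: infinite_finite_induct)
     (auto intro: uniformly_C_k_add uniformly_C_k_const[where a = "\<lambda>_. 0" and M = 0])

lemma uniformly_C_k_scaleR:
  "uniformly_C_k k P c f \<Longrightarrow> uniformly_C_k k P c g \<Longrightarrow> uniformly_C_k k P c (\<lambda>p h. f p h *\<^sub>R g p h)"
proof (induction k arbitrary: f g)
  case 0
  then obtain M N where "\<forall>p\<in>P. \<forall>h\<in>{0..c p}. norm (f p h) \<le> M" "\<forall>p\<in>P. \<forall>h\<in>{0..c p}. norm (g p h) \<le> N"
    by auto
  then have "norm (f p h *\<^sub>R g p h) \<le> \<bar>M\<bar> * \<bar>N\<bar>" if "p \<in> P" "h \<in> {0..c p}" for p h
    unfolding norm_scaleR real_norm_def[symmetric]
    using that by (intro mult_mono) (auto intro!: order_trans[OF _ abs_ge_self])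
  then show ?case
    unfolding uniformly_C_k.simps by blast
next
  case (Suc k)
  obtain M N where "\<forall>p\<in>P. \<forall>h\<in>{0..c p}. norm (f p h) \<le> M" "\<forall>p\<in>P. \<forall>h\<in>{0..c p}. norm (g p h) \<le> N"
    using Suc.prems unfolding uniformly_C_k.simps(2) by blast
  then have bound: "norm (f p h *\<^sub>R g p h) \<le> \<bar>M\<bar> * \<bar>N\<bar>" if "p \<in> P" "h \<in> {0..c p}" for p h
    unfolding norm_scaleR real_norm_def[symmetric]
    using that by (intro mult_mono) (auto intro!: order_trans[OF _ abs_ge_self])
  obtain f' where f': "\<forall>p\<in>P. \<forall>h\<in>{0..c p}. (f p has_vector_derivative f' p h) (at h within {0..c p})"
    "uniformly_C_k k P c f'"
    using Suc.prems(1) unfolding uniformly_C_k.simps(2) by blast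
  obtain g' where g': "\<forall>p\<in>P. \<forall>h\<in>{0..c p}. (g p has_vector_derivative g' p h) (at h within {0..c p})"
    "uniformly_C_k k P c g'"
    using Suc.prems(2) unfolding uniformly_C_k.simps(2) by blast
  have deriv: "((\<lambda>h. f p h *\<^sub>R g p h) has_vector_derivative (f p h *\<^sub>R g' p h + f' p h *\<^sub>R g p h))
      (at h within {0..c p})" if "p \<in> P" "h \<in> {0..c p}" for p h
    using f'(1) g'(1) that
    by (intro has_vector_derivative_scaleR) (auto simp: has_real_derivative_iff_has_vector_derivative)
  show ?case
  proof (rule uniformly_C_k_SucI[OF bound deriv])
    show "uniformly_C_k k P c (\<lambda>p h. f p h *\<^sub>R g' p h + f' p h *\<^sub>R g p h)"
      by (intro uniformly_C_k_add Suc.IH f'(2) g'(2) uniformly_C_k_SucD[OF Suc.prems(1)]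
          uniformly_C_k_SucD[OF Suc.prems(2)])
  qed
qed

lemma uniformly_C_k_compose:
  fixes g :: "'p \<Rightarrow> real \<Rightarrow> 'a::euclidean_space"
  shows "smooth F \<Longrightarrow> uniformly_C_k k P c g \<Longrightarrow> uniformly_C_k k P c (\<lambda>p h. F (g p h))"
proof (induction k arbitrary: F)
  case 0
  then obtain M where M: "\<forall>p\<in>P. \<forall>h\<in>{0..c p}. norm (g p h) \<le> M"
    by auto
  obtain N where "\<And>x. norm x \<le> M \<Longrightarrow> norm (F x) \<le> N"
    using bounded_on_cball[OF smooth_continuous_on[OF 0(1)], where R = M] by metis
  with M show ?case
    by auto
next
  case (Suc k)
  let ?F' = "\<lambda>x. frechet_derivative F (at x)"
  obtain M where M: "\<forall>p\<in>P. \<forall>h\<in>{0..c p}. norm (g p h) \<le> M"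
    using Suc.prems unfolding uniformly_C_k.simps(2) by blast
  obtain N where "\<And>x. norm x \<le> M \<Longrightarrow> norm (F x) \<le> N"
    using bounded_on_cball[OF smooth_continuous_on[OF Suc.prems(1)], where R = M] by metis
  with M have bound: "norm (F (g p h)) \<le> N" if "p \<in> P" "h \<in> {0..c p}" for p h
    using that by auto
  obtain g' where g': "\<forall>p\<in>P. \<forall>h\<in>{0..c p}. (g p has_vector_derivative g' p h) (at h within {0..c p})"
    "uniformly_C_k k P c g'"
    using Suc.prems(2) unfolding uniformly_C_k.simps(2) by blast
  have deriv: "((\<lambda>h. F (g p h)) has_vector_derivative ?F' (g p h) (g' p h)) (at h within {0..c p})"
    if "p \<in> P" "h \<in> {0..c p}" for p h
    using vector_derivative_diff_chain_within[of "g p" "g' p h" h "{0..c p}" F "?F' (g p h)"]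
      g'(1) that has_derivative_at_withinI[OF smooth_has_derivative[OF Suc.prems(1)]]
    by (auto simp: o_def)
  have expand: "?F' x v = (\<Sum>b\<in>Basis. (v \<bullet> b) *\<^sub>R ?F' x b)" for x v
    by (rule linear_basis_expansion[OF smooth_linear_derivative[OF Suc.prems(1)]])
  have "uniformly_C_k k P c (\<lambda>p h. ?F' (g p h) (g' p h))"
    unfolding expand[of "g _ _" "g' _ _"]
    by (intro uniformly_C_k_sum uniformly_C_k_scaleR uniformly_C_k_bounded_linear[OF bounded_linear_inner_left]
        Suc.IH smooth_frechet_derivative Suc.prems(1) g'(2) uniformly_C_k_SucD[OF Suc.prems(2)])
  then show ?case
    using bound deriv by (intro uniformly_C_k_SucI[where M = N and g' = "\<lambda>p h. ?F' (g p h) (g' p h)"])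
qed

text \<open>Taylor's formula by repeated integration: an expansion of the derivative, integrated term by
  term, is an expansion of the function, and the mean value inequality bounds the remainder.\<close>

lemma uniformly_C_k_taylor:
  assumes "uniformly_C_k k P c g"
  shows "\<exists>a M. \<forall>p\<in>P. \<forall>h\<in>{0..c p}. norm (g p h - (\<Sum>j<k. h ^ j *\<^sub>R a p j)) \<le> M * h ^ k"
  using assms
proof (induction k arbitrary: g)
  case 0
  then show ?case by simp
next
  case (Suc k)
  obtain g' where g': "\<And>p h. p \<in> P \<Longrightarrow> h \<in> {0..c p} \<Longrightarrow>
      (g p has_vector_derivative g' p h) (at h within {0..c p})" "uniformly_C_k k P c g'"
    using Suc.prems unfolding uniformly_C_k.simps(2) by blast
  obtain a' M' where a': "\<And>p h. p \<in> P \<Longrightarrow> h \<in> {0..c p} \<Longrightarrow>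
      norm (g' p h - (\<Sum>j<k. h ^ j *\<^sub>R a' p j)) \<le> M' * h ^ k"
    using Suc.IH[OF g'(2)] by blast
  define a where "a p j = (case j of 0 \<Rightarrow> g p 0 | Suc i \<Rightarrow> (1 / real (Suc i)) *\<^sub>R a' p i)" for p j
  have "norm (g p h - (\<Sum>j<Suc k. h ^ j *\<^sub>R a p j)) \<le> \<bar>M'\<bar> * h ^ Suc k" if p: "p \<in> P" and h: "h \<in> {0..c p}" for p h
  proof -
    define R where "R s = g p s - (\<Sum>j<Suc k. s ^ j *\<^sub>R a p j)" for s
    define R' where "R' s = g' p s - (\<Sum>j<k. s ^ j *\<^sub>R a' p j)" for s
    have R_eq: "R = (\<lambda>s. g p s - (g p 0 + (\<Sum>j<k. (s ^ Suc j / real (Suc j)) *\<^sub>R a' p j)))"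
      unfolding R_def a_def sum.lessThan_Suc_shift by (auto simp: fun_eq_iff)
    have pow: "((\<lambda>s. (s ^ Suc j / real (Suc j)) *\<^sub>R v) has_vector_derivative s ^ j *\<^sub>R v) (at s within S)"
      for j s S and v :: 'b
    proof -
      have "((\<lambda>s. s ^ Suc j / real (Suc j)) has_real_derivative s ^ j) (at s within S)"
        by (auto intro!: derivative_eq_intros simp del: of_nat_Suc power_Suc)
      then show ?thesis
        using has_vector_derivative_scaleR[OF _ has_vector_derivative_const[of v]] by fastforce
    qed
    have deriv: "(R has_derivative (\<lambda>t. t *\<^sub>R R' s)) (at s within {0..h})" if "s \<in> {0..h}" for s
    proof -
      have "(g p has_vector_derivative g' p s) (at s within {0..h})"
        by (rule has_vector_derivative_within_subset[OF g'(1)[OF p]]) (use that h in auto)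
      then have "(R has_vector_derivative g' p s - (0 + (\<Sum>j<k. s ^ j *\<^sub>R a' p j))) (at s within {0..h})"
        unfolding R_eq
        by (intro has_vector_derivative_diff has_vector_derivative_add has_vector_derivative_sum
            has_vector_derivative_const pow)
      then show ?thesis
        by (simp add: has_vector_derivative_def R'_def)
    qed
    have "norm (R h - R 0) \<le> (\<bar>M'\<bar> * h ^ k) * norm (h - 0)"
    proof (rule differentiable_bound[OF _ deriv])
      fix s assume s: "s \<in> {0..h}"
      have "norm (R' s) \<le> M' * s ^ k"
        unfolding R'_def by (rule a'[OF p]) (use s h in auto)
      also have "\<dots> \<le> \<bar>M'\<bar> * h ^ k"
        using s by (intro mult_mono power_mono) auto
      finally show "onorm (\<lambda>t. t *\<^sub>R R' s) \<le> \<bar>M'\<bar> * h ^ k"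
        by (intro onorm_le) (simp add: mult.commute mult_left_mono)
    qed (use h in auto)
    moreover have "R 0 = 0"
      by (simp add: R_eq)
    ultimately show ?thesis
      using h by (simp add: R_def mult.assoc mult.commute[of h])
  qed
  then show ?case
    by blast
qed

text \<open>The limit \<open>h \<rightarrow> 0\<close> isolates the lowest coefficient; the others follow after division by \<open>h\<close>.\<close>

lemma polynomial_small_imp_zero:
  fixes a :: "nat \<Rightarrow> 'a::real_normed_vector"
  assumes "0 < \<delta>" and "\<And>h. 0 < h \<Longrightarrow> h < \<delta> \<Longrightarrow> norm (\<Sum>j<k. h ^ j *\<^sub>R a j) \<le> M * h ^ k"
  shows "j < k \<Longrightarrow> a j = 0"
  using assms(2)
proof (induction k arbitrary: a j)
  case (Suc k)
  have lim: "((\<lambda>h. norm (\<Sum>j<Suc k. h ^ j *\<^sub>R a j)) \<longlongrightarrow> norm (\<Sum>j<Suc k. 0 ^ j *\<^sub>R a j)) (at_right (0::real))"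
    by (intro tendsto_intros)
  have lim0: "((\<lambda>h. M * h ^ Suc k) \<longlongrightarrow> M * 0 ^ Suc k) (at_right (0::real))"
    by (intro tendsto_intros)
  have ev: "eventually (\<lambda>h. norm (\<Sum>j<Suc k. h ^ j *\<^sub>R a j) \<le> M * h ^ Suc k) (at_right 0)"
    unfolding eventually_at_right_field
    by (intro exI[of _ \<delta>] conjI allI impI Suc.prems(2)) (use assms(1) in auto)
  have "norm (\<Sum>j<Suc k. (0::real) ^ j *\<^sub>R a j) \<le> M * 0 ^ Suc k"
    by (rule tendsto_le[OF trivial_limit_at_right_real lim0 lim ev])
  moreover have "(\<Sum>j<Suc k. (0::real) ^ j *\<^sub>R a j) = a 0"
    by (subst sum.lessThan_Suc_shift) simp
  ultimately have "norm (a 0) \<le> 0"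
    by simp
  then have a0: "a 0 = 0"
    by simp
  have "norm (\<Sum>j<k. h ^ j *\<^sub>R a (Suc j)) \<le> M * h ^ k" if "0 < h" "h < \<delta>" for h
  proof -
    have "(\<Sum>j<Suc k. h ^ j *\<^sub>R a j) = h *\<^sub>R (\<Sum>j<k. h ^ j *\<^sub>R a (Suc j))"
      by (subst sum.lessThan_Suc_shift) (simp add: a0 scaleR_sum_right)
    then have "h * norm (\<Sum>j<k. h ^ j *\<^sub>R a (Suc j)) \<le> h * (M * h ^ k)"
      using Suc.prems(2)[OF that] that by (simp add: mult.left_commute)
    then show ?thesis
      using that by simp
  qed
  then have "a (Suc i) = 0" if "i < k" for i
    using Suc.IH[where a = "\<lambda>j. a (Suc j)" and j = i] that by simp
  with a0 Suc.prems(1) show ?case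
    by (cases j) auto
qed simp

text \<open>A bound \<open>O(h\<^sup>k)\<close> with constants depending on the parameter annihilates the Taylor polynomial,
  and what remains is the uniformly bounded remainder.\<close>

lemma pointwise_order_imp_uniform:
  assumes "uniformly_C_k k P c g"
    and "\<And>p. p \<in> P \<Longrightarrow> 0 < c p \<and> (\<exists>\<delta>>0. \<exists>M. \<forall>h. 0 < h \<and> h < \<delta> \<longrightarrow> norm (g p h) \<le> M * h ^ k)"
  shows "\<exists>M. \<forall>p\<in>P. \<forall>h\<in>{0..c p}. norm (g p h) \<le> M * h ^ k"
proof -
  obtain a M where aM: "\<And>p h. p \<in> P \<Longrightarrow> h \<in> {0..c p} \<Longrightarrow>
      norm (g p h - (\<Sum>j<k. h ^ j *\<^sub>R a p j)) \<le> M * h ^ k"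
    using uniformly_C_k_taylor[OF assms(1)] by blast
  have "norm (g p h) \<le> M * h ^ k" if p: "p \<in> P" and h: "h \<in> {0..c p}" for p h
  proof -
    obtain \<delta> N where \<delta>: "0 < \<delta>" "\<And>h. 0 < h \<Longrightarrow> h < \<delta> \<Longrightarrow> norm (g p h) \<le> N * h ^ k"
      using assms(2)[OF p] by blast
    have "norm (\<Sum>j<k. s ^ j *\<^sub>R a p j) \<le> (N + M) * s ^ k" if "0 < s" "s < min \<delta> (c p)" for s
    proof -
      have "norm (\<Sum>j<k. s ^ j *\<^sub>R a p j) \<le> norm (g p s) + norm (g p s - (\<Sum>j<k. s ^ j *\<^sub>R a p j))"
        by (metis norm_triangle_sub norm_minus_commute)
      also have "\<dots> \<le> N * s ^ k + M * s ^ k"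
        using that by (intro add_mono \<delta> aM p) auto
      finally show ?thesis
        by (simp add: algebra_simps)
    qed
    then have "a p j = 0" if "j < k" for j
      using polynomial_small_imp_zero[where \<delta> = "min \<delta> (c p)" and k = k and a = "a p" and M = "N + M" and j = j] that \<delta>(1) assms(2)[OF p] by auto
    with aM[OF p h] show ?thesis
      by simp
  qed
  then show ?thesis
    by blast
qed

section \<open>Runge--Kutta methods for ordinary differential equations\<close>

text \<open>The stages of a method are collected in one vector, so that the stage equations for
  \<open>x' = f(x)\<close> from the initial value \<open>x\<close> become \<open>X = diag x + h G(X)\<close> with
  \<open>G = stage_slopes A f\<close>.\<close>

definition diag :: "'a \<Rightarrow> 'a^'s" where
  "diag x = (\<chi> i. x)"

definition stage_slopes :: "real^'s^'s \<Rightarrow> ('a::real_vector \<Rightarrow> 'a) \<Rightarrow> 'a^'s \<Rightarrow> 'a^'s" where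
  "stage_slopes A f X = (\<chi> i. \<Sum>j\<in>UNIV. A $ i $ j *\<^sub>R f (X $ j))"

definition weighted_slope :: "real^'s \<Rightarrow> ('a::real_vector \<Rightarrow> 'a) \<Rightarrow> 'a^'s \<Rightarrow> 'a" where
  "weighted_slope b f X = (\<Sum>j\<in>UNIV. b $ j *\<^sub>R f (X $ j))"

lemma smooth_weighted_slope:
  fixes f :: "'a::euclidean_space \<Rightarrow> 'a"
  assumes "smooth f"
  shows "smooth (weighted_slope b f)"
  unfolding weighted_slope_def[abs_def]
  by (intro smooth_sum smooth_scaleR smooth_const smooth_compose[OF assms]
      smooth_bounded_linear bounded_linear_vec_nth)

lemma smooth_stage_slopes:
  fixes f :: "'a::euclidean_space \<Rightarrow> 'a"
  assumes "smooth f"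
  shows "smooth (stage_slopes A f)"
  unfolding stage_slopes_def[abs_def]
  by (intro smooth_vec_lambda smooth_sum smooth_scaleR smooth_const smooth_compose[OF assms]
      smooth_bounded_linear bounded_linear_vec_nth)

lemma norm_diag_le: "norm (diag x :: 'a::real_normed_vector^'s) \<le> real CARD('s) * norm x"
  using L2_set_le_sum[of UNIV "\<lambda>i::'s. norm x"] by (simp add: norm_vec_def diag_def)

lemma norm_vec_le:
  fixes X :: "'a::real_normed_vector^'s"
  assumes "\<And>i. norm (X $ i) \<le> c"
  shows "norm X \<le> real CARD('s) * c"
proof -
  have "norm X \<le> (\<Sum>i\<in>UNIV. norm (X $ i))"
    unfolding norm_vec_def by (rule L2_set_le_sum) simp
  also have "\<dots> \<le> (\<Sum>i\<in>(UNIV :: 's set). c)"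
    by (intro sum_mono assms)
  finally show ?thesis
    by simp
qed

lemma bounded_linear_diag: "bounded_linear (diag :: 'a::real_normed_vector \<Rightarrow> 'a^'s)"
proof (rule bounded_linear_intro)
  show "norm (diag x :: 'a^'s) \<le> norm x * real CARD('s)" for x :: 'a
    using norm_diag_le[of x] by (simp add: mult.commute)
qed (simp_all add: diag_def vec_eq_iff)

lemma diag_diff: "diag x - diag y = diag (x - y)"
  by (simp add: diag_def vec_eq_iff)

lemma diag_nth [simp]: "diag x $ i = x"
  by (simp add: diag_def)

text \<open>The stages depend on the initial value in a Lipschitz way, and the weighted slope enters with the
  factor \<open>h\<close>. The form \<open>1 + h \<Lambda>\<close> of the constant is what the summation of local errors needs.\<close>

lemma rk_step_stable:
  fixes f :: "'a::euclidean_space \<Rightarrow> 'a" and A :: "real^'s^'s"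
  assumes "smooth f"
  obtains h0 \<Lambda> where "0 < h0" "0 < \<Lambda>"
    "\<And>h x y X Y. \<lbrakk>0 \<le> h; h < h0; norm X \<le> R; norm Y \<le> R;
        X = diag x + h *\<^sub>R stage_slopes A f X; Y = diag y + h *\<^sub>R stage_slopes A f Y\<rbrakk>
      \<Longrightarrow> norm (x + h *\<^sub>R weighted_slope b f X - (y + h *\<^sub>R weighted_slope b f Y)) \<le> (1 + h * \<Lambda>) * norm (x - y)"
proof -
  obtain h0 where h0: "0 < h0"
    "\<And>h c c' X Y. \<lbrakk>0 \<le> h; h < h0; norm X \<le> R; norm Y \<le> R; X = c + h *\<^sub>R stage_slopes A f X;
        Y = c' + h *\<^sub>R stage_slopes A f Y\<rbrakk> \<Longrightarrow> norm (X - Y) \<le> 2 * norm (c - c')"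
    using implicit_equation_stable[OF smooth_stage_slopes[OF assms], where R = R] by metis
  obtain L where L: "0 < L"
    "\<And>X Y. norm X \<le> R \<Longrightarrow> norm Y \<le> R \<Longrightarrow> norm (weighted_slope b f X - weighted_slope b f Y) \<le> L * norm (X - Y)"
    using smooth_lipschitz_on_cball[OF smooth_weighted_slope[OF assms], where R = R] by metis
  show ?thesis
  proof
    show "0 < h0" "0 < L * (2 * real CARD('s))"
      using h0 L by auto
    fix h :: real and x y :: 'a and X Y :: "'a^'s"
    assume h: "0 \<le> h" "h < h0" and R: "norm X \<le> R" "norm Y \<le> R"
      and XY: "X = diag x + h *\<^sub>R stage_slopes A f X" "Y = diag y + h *\<^sub>R stage_slopes A f Y"
    have "norm (X - Y) \<le> 2 * (real CARD('s) * norm (x - y))"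
      using h0(2)[OF h R XY] norm_diag_le[of "x - y", where 's = 's] by (simp add: diag_diff)
    then have "L * norm (X - Y) \<le> L * (2 * (real CARD('s) * norm (x - y)))"
      using L(1) by (intro mult_left_mono) auto
    then have slopes: "norm (weighted_slope b f X - weighted_slope b f Y) \<le> L * (2 * (real CARD('s) * norm (x - y)))"
      using L(2)[OF R] by linarith
    have split: "x + h *\<^sub>R weighted_slope b f X - (y + h *\<^sub>R weighted_slope b f Y)
        = (x - y) + h *\<^sub>R (weighted_slope b f X - weighted_slope b f Y)"
      by (simp add: algebra_simps)
    have "norm (x + h *\<^sub>R weighted_slope b f X - (y + h *\<^sub>R weighted_slope b f Y))
        \<le> norm (x - y) + h * norm (weighted_slope b f X - weighted_slope b f Y)"
      unfolding split using norm_triangle_ineq[of "x - y" "h *\<^sub>R (weighted_slope b f X - weighted_slope b f Y)"] h(1) by simp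
    also have "\<dots> \<le> norm (x - y) + h * (L * (2 * (real CARD('s) * norm (x - y))))"
      using slopes h(1) by (intro add_mono mult_left_mono) auto
    finally show "norm (x + h *\<^sub>R weighted_slope b f X - (y + h *\<^sub>R weighted_slope b f Y))
        \<le> (1 + h * (L * (2 * real CARD('s)))) * norm (x - y)"
      by (simp add: algebra_simps)
  qed
qed

section \<open>The local error along a solution\<close>

lemma C_k_partials_compose_linear_combination:
  fixes \<phi> :: "'a::euclidean_space \<Rightarrow> real"
  assumes "smooth \<phi>"
  shows "C_k_partials d k (\<lambda>y. \<phi> (\<Sum>i<d. y i *\<^sub>R e i))"
  using assms
proof (induction k arbitrary: \<phi>)
  have lin: "continuous_on UNIV (\<lambda>y::nat \<Rightarrow> real. \<Sum>i<d. y i *\<^sub>R e i)"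
    by (intro continuous_intros continuous_on_product_coordinates)
  have cont: "continuous_on UNIV (\<lambda>y. \<phi> (\<Sum>i<d. y i *\<^sub>R e i))" if "smooth \<phi>" for \<phi> :: "'a \<Rightarrow> real"
    using continuous_on_compose2[OF smooth_continuous_on[OF that, of UNIV] lin] by simp
  {
    case 0
    then show ?case
      using cont by simp
  next
    case (Suc k)
    have "((\<lambda>t. \<phi> (\<Sum>l<d. (y(i := t)) l *\<^sub>R e l)) has_real_derivative
        frechet_derivative \<phi> (at (\<Sum>l<d. y l *\<^sub>R e l)) (e i)) (at (y i))" if "i < d" for i and y :: "nat \<Rightarrow> real"
    proof -
      let ?z = "(\<Sum>l\<in>{..<d} - {i}. y l *\<^sub>R e l)"
      have "(\<Sum>l<d. (y(i := t)) l *\<^sub>R e l) = ?z + t *\<^sub>R e i" for t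
        using that by (subst sum.remove[of _ i]) (auto intro!: sum.cong)
      moreover have "(\<Sum>l<d. y l *\<^sub>R e l) = ?z + y i *\<^sub>R e i"
        using that by (subst sum.remove[of _ i]) auto
      ultimately show ?thesis
        using smooth_line_derivative[OF Suc.prems, of ?z "e i" "y i"] by simp
    qed
    moreover have "C_k_partials d k (\<lambda>y. frechet_derivative \<phi> (at (\<Sum>l<d. y l *\<^sub>R e l)) v)" for v
      by (rule Suc.IH[OF smooth_frechet_derivative[OF Suc.prems]])
    ultimately show ?case
      unfolding C_k_partials.simps(2)
      by (intro conjI allI impI exI[of _ "\<lambda>y. frechet_derivative \<phi> (at (\<Sum>l<d. y l *\<^sub>R e l)) (e _)"]
          cont[OF Suc.prems])
  }
qed

text \<open>In coordinates with respect to an orthonormal basis, the order of the method bounds the local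
  error at one point of the solution, with constants that may depend on this point.\<close>

lemma rk_order_local_error_at_point:
  fixes f :: "'a::euclidean_space \<Rightarrow> 'a" and A :: "real^'s^'s"
  assumes f: "smooth f" and order: "rk_has_order A b p" and "0 < T"
    and sol: "\<And>t. t \<in> {0..T} \<Longrightarrow> (x has_vector_derivative f (x t)) (at t within {0..T})"
  obtains r h0 M where "0 < r" "0 < h0"
    "\<And>h X. \<lbrakk>0 < h; h < h0; norm (X - diag (x 0)) < r; X = diag (x 0) + h *\<^sub>R stage_slopes A f X\<rbrakk>
      \<Longrightarrow> norm (x 0 + h *\<^sub>R weighted_slope b f X - x h) \<le> M * h ^ (p + 1)"
proof -
  define d where "d = DIM('a)"
  obtain e where e: "bij_betw e {..<d} (Basis :: 'a set)"
    using ex_bij_betw_nat_finite[of "Basis :: 'a set"] unfolding d_def lessThan_atLeast0 by auto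
  have e_Basis: "e j \<in> Basis" if "j < d" for j
    using e that by (auto simp: bij_betw_def)
  define \<iota> where "\<iota> y = (\<Sum>i<d. y i *\<^sub>R e i)" for y :: "nat \<Rightarrow> real"
  have \<iota>_coords: "\<iota> (\<lambda>j. v \<bullet> e j) = v" for v
    unfolding \<iota>_def using sum.reindex_bij_betw[OF e, of "\<lambda>b. (v \<bullet> b) *\<^sub>R b"]
    by (simp add: euclidean_representation)
  define F where "F y j = f (\<iota> y) \<bullet> e j" for y j
  have F_coords: "F (\<lambda>j. v \<bullet> e j) j = f v \<bullet> e j" for v j
    by (simp add: F_def \<iota>_coords)
  have "smooth_field d F"
    unfolding smooth_field_def
  proof (intro allI impI conjI)
    fix j k
    show "F y j = F y' j" if "\<forall>i<d. y i = y' i" for y y'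
      using that by (simp add: F_def \<iota>_def)
    have "smooth (\<lambda>v. f v \<bullet> e j)"
      using smooth_compose[OF smooth_bounded_linear[OF bounded_linear_inner_left] f] .
    then show "C_k_partials d k (\<lambda>y. F y j)"
      unfolding F_def \<iota>_def by (rule C_k_partials_compose_linear_combination)
  qed
  moreover have "ode_solution d F T (\<lambda>t j. x t \<bullet> e j)"
    unfolding ode_solution_def F_coords has_real_derivative_iff_has_vector_derivative
    using bounded_linear.has_vector_derivative[OF bounded_linear_inner_left sol] by blast
  ultimately have "smooth_field d F \<and> 0 < T \<and> ode_solution d F T (\<lambda>t j. x t \<bullet> e j)"
    using \<open>0 < T\<close> by simp
  from order[unfolded rk_has_order_def, THEN spec, THEN spec, THEN spec, THEN spec, THEN mp, OF this]
  obtain r h0 M where r: "0 < r" "0 < h0" and step: "\<forall>h Y y1. 0 < h \<and> h < h0 \<and>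
      (\<forall>i. \<forall>j<d. \<bar>Y i j - x 0 \<bullet> e j\<bar> < r) \<and> ode_rk_step A b d F h (\<lambda>j. x 0 \<bullet> e j) Y y1 \<longrightarrow>
      (\<forall>j<d. \<bar>y1 j - x h \<bullet> e j\<bar> \<le> M * h ^ (p + 1))"
    by blast
  show ?thesis
  proof
    show "0 < r" "0 < h0"
      by (fact r)+
    fix h :: real and X :: "'a^'s"
    assume h: "0 < h" "h < h0" and near: "norm (X - diag (x 0)) < r"
      and X: "X = diag (x 0) + h *\<^sub>R stage_slopes A f X"
    let ?x1 = "x 0 + h *\<^sub>R weighted_slope b f X"
    have "\<bar>X $ i \<bullet> e j - x 0 \<bullet> e j\<bar> < r" if "j < d" for i j
    proof -
      have "\<bar>X $ i \<bullet> e j - x 0 \<bullet> e j\<bar> \<le> norm (X $ i - x 0)"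
        using Basis_le_norm[OF e_Basis[OF that], of "X $ i - x 0"] by (simp add: inner_diff_left)
      also have "\<dots> \<le> norm (X - diag (x 0))"
        using Finite_Cartesian_Product.norm_nth_le[of "X - diag (x 0)" i] by simp
      finally show ?thesis
        using near by simp
    qed
    moreover have "ode_rk_step A b d F h (\<lambda>j. x 0 \<bullet> e j) (\<lambda>i j. X $ i \<bullet> e j) (\<lambda>j. ?x1 \<bullet> e j)"
      unfolding ode_rk_step_def F_coords
    proof (intro conjI allI impI)
      fix i j
      have "X $ i = x 0 + h *\<^sub>R (\<Sum>l\<in>UNIV. A $ i $ l *\<^sub>R f (X $ l))"
        using arg_cong[OF X, of "\<lambda>X. X $ i"] by (simp add: stage_slopes_def)
      then show "X $ i \<bullet> e j = x 0 \<bullet> e j + h * (\<Sum>l\<in>UNIV. A $ i $ l * (f (X $ l) \<bullet> e j))"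
        by (simp add: inner_add_left inner_sum_left)
    qed (simp add: weighted_slope_def inner_add_left inner_sum_left)
    ultimately have err: "\<forall>j<d. \<bar>?x1 \<bullet> e j - x h \<bullet> e j\<bar> \<le> M * h ^ (p + 1)"
      using step[THEN spec, THEN spec, THEN spec, THEN mp, of h "\<lambda>i j. X $ i \<bullet> e j" "\<lambda>j. ?x1 \<bullet> e j"] h
      by blast
    have "norm (?x1 - x h) \<le> (\<Sum>u\<in>Basis. \<bar>(?x1 - x h) \<bullet> u\<bar>)"
      by (rule norm_le_l1)
    also have "\<dots> = (\<Sum>j<d. \<bar>(?x1 - x h) \<bullet> e j\<bar>)"
      by (rule sum.reindex_bij_betw[OF e, symmetric])
    also have "\<dots> \<le> (\<Sum>j<d. M * h ^ (p + 1))"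
      using err by (intro sum_mono) (simp add: inner_diff_left)
    finally show "norm (?x1 - x h) \<le> (real d * M) * h ^ (p + 1)"
      by simp
  qed
qed

text \<open>The differential equation expresses one more derivative of the solution by a smooth function of the
  solution, so that the regularity improves by induction.\<close>

lemma solution_uniformly_C_k:
  fixes f :: "'a::euclidean_space \<Rightarrow> 'a"
  assumes f: "smooth f"
    and sol: "\<And>t. t \<in> {0..T} \<Longrightarrow> (x has_vector_derivative f (x t)) (at t within {0..T})"
    and bound: "\<And>t. t \<in> {0..T} \<Longrightarrow> norm (x t) \<le> R"
    and dom: "\<And>t. t \<in> P \<Longrightarrow> 0 \<le> t \<and> t + c t \<le> T"
  shows "uniformly_C_k k P c (\<lambda>t h. x (t + h))"
proof (induction k)
  case 0
  show ?case
    unfolding uniformly_C_k.simps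
    by (intro exI[of _ R] ballI bound) (use dom in force)
next
  case (Suc k)
  show ?case
  proof (rule uniformly_C_k_SucI)
    fix t h assume th: "t \<in> P" "h \<in> {0..c t}"
    then have t: "t + h \<in> {0..T}"
      using dom[OF th(1)] by auto
    show "norm (x (t + h)) \<le> R"
      by (rule bound[OF t])
    have sub: "(\<lambda>h. t + h) ` {0..c t} \<subseteq> {0..T}"
      using dom[OF th(1)] by auto
    have "((\<lambda>h. t + h) has_vector_derivative 1) (at h within {0..c t})"
      by (auto intro!: derivative_eq_intros)
    from vector_diff_chain_within[OF this has_vector_derivative_within_subset[OF sol[OF t] sub]]
    show "((\<lambda>h. x (t + h)) has_vector_derivative f (x (t + h))) (at h within {0..c t})"
      by (simp add: o_def)
  next
    show "uniformly_C_k k P c (\<lambda>t h. f (x (t + h)))"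
      by (rule uniformly_C_k_compose[OF f Suc])
  qed
qed

text \<open>To make the local error uniform along the solution, the stages are replaced by \<open>p + 1\<close> Picard
  iterations. These agree with the stages up to \<open>O(h\<^bsup>p+1\<^esup>)\<close> and depend on \<open>h\<close> through finitely many
  applications of \<open>f\<close>, so that their derivatives in \<open>h\<close> are bounded uniformly.\<close>

lemma rk_local_error_uniform:
  fixes f :: "'a::euclidean_space \<Rightarrow> 'a" and A :: "real^'s^'s"
  assumes f: "smooth f" and order: "rk_has_order A b p" and T: "0 < T"
    and sol: "\<And>t. t \<in> {0..T} \<Longrightarrow> (x has_vector_derivative f (x t)) (at t within {0..T})"
    and bound: "\<And>t. t \<in> {0..T} \<Longrightarrow> norm (x t) \<le> R"
  obtains h0 M where "0 < h0" "0 < M"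
    "\<And>t h X. \<lbrakk>0 \<le> t; 0 < h; h < h0; t + h \<le> T; norm X \<le> K; X = diag (x t) + h *\<^sub>R stage_slopes A f X\<rbrakk>
      \<Longrightarrow> norm (x t + h *\<^sub>R weighted_slope b f X - x (t + h)) \<le> M * h ^ (p + 1)"
proof -
  let ?G = "stage_slopes A f" and ?W = "weighted_slope b f"
  let ?R = "real CARD('s) * R"
  note G = smooth_stage_slopes[OF f, of A] and W = smooth_weighted_slope[OF f, of b]
  have diag_bound: "norm (diag (x t) :: 'a^'s) \<le> ?R" if "t \<in> {0..T}" for t
    using norm_diag_le[of "x t", where 's = 's] bound[OF that]
    by (meson mult_left_mono of_nat_0_le_iff order_trans)
  obtain h1 L where h1: "0 < h1" "0 < L"
    "\<And>h c X m. \<lbrakk>0 \<le> h; h < h1; norm c \<le> ?R; norm (X - c) \<le> 1; X = c + h *\<^sub>R ?G X\<rbrakk>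
       \<Longrightarrow> norm (picard_iterate ?G m c h) \<le> ?R + 1 \<and> norm (picard_iterate ?G m c h - X) \<le> (L * h) ^ m"
    using picard_iterate_error[OF G, where R = ?R] by metis
  obtain Lw where Lw: "0 < Lw"
    "\<And>X Y. norm X \<le> ?R + 1 \<Longrightarrow> norm Y \<le> ?R + 1 \<Longrightarrow> norm (?W X - ?W Y) \<le> Lw * norm (X - Y)"
    using smooth_lipschitz_on_cball[OF W, where R = "?R + 1"] by metis
  obtain h2 where h2: "0 < h2"
    "\<And>h c. 0 \<le> h \<Longrightarrow> h < h2 \<Longrightarrow> norm c \<le> ?R \<Longrightarrow> \<exists>X. norm (X - c) \<le> 1 \<and> X = c + h *\<^sub>R ?G X"
    using implicit_equation_exists[OF G, where R = ?R and \<rho> = 1] by (metis zero_less_one)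
  obtain h3 where h3: "0 < h3"
    "\<And>h c c' X Y. \<lbrakk>0 \<le> h; h < h3; norm X \<le> max K (?R + 1); norm Y \<le> max K (?R + 1);
       X = c + h *\<^sub>R ?G X; Y = c' + h *\<^sub>R ?G Y\<rbrakk> \<Longrightarrow> norm (X - Y) \<le> 2 * norm (c - c')"
    using implicit_equation_stable[OF G, where R = "max K (?R + 1)"] by metis
  define x1 where "x1 t h = x t + h *\<^sub>R ?W (picard_iterate ?G (p + 1) (diag (x t)) h)" for t h
  define C where "C = Lw * L ^ (p + 1)"
  have x1_error: "norm (x t + h *\<^sub>R ?W X - x1 t h) \<le> C * h ^ (p + 1)"
    if t: "t \<in> {0..T}" and h: "0 < h" "h < min 1 h1" and X: "norm (X - diag (x t)) \<le> 1" "X = diag (x t) + h *\<^sub>R ?G X"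
    for t h X
  proof -
    let ?Y = "picard_iterate ?G (p + 1) (diag (x t)) h"
    have Y: "norm ?Y \<le> ?R + 1" "norm (?Y - X) \<le> (L * h) ^ (p + 1)"
      using h1(3)[of h "diag (x t)" X "p + 1"] h X diag_bound[OF t] by auto
    have XR: "norm X \<le> ?R + 1"
      using X(1) diag_bound[OF t] norm_triangle_ineq2[of X "diag (x t)"] by simp
    have "norm (x t + h *\<^sub>R ?W X - x1 t h) = norm (h *\<^sub>R (?W X - ?W ?Y))"
      by (simp add: x1_def scaleR_diff_right)
    also have "\<dots> = h * norm (?W X - ?W ?Y)"
      using h by simp
    also have "\<dots> \<le> 1 * (Lw * norm (X - ?Y))"
      using h Lw(2)[OF XR Y(1)] by (intro mult_mono) auto
    also have "\<dots> \<le> Lw * (L * h) ^ (p + 1)"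
      using Lw(1) Y(2) by (simp add: norm_minus_commute mult_left_mono)
    finally show ?thesis
      by (simp add: C_def power_mult_distrib mult_ac)
  qed
  let ?P = "{0..<T}" and ?c = "\<lambda>t. min 1 (T - t)"
  have start_C_k: "uniformly_C_k k ?P ?c (\<lambda>t h. x t)" for k
    by (rule uniformly_C_k_const[where M = R]) (auto intro: bound)
  have ident_C_k: "uniformly_C_k k ?P ?c (\<lambda>t h. h)" for k
    by (rule uniformly_C_k_ident[where C = 1]) auto
  have picard_C_k: "uniformly_C_k k ?P ?c (\<lambda>t h. picard_iterate ?G m (diag (x t)) h)" for k m
  proof (induction m)
    case 0
    show ?case
      using uniformly_C_k_bounded_linear[OF bounded_linear_diag start_C_k] by simp
  next
    case (Suc m)
    show ?case
      unfolding picard_iterate_simps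
      by (intro uniformly_C_k_add uniformly_C_k_scaleR ident_C_k uniformly_C_k_compose[OF G Suc]
          uniformly_C_k_bounded_linear[OF bounded_linear_diag start_C_k])
  qed
  have solution_C_k: "uniformly_C_k k ?P ?c (\<lambda>t h. x (t + h))" for k
    by (rule solution_uniformly_C_k[OF f sol bound]) auto
  have "uniformly_C_k (p + 1) ?P ?c (\<lambda>t h. x1 t h + (- 1) *\<^sub>R x (t + h))"
    unfolding x1_def
    by (intro uniformly_C_k_add uniformly_C_k_scaleR start_C_k ident_C_k uniformly_C_k_compose[OF W picard_C_k]
        solution_C_k uniformly_C_k_const[where a = "\<lambda>_. - 1" and M = 1]) auto
  then have C_k: "uniformly_C_k (p + 1) ?P ?c (\<lambda>t h. x1 t h - x (t + h))"
    by simp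
  have at_point: "0 < ?c t \<and> (\<exists>\<delta>>0. \<exists>M. \<forall>h. 0 < h \<and> h < \<delta> \<longrightarrow> norm (x1 t h - x (t + h)) \<le> M * h ^ (p + 1))"
    if t: "t \<in> {0..<T}" for t
  proof -
    have "((\<lambda>s. x (t + s)) has_vector_derivative f (x (t + s))) (at s within {0..T - t})"
      if s: "s \<in> {0..T - t}" for s
    proof -
      have sub: "(\<lambda>s. t + s) ` {0..T - t} \<subseteq> {0..T}" and ts: "t + s \<in> {0..T}"
        using t s by auto
      have "((\<lambda>s. t + s) has_vector_derivative 1) (at s within {0..T - t})"
        by (auto intro!: derivative_eq_intros)
      from vector_diff_chain_within[OF this has_vector_derivative_within_subset[OF sol[OF ts] sub]]
      show ?thesis
        by (simp add: o_def)
    qed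
    from rk_order_local_error_at_point[OF f order _ this]
    obtain r h4 M where r: "0 < r" "0 < h4"
      "\<And>h X. \<lbrakk>0 < h; h < h4; norm (X - diag (x t)) < r; X = diag (x t) + h *\<^sub>R ?G X\<rbrakk>
        \<Longrightarrow> norm (x t + h *\<^sub>R ?W X - x (t + h)) \<le> M * h ^ (p + 1)"
      using t by auto
    obtain h5 where h5: "0 < h5"
      "\<And>h c. 0 \<le> h \<Longrightarrow> h < h5 \<Longrightarrow> norm c \<le> ?R \<Longrightarrow> \<exists>X. norm (X - c) \<le> min 1 (r / 2) \<and> X = c + h *\<^sub>R ?G X"
      using implicit_equation_exists[OF G, where R = ?R and \<rho> = "min 1 (r / 2)"] r(1)
      by (metis half_gt_zero min_less_iff_conj zero_less_one)
    have tT: "t \<in> {0..T}"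
      using t by simp
    have "norm (x1 t h - x (t + h)) \<le> (C + M) * h ^ (p + 1)"
      if h: "0 < h" "h < min (min 1 h1) (min h4 h5)" for h
    proof -
      obtain X where X: "norm (X - diag (x t)) \<le> min 1 (r / 2)" "X = diag (x t) + h *\<^sub>R ?G X"
        using h5(2)[of h "diag (x t)"] h diag_bound[OF tT] by auto
      have "norm (x1 t h - x (t + h)) \<le> norm (x t + h *\<^sub>R ?W X - x1 t h) + norm (x t + h *\<^sub>R ?W X - x (t + h))"
        using norm_triangle_ineq4[of "x t + h *\<^sub>R ?W X - x (t + h)" "x t + h *\<^sub>R ?W X - x1 t h"]
        by (simp add: algebra_simps)
      also have "\<dots> \<le> C * h ^ (p + 1) + M * h ^ (p + 1)"
        using X h r(1) by (intro add_mono x1_error[OF tT] r(3)) auto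
      finally show ?thesis
        by (simp add: algebra_simps)
    qed
    moreover have "0 < min (min 1 h1) (min h4 h5)" "0 < ?c t"
      using t r(2) h1(1) h5(1) by auto
    ultimately show ?thesis
      by blast
  qed
  obtain M where M: "\<And>t h. t \<in> ?P \<Longrightarrow> h \<in> {0..?c t} \<Longrightarrow> norm (x1 t h - x (t + h)) \<le> M * h ^ (p + 1)"
    using pointwise_order_imp_uniform[OF C_k at_point] by blast
  show ?thesis
  proof
    show "0 < min (min 1 h1) (min h2 h3)" "0 < \<bar>C + M\<bar> + 1"
      using h1 h2 h3 by auto
    fix t h :: real and X :: "'a^'s"
    assume t: "0 \<le> t" "t + h \<le> T" and h: "0 < h" "h < min (min 1 h1) (min h2 h3)"
      and X: "norm X \<le> K" "X = diag (x t) + h *\<^sub>R ?G X"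
    have tT: "t \<in> {0..T}"
      using t h by simp
    obtain Y where Y: "norm (Y - diag (x t)) \<le> 1" "Y = diag (x t) + h *\<^sub>R ?G Y"
      using h2(2)[of h "diag (x t)"] h diag_bound[OF tT] by auto
    have "norm Y \<le> ?R + 1"
      using Y(1) diag_bound[OF tT] norm_triangle_ineq2[of Y "diag (x t)"] by simp
    then have "norm (X - Y) \<le> 2 * norm (diag (x t) - diag (x t) :: 'a^'s)"
      using h X Y by (intro h3(2)[of h]) auto
    then have "X = Y"
      by simp
    have "norm (x t + h *\<^sub>R ?W X - x (t + h)) \<le> norm (x t + h *\<^sub>R ?W X - x1 t h) + norm (x1 t h - x (t + h))"
      using norm_triangle_ineq[of "x t + h *\<^sub>R ?W X - x1 t h" "x1 t h - x (t + h)"] by simp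
    also have "\<dots> \<le> C * h ^ (p + 1) + M * h ^ (p + 1)"
      using Y h t unfolding \<open>X = Y\<close> by (intro add_mono x1_error[OF tT] M) auto
    also have "\<dots> \<le> (\<bar>C + M\<bar> + 1) * h ^ (p + 1)"
      unfolding distrib_right[symmetric] using h by (intro mult_right_mono) auto
    finally show "norm (x t + h *\<^sub>R ?W X - x (t + h)) \<le> (\<bar>C + M\<bar> + 1) * h ^ (p + 1)" .
  qed
qed

section \<open>The global error\<close>

text \<open>The errors of the single steps are amplified by at most \<open>1 + h \<Lambda>\<close> per step, and by at most
  \<open>exp (T \<Lambda>)\<close> altogether. The resulting bound keeps the numerical solution within distance 1 of the
  exact one, where the constants are valid.\<close>

lemma rk_global_error:
  fixes f :: "'a::euclidean_space \<Rightarrow> 'a" and A :: "real^'s^'s"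
  assumes f: "smooth f" and order: "rk_has_order A b p" and "1 \<le> p" and T: "0 < T"
    and sol: "\<And>t. t \<in> {0..T} \<Longrightarrow> (x has_vector_derivative f (x t)) (at t within {0..T})"
    and bound: "\<And>t. t \<in> {0..T} \<Longrightarrow> norm (x t) \<le> R"
  obtains h0 M where "0 < h0" "0 < M"
    "\<And>h N y X. \<lbrakk>0 < h; h < h0; real N * h \<le> T; y 0 = x 0;
       \<And>k. k < N \<Longrightarrow> norm (X k - diag (y k)) \<le> \<kappa>;
       \<And>k. k < N \<Longrightarrow> X k = diag (y k) + h *\<^sub>R stage_slopes A f (X k);
       \<And>k. k < N \<Longrightarrow> y (Suc k) = y k + h *\<^sub>R weighted_slope b f (X k)\<rbrakk>
      \<Longrightarrow> \<forall>k\<le>N. norm (y k - x (real k * h)) \<le> M * h ^ p \<and> norm (y k - x (real k * h)) \<le> 1"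
proof -
  let ?G = "stage_slopes A f" and ?W = "weighted_slope b f"
  let ?R = "real CARD('s) * (R + 1)"
  \<comment> \<open>A bound for the stages of the numerical solution in the tube of radius 1 and for those started on
    the exact solution.\<close>
  define K where "K = ?R + max \<kappa> 1"
  have R: "0 \<le> R"
    using order_trans[OF norm_ge_zero bound[of 0]] T by simp
  have diag_bound: "norm (diag v :: 'a^'s) \<le> ?R" if "norm v \<le> R + 1" for v :: 'a
    using norm_diag_le[of v, where 's = 's] that by (meson mult_left_mono of_nat_0_le_iff order_trans)
  obtain h1 M1 where h1: "0 < h1" "0 < M1"
    "\<And>t h X. \<lbrakk>0 \<le> t; 0 < h; h < h1; t + h \<le> T; norm X \<le> K; X = diag (x t) + h *\<^sub>R ?G X\<rbrakk>
      \<Longrightarrow> norm (x t + h *\<^sub>R ?W X - x (t + h)) \<le> M1 * h ^ (p + 1)"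
    using rk_local_error_uniform[OF f order T sol bound, where K = K] by metis
  obtain h2 \<Lambda> where h2: "0 < h2" "0 < \<Lambda>"
    "\<And>h x y X Y. \<lbrakk>0 \<le> h; h < h2; norm X \<le> K; norm Y \<le> K; X = diag x + h *\<^sub>R ?G X; Y = diag y + h *\<^sub>R ?G Y\<rbrakk>
      \<Longrightarrow> norm (x + h *\<^sub>R ?W X - (y + h *\<^sub>R ?W Y)) \<le> (1 + h * \<Lambda>) * norm (x - y)"
    using rk_step_stable[OF f, where R = K and A = A and b = b] by metis
  obtain h3 where h3: "0 < h3"
    "\<And>h c. 0 \<le> h \<Longrightarrow> h < h3 \<Longrightarrow> norm c \<le> ?R \<Longrightarrow> \<exists>X. norm (X - c) \<le> 1 \<and> X = c + h *\<^sub>R ?G X"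
    using implicit_equation_exists[OF smooth_stage_slopes[OF f], where R = ?R and \<rho> = 1] by (metis zero_less_one)
  define M where "M = M1 * T * exp (T * \<Lambda>)"
  have M: "0 < M"
    using h1(2) T by (simp add: M_def)
  show ?thesis
  proof
    show "0 < min (min h1 h2) (min h3 (min 1 (1 / M)))" "0 < M"
      using h1 h2 h3 M by auto
    fix h :: real and N :: nat and y :: "nat \<Rightarrow> 'a" and X :: "nat \<Rightarrow> 'a^'s"
    assume h: "0 < h" "h < min (min h1 h2) (min h3 (min 1 (1 / M)))" and N: "real N * h \<le> T"
      and y0: "y 0 = x 0" and near: "\<And>k. k < N \<Longrightarrow> norm (X k - diag (y k)) \<le> \<kappa>"
      and X: "\<And>k. k < N \<Longrightarrow> X k = diag (y k) + h *\<^sub>R ?G (X k)"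
      and step: "\<And>k. k < N \<Longrightarrow> y (Suc k) = y k + h *\<^sub>R ?W (X k)"
    \<comment> \<open>Instead of the geometric sum of the amplified local errors, \<open>k\<close> times its largest term.\<close>
    define E where "E k = M1 * h ^ (p + 1) * real k * (1 + h * \<Lambda>) ^ k" for k :: nat
    have time: "real k * h \<le> T" if "k \<le> N" for k
      using that h(1) N by (meson mult_right_mono less_imp_le of_nat_mono order_trans)
    have E_le: "E k \<le> M * h ^ p" if k: "k \<le> N" for k
    proof -
      have "(1 + h * \<Lambda>) ^ k \<le> exp (h * \<Lambda>) ^ k"
        using h h2(2) by (intro power_mono) auto
      also have "\<dots> = exp (real k * h * \<Lambda>)"
        by (simp add: exp_of_nat_mult[symmetric] mult.assoc)
      also have "\<dots> \<le> exp (T * \<Lambda>)"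
        using time[OF k] h2(2) by simp
      finally have growth: "(1 + h * \<Lambda>) ^ k \<le> exp (T * \<Lambda>)" .
      have "E k = (M1 * h ^ p) * ((real k * h) * (1 + h * \<Lambda>) ^ k)"
        by (simp add: E_def)
      also have "\<dots> \<le> (M1 * h ^ p) * (T * exp (T * \<Lambda>))"
        using time[OF k] growth h h1(2) h2(2) T by (intro mult_left_mono mult_mono) auto
      finally show ?thesis
        by (simp add: M_def mult_ac)
    qed
    have small: "M * h ^ p \<le> 1"
    proof -
      have "h ^ p \<le> h ^ 1"
        using h \<open>1 \<le> p\<close> by (intro power_decreasing) auto
      then have "M * h ^ p \<le> M * h"
        using M by simp
      also have "\<dots> \<le> 1"
        using h M by (simp add: field_simps)
      finally show ?thesis .
    qed
    have error: "norm (y k - x (real k * h)) \<le> E k" if "k \<le> N" for k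
      using that
    proof (induction k)
      case 0
      then show ?case
        by (simp add: y0 E_def)
    next
      case (Suc k)
      then have k: "k < N" and IH: "norm (y k - x (real k * h)) \<le> E k"
        by auto
      let ?t = "real k * h"
      have t: "0 \<le> ?t" "?t + h \<le> T"
        using h(1) time[OF Suc.prems] by (auto simp: algebra_simps)
      have x_bound: "norm (x ?t) \<le> R"
        using t h(1) by (intro bound) auto
      have "norm (y k - x ?t) \<le> 1"
        using IH E_le[of k] small k by simp
      then have "norm (y k) \<le> R + 1"
        using x_bound norm_triangle_ineq2[of "y k" "x ?t"] by simp
      then have X_bound: "norm (X k) \<le> K"
        using diag_bound near[OF k] norm_triangle_ineq2[of "X k" "diag (y k)"] unfolding K_def
        by (smt (verit))
      obtain Y where Y: "norm (Y - diag (x ?t)) \<le> 1" "Y = diag (x ?t) + h *\<^sub>R ?G Y"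
        using h3(2)[of h "diag (x ?t)"] diag_bound[of "x ?t"] x_bound h by auto
      have Y_bound: "norm Y \<le> K"
        using diag_bound[of "x ?t"] x_bound Y(1) norm_triangle_ineq2[of Y "diag (x ?t)"] unfolding K_def
        by simp
      have "norm (y k + h *\<^sub>R ?W (X k) - (x ?t + h *\<^sub>R ?W Y)) \<le> (1 + h * \<Lambda>) * norm (y k - x ?t)"
        using h X_bound Y_bound X[OF k] Y(2) by (intro h2(3)) auto
      also have "\<dots> \<le> (1 + h * \<Lambda>) * E k"
        using IH h h2(2) by (intro mult_left_mono) auto
      finally have 1: "norm (y k + h *\<^sub>R ?W (X k) - (x ?t + h *\<^sub>R ?W Y)) \<le> (1 + h * \<Lambda>) * E k" .
      have 2: "norm (x ?t + h *\<^sub>R ?W Y - x (?t + h)) \<le> M1 * h ^ (p + 1)"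
        using h t Y_bound Y(2) by (intro h1(3)) auto
      have "norm (y (Suc k) - x (?t + h)) \<le> (1 + h * \<Lambda>) * E k + M1 * h ^ (p + 1)"
        unfolding step[OF k]
        using norm_triangle_ineq[of "y k + h *\<^sub>R ?W (X k) - (x ?t + h *\<^sub>R ?W Y)" "x ?t + h *\<^sub>R ?W Y - x (?t + h)"] 1 2
        by simp
      also have "\<dots> \<le> (1 + h * \<Lambda>) * E k + M1 * h ^ (p + 1) * (1 + h * \<Lambda>) ^ Suc k"
      proof -
        have "1 \<le> (1 + h * \<Lambda>) ^ Suc k"
          using h h2(2) by (intro one_le_power) auto
        then show ?thesis
          using h h1(2) mult_left_mono[of 1 "(1 + h * \<Lambda>) ^ Suc k" "M1 * h ^ (p + 1)"] by simp
      qed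
      also have "\<dots> = E (Suc k)"
        by (simp add: E_def algebra_simps)
      finally show ?case
        by (simp add: algebra_simps)
    qed
    show "\<forall>k\<le>N. norm (y k - x (real k * h)) \<le> M * h ^ p \<and> norm (y k - x (real k * h)) \<le> 1"
      using error E_le small by (meson order_trans)
  qed
qed

section \<open>Symplectic Runge--Kutta methods\<close>

text \<open>Linearised stages satisfy the same equations with slopes \<open>B j (U j)\<close>. Expressing the initial
  vectors through the stages, the terms linear in \<open>h\<close> vanish because every \<open>B j\<close> is infinitesimally
  symplectic, and the coefficients of the quadratic terms are those of the symplecticity condition.\<close>

lemma symplectic_rk_preserves_bilinear:
  fixes \<omega> :: "'a::real_vector \<Rightarrow> 'a \<Rightarrow> real" and A :: "real^'s^'s" and U V :: "'s \<Rightarrow> 'a"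
  assumes symplectic: "symplectic_rk A b" and \<omega>: "bilinear \<omega>"
    and skew: "\<And>j u v. \<omega> (B j u) v + \<omega> u (B j v) = 0"
    and U: "\<And>i. U i = u + h *\<^sub>R (\<Sum>j\<in>UNIV. A $ i $ j *\<^sub>R B j (U j))"
    and V: "\<And>i. V i = v + h *\<^sub>R (\<Sum>j\<in>UNIV. A $ i $ j *\<^sub>R B j (V j))"
  shows "\<omega> (u + h *\<^sub>R (\<Sum>j\<in>UNIV. b $ j *\<^sub>R B j (U j))) (v + h *\<^sub>R (\<Sum>j\<in>UNIV. b $ j *\<^sub>R B j (V j))) = \<omega> u v"
proof -
  define F where "F j = B j (U j)" for j
  define G where "G j = B j (V j)" for j
  have lin1: "linear (\<lambda>x. \<omega> x y)" and lin2: "linear (\<lambda>y. \<omega> x y)" for x y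
    using \<omega> by (auto simp: bilinear_def)
  note expand = linear_add[OF lin1] linear_add[OF lin2] linear_scale[OF lin1] linear_scale[OF lin2]
    linear_sum[OF lin1] linear_sum[OF lin2]
  have Fv: "\<omega> (F j) v = \<omega> (F j) (V j) - h * (\<Sum>i\<in>UNIV. A $ j $ i * \<omega> (F j) (G i))" for j
    using arg_cong[OF V[of j], of "\<omega> (F j)"] by (simp add: expand G_def)
  have uG: "\<omega> u (G j) = \<omega> (U j) (G j) - h * (\<Sum>i\<in>UNIV. A $ j $ i * \<omega> (F i) (G j))" for j
    using arg_cong[OF U[of j], of "\<lambda>x. \<omega> x (G j)"] by (simp add: expand F_def)
  have FG: "\<omega> (F j) (V j) + \<omega> (U j) (G j) = 0" for j
    using skew by (simp add: F_def G_def)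
  have linear_terms: "(\<Sum>j\<in>UNIV. b $ j * (\<omega> (F j) v + \<omega> u (G j)))
      = - h * (\<Sum>i\<in>UNIV. \<Sum>j\<in>UNIV. (b $ i * A $ i $ j + b $ j * A $ j $ i) * \<omega> (F i) (G j))"
  proof -
    have "b $ j * (\<omega> (F j) v + \<omega> u (G j)) = - h * (\<Sum>i\<in>UNIV. b $ j * A $ j $ i * \<omega> (F j) (G i))
        - h * (\<Sum>i\<in>UNIV. b $ j * A $ j $ i * \<omega> (F i) (G j))" for j
    proof -
      have FvuG: "\<omega> (F j) v + \<omega> u (G j) = - h * (\<Sum>i\<in>UNIV. A $ j $ i * \<omega> (F j) (G i))
          - h * (\<Sum>i\<in>UNIV. A $ j $ i * \<omega> (F i) (G j))"
        using Fv[of j] uG[of j] FG[of j] by simp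
      show ?thesis
        unfolding FvuG by (simp add: sum_distrib_left algebra_simps)
    qed
    then have "(\<Sum>j\<in>UNIV. b $ j * (\<omega> (F j) v + \<omega> u (G j)))
        = - h * (\<Sum>j\<in>UNIV. \<Sum>i\<in>UNIV. b $ j * A $ j $ i * \<omega> (F j) (G i))
          - h * (\<Sum>j\<in>UNIV. \<Sum>i\<in>UNIV. b $ j * A $ j $ i * \<omega> (F i) (G j))"
      by (simp add: sum_subtractf sum_negf sum_distrib_left)
    also have "(\<Sum>j\<in>UNIV. \<Sum>i\<in>UNIV. b $ j * A $ j $ i * \<omega> (F i) (G j))
        = (\<Sum>i\<in>UNIV. \<Sum>j\<in>UNIV. b $ j * A $ j $ i * \<omega> (F i) (G j))"
      by (rule sum.swap)
    finally show ?thesis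
      by (simp add: sum.distrib distrib_right algebra_simps)
  qed
  have coeff: "b $ i * b $ j = b $ i * A $ i $ j + b $ j * A $ j $ i" for i j
    using symplectic[unfolded symplectic_rk_def, THEN spec, THEN spec, of i j] by linarith
  have "\<omega> (u + h *\<^sub>R (\<Sum>j\<in>UNIV. b $ j *\<^sub>R F j)) (v + h *\<^sub>R (\<Sum>j\<in>UNIV. b $ j *\<^sub>R G j))
      = \<omega> u v + h * (\<Sum>j\<in>UNIV. b $ j * (\<omega> (F j) v + \<omega> u (G j)))
        + h * (h * (\<Sum>j\<in>UNIV. \<Sum>i\<in>UNIV. (b $ i * b $ j) * \<omega> (F i) (G j)))"
    by (simp add: expand sum.distrib distrib_left sum_distrib_left mult_ac)
  also have "(\<Sum>j\<in>UNIV. \<Sum>i\<in>UNIV. (b $ i * b $ j) * \<omega> (F i) (G j))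
      = (\<Sum>i\<in>UNIV. \<Sum>j\<in>UNIV. (b $ i * b $ j) * \<omega> (F i) (G j))"
    by (rule sum.swap)
  also have "\<omega> u v + h * (\<Sum>j\<in>UNIV. b $ j * (\<omega> (F j) v + \<omega> u (G j)))
        + h * (h * (\<Sum>i\<in>UNIV. \<Sum>j\<in>UNIV. (b $ i * b $ j) * \<omega> (F i) (G j))) = \<omega> u v"
    unfolding linear_terms coeff by simp
  finally show ?thesis
    by (simp add: F_def G_def)
qed

lemma frechet_weighted_slope:
  fixes f :: "'a::euclidean_space \<Rightarrow> 'a"
  assumes "smooth f"
  shows "frechet_derivative (weighted_slope b f) (at X) U =
    (\<Sum>j\<in>UNIV. b $ j *\<^sub>R frechet_derivative f (at (X $ j)) (U $ j))"
proof -
  have "((\<lambda>X. f (X $ j)) has_derivative (\<lambda>U. frechet_derivative f (at (X $ j)) (U $ j))) (at X)" for j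
    by (rule has_derivative_compose[OF bounded_linear_imp_has_derivative[OF bounded_linear_vec_nth]
        smooth_has_derivative[OF assms]])
  then have deriv: "(weighted_slope b f has_derivative
      (\<lambda>U. \<Sum>j\<in>UNIV. b $ j *\<^sub>R frechet_derivative f (at (X $ j)) (U $ j))) (at X)"
    unfolding weighted_slope_def[abs_def] by (intro has_derivative_sum has_derivative_scaleR_right)
  show ?thesis
    unfolding frechet_derivative_at[OF deriv, symmetric] ..
qed

lemma frechet_stage_slopes:
  fixes f :: "'a::euclidean_space \<Rightarrow> 'a" and A :: "real^'s^'s"
  assumes "smooth f"
  shows "frechet_derivative (stage_slopes A f) (at X) U $ i =
    (\<Sum>j\<in>UNIV. A $ i $ j *\<^sub>R frechet_derivative f (at (X $ j)) (U $ j))"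
proof -
  have row: "(\<lambda>X. stage_slopes A f X $ i) = weighted_slope (A $ i) f"
    by (simp add: stage_slopes_def weighted_slope_def fun_eq_iff)
  have deriv: "((\<lambda>X. stage_slopes A f X $ i) has_derivative
      (\<lambda>U. frechet_derivative (stage_slopes A f) (at X) U $ i)) (at X)"
    by (rule bounded_linear.has_derivative[OF bounded_linear_vec_nth
        smooth_has_derivative[OF smooth_stage_slopes[OF assms]]])
  have "frechet_derivative (weighted_slope (A $ i) f) (at X) U =
      frechet_derivative (stage_slopes A f) (at X) U $ i"
    unfolding frechet_derivative_at[OF deriv[unfolded row], symmetric] ..
  then show ?thesis
    unfolding frechet_weighted_slope[OF assms] by (rule sym)
qed

section \<open>Gradients and the canonical structure matrix\<close>

lemma frechet_derivative_grad:
  fixes \<phi> :: "real^'m \<Rightarrow> real"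
  assumes "smooth \<phi>"
  shows "frechet_derivative \<phi> (at x) v = grad \<phi> x \<bullet> v"
proof -
  note lin = smooth_linear_derivative[OF assms, of x]
  have "frechet_derivative \<phi> (at x) v = frechet_derivative \<phi> (at x) (\<Sum>i\<in>UNIV. v $ i *\<^sub>R axis i 1)"
    using basis_expansion[of v] by (simp add: scalar_mult_eq_scaleR)
  also have "\<dots> = (\<Sum>i\<in>UNIV. v $ i * frechet_derivative \<phi> (at x) (axis i 1))"
    by (simp add: linear_sum[OF lin] linear_scale[OF lin])
  finally show ?thesis
    by (simp add: grad_def inner_vec_def mult.commute)
qed

lemma grad_eqI:
  fixes \<phi> :: "real^'m \<Rightarrow> real"
  assumes "(\<phi> has_derivative (\<lambda>v. g \<bullet> v)) (at x)"
  shows "grad \<phi> x = g"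
  unfolding grad_def frechet_derivative_at[OF assms, symmetric]
  by (simp add: vec_eq_iff inner_axis)

lemma smooth_grad:
  fixes \<phi> :: "real^'m \<Rightarrow> real"
  assumes "smooth \<phi>"
  shows "smooth (grad \<phi>)"
  unfolding grad_def[abs_def] by (intro smooth_vec_lambda smooth_frechet_derivative assms)

lemma frechet_grad_symmetric:
  fixes \<phi> :: "real^'m \<Rightarrow> real"
  assumes "smooth \<phi>"
  shows "frechet_derivative (grad \<phi>) (at x) u \<bullet> v = frechet_derivative (grad \<phi>) (at x) v \<bullet> u"
proof -
  have second: "frechet_derivative (grad \<phi>) (at x) u \<bullet> v =
      frechet_derivative (\<lambda>x. frechet_derivative \<phi> (at x) v) (at x) u" for u v
  proof -
    have "((\<lambda>x. grad \<phi> x \<bullet> v) has_derivative (\<lambda>u. frechet_derivative (grad \<phi>) (at x) u \<bullet> v)) (at x)"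
      by (rule bounded_linear.has_derivative[OF bounded_linear_inner_left
          smooth_has_derivative[OF smooth_grad[OF assms]]])
    from frechet_derivative_at[OF this, symmetric] show ?thesis
      by (simp add: frechet_derivative_grad[OF assms])
  qed
  show ?thesis
    unfolding second by (rule smooth_second_derivative_symmetric[OF assms])
qed

lemma J_form_antisymmetric:
  assumes "transpose J = - J"
  shows "J_form J u v = u \<bullet> (J *v v)"
proof -
  have J: "J $ j $ i = - J $ i $ j" for i j
    using arg_cong[OF assms, of "\<lambda>J. J $ i $ j"] by (simp add: transpose_def)
  have "(\<Sum>i\<in>UNIV. \<Sum>j\<in>UNIV. J $ i $ j * (u $ j * v $ i)) = (\<Sum>i\<in>UNIV. \<Sum>j\<in>UNIV. J $ j $ i * (u $ i * v $ j))"
    by (rule sum.swap)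
  also have "\<dots> = (\<Sum>i\<in>UNIV. \<Sum>j\<in>UNIV. - (J $ i $ j * (u $ i * v $ j)))"
    by (intro sum.cong refl) (subst J, simp)
  finally have swap: "(\<Sum>i\<in>UNIV. \<Sum>j\<in>UNIV. J $ i $ j * (u $ j * v $ i)) =
      - (\<Sum>i\<in>UNIV. \<Sum>j\<in>UNIV. J $ i $ j * (u $ i * v $ j))"
    by (simp add: sum_negf)
  have "J_form J u v = (\<Sum>i\<in>UNIV. \<Sum>j\<in>UNIV. J $ i $ j * (u $ i * v $ j))"
    unfolding J_form_def right_diff_distrib sum_subtractf swap by simp
  also have "\<dots> = u \<bullet> (J *v v)"
    by (simp add: inner_vec_def matrix_vector_mult_def sum_distrib_left mult_ac)
  finally show ?thesis .
qed

lemma bounded_linear_matrix_vector_mult: "bounded_linear (\<lambda>v. (M :: real^'n^'m) *v v)"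
  using matrix_vector_mul_linear[of M] by (simp add: linear_conv_bounded_linear)

lemma bounded_linear_qp_part: "bounded_linear (qp_part idx)"
  unfolding linear_conv_bounded_linear[symmetric]
  by (intro linearI) (auto simp: qp_part_def vec_eq_iff)

lemma qp_part_idem [simp]: "qp_part idx (qp_part idx v) = qp_part idx v"
  by (simp add: qp_part_def vec_eq_iff)

lemma qp_space_iff: "v \<in> qp_space idx \<longleftrightarrow> qp_part idx v = v"
  by (auto simp: qp_space_def qp_part_def vec_eq_iff)

lemma qp_part_inner: "qp_part idx u \<bullet> v = u \<bullet> qp_part idx v"
  by (auto simp: qp_part_def inner_vec_def intro!: sum.cong)

lemma qp_part_lambda_space: "l \<in> lambda_space idx \<Longrightarrow> qp_part idx l = 0"
  by (auto simp: qp_part_def lambda_space_def vec_eq_iff)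

lemma canonical_J_antisymmetric: "transpose (canonical_J idx) = - canonical_J idx"
  by (auto simp: transpose_def canonical_J_def vec_eq_iff split: darboux_index.splits)

locale darboux_labelling =
  fixes n k :: nat and idx :: "'m::finite \<Rightarrow> darboux_index"
  assumes bij_idx: "bij_betw idx UNIV (Q_idx ` {..<n} \<union> P_idx ` {..<n} \<union> L_idx ` {..<k})"
begin

abbreviation "\<J> \<equiv> canonical_J idx"
abbreviation "\<P> \<equiv> qp_part idx"

lemma canonical_J_mult:
  "idx a = Q_idx i \<Longrightarrow> idx c = P_idx i \<Longrightarrow> (\<J> *v w) $ a = - w $ c"
  "idx a = P_idx i \<Longrightarrow> idx c = Q_idx i \<Longrightarrow> (\<J> *v w) $ a = w $ c"
  "is_lambda idx a \<Longrightarrow> (\<J> *v w) $ a = 0"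
proof -
  have inj: "idx c = idx c' \<longleftrightarrow> c = c'" for c c'
    using bij_idx by (auto simp: bij_betw_def inj_on_def)
  show "(\<J> *v w) $ a = - w $ c" if "idx a = Q_idx i" "idx c = P_idx i"
  proof -
    have "\<J> $ a $ c' * w $ c' = (if c' = c then - w $ c' else 0)" for c'
      using that inj[of c' c] by (cases "idx c'") (auto simp: canonical_J_def)
    then show ?thesis
      by (simp add: matrix_vector_mult_def)
  qed
  show "(\<J> *v w) $ a = w $ c" if "idx a = P_idx i" "idx c = Q_idx i"
  proof -
    have "\<J> $ a $ c' * w $ c' = (if c' = c then w $ c' else 0)" for c'
      using that inj[of c' c] by (cases "idx c'") (auto simp: canonical_J_def)
    then show ?thesis
      by (simp add: matrix_vector_mult_def)
  qed
  show "(\<J> *v w) $ a = 0" if "is_lambda idx a"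
    using that by (auto simp: matrix_vector_mult_def canonical_J_def is_lambda_def)
qed

lemma idx_cases:
  obtains i c where "idx a = Q_idx i" "idx c = P_idx i"
  | i c where "idx a = P_idx i" "idx c = Q_idx i"
  | "is_lambda idx a"
proof -
  have range: "range idx = Q_idx ` {..<n} \<union> P_idx ` {..<n} \<union> L_idx ` {..<k}"
    using bij_idx by (simp add: bij_betw_def)
  consider i where "idx a = Q_idx i" "i < n" | i where "idx a = P_idx i" "i < n" | l where "idx a = L_idx l"
    using rangeI[of idx a] unfolding range by auto
  then show thesis
  proof cases
    case 1
    then have "P_idx i \<in> range idx"
      unfolding range by simp
    then show thesis
      using 1 that(1) by (metis rangeE)
  next
    case 2
    then have "Q_idx i \<in> range idx"
      unfolding range by simp
    then show thesis
      using 2 that(2) by (metis rangeE)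
  next
    case 3
    then show thesis
      using that(3) by (auto simp: is_lambda_def)
  qed
qed

text \<open>On \<open>(q, p)\<close> the canonical structure matrix is a complex structure; it annihilates
  \<open>\<lambda>\<close>.\<close>

lemma canonical_J_square: "\<J> *v (\<J> *v w) = - \<P> w"
proof -
  have "(\<J> *v (\<J> *v w)) $ a = (- \<P> w) $ a" for a
    by (cases a rule: idx_cases) (auto simp: canonical_J_mult qp_part_def is_lambda_def)
  then show ?thesis
    by (simp add: vec_eq_iff)
qed

lemma qp_part_canonical_J [simp]: "\<P> (\<J> *v w) = \<J> *v w"
  by (auto simp: vec_eq_iff qp_part_def canonical_J_mult)

lemma canonical_J_minus: "\<J> *v (- w) = - (\<J> *v w)"
  using linear_neg[OF matrix_vector_mul_linear[of \<J>]] by simp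

lemma canonical_J_qp_part [simp]: "\<J> *v \<P> w = \<J> *v w"
proof -
  have "- (\<J> *v \<P> w) = \<J> *v (\<J> *v (\<J> *v w))"
    by (simp add: canonical_J_square canonical_J_minus)
  also have "\<dots> = - (\<J> *v w)"
    by (subst canonical_J_square) simp
  finally show ?thesis
    by simp
qed

lemma canonical_J_inner: "(\<J> *v u) \<bullet> v = - (u \<bullet> (\<J> *v v))"
proof -
  have "(\<J> *v u) \<bullet> v = (v v* \<J>) \<bullet> u"
    unfolding dot_lmul_matrix by (rule inner_commute)
  also have "v v* \<J> = transpose \<J> *v v"
    by simp
  also have "\<dots> = - (\<J> *v v)"
    unfolding canonical_J_antisymmetric by (simp add: vec_eq_iff matrix_vector_mult_def sum_negf)
  finally show ?thesis
    by (simp add: inner_commute)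
qed

end

section \<open>Reduction to a Hamiltonian system in (q, p)\<close>

locale index_one_system = darboux_labelling n k idx
  for n k :: nat and idx :: "'m::finite \<Rightarrow> darboux_index" +
  fixes J S :: "real^'m^'m" and H :: "real^'m \<Rightarrow> real" and lam :: "real^'m \<Rightarrow> real^'m"
  assumes antisym: "transpose J = - J"
    and smooth_H: "smooth H"
    and darboux: "darboux_coordinates J n k idx S"
    and index1: "index_one H idx S lam"
    and smooth_lam: "smooth (\<lambda>w. lam (qp_part idx w))"
begin

abbreviation "C \<equiv> constraint_set H idx S"

text \<open>\<open>qp\<close> extracts \<open>(q, p)\<close> from a point in the original coordinates, and \<open>graph_point\<close> maps \<open>(q, p)\<close> to
  the corresponding point of the constraint set. Composing with the projection \<open>\<P>\<close> extends \<open>graph_point\<close>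
  and the reduced field to the whole of \<open>\<real>\<^sup>m\<close>, which allows calculus without a subspace type.\<close>

definition qp :: "real^'m \<Rightarrow> real^'m" where
  "qp z = \<P> (matrix_inv S *v z)"

definition lift :: "real^'m \<Rightarrow> real^'m" where
  "lift x = \<P> x + lam (\<P> x)"

definition graph_point :: "real^'m \<Rightarrow> real^'m" where
  "graph_point x = S *v lift x"

definition H_coords :: "real^'m \<Rightarrow> real" where
  "H_coords w = H (S *v w)"

definition H_red :: "real^'m \<Rightarrow> real" where
  "H_red x = H_coords (lift x)"

text \<open>On \<open>(q, p)\<close> the inverse of the canonical structure matrix is its negative.\<close>

definition reduced_field :: "real^'m \<Rightarrow> real^'m" where
  "reduced_field x = - (\<J> *v grad H_red x)"

lemma invertible_S: "invertible S" and S_J_S: "transpose S ** J ** S = \<J>"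
  using darboux by (auto simp: darboux_coordinates_def)

lemma matrix_inv_S: "S ** matrix_inv S = mat 1" "matrix_inv S ** S = mat 1"
  using someI_ex[OF invertible_S[unfolded invertible_def]] by (simp_all add: matrix_inv_def)

lemma S_inv [simp]: "S *v (matrix_inv S *v z) = z" "matrix_inv S *v (S *v z) = z"
  by (simp_all add: matrix_vector_mul_assoc matrix_inv_S)

lemma bounded_linear_qp: "bounded_linear qp"
  unfolding qp_def[abs_def]
  by (rule bounded_linear_compose[OF bounded_linear_qp_part bounded_linear_matrix_vector_mult])

lemmas qp_linear = bounded_linear.linear[OF bounded_linear_qp]

lemma qp_part_qp [simp]: "\<P> (qp z) = qp z"
  by (simp add: qp_def)

lemma lam_in_lambda_space: "lam (\<P> x) \<in> lambda_space idx"
  using index1 qp_space_iff[of "\<P> x" idx] by (auto simp: index_one_def)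

lemma qp_graph_point [simp]: "qp (graph_point x) = \<P> x"
  by (simp add: qp_def graph_point_def lift_def linear_add[OF bounded_linear.linear[OF bounded_linear_qp_part]]
      qp_part_lambda_space[OF lam_in_lambda_space])

lemma graph_point_qp_part [simp]: "graph_point (\<P> x) = graph_point x"
  by (simp add: graph_point_def lift_def)

lemma graph_eq_constraint_set: "multiplier_graph idx S lam = C"
  using constraint_set_eq_graph[OF index1] by simp

lemma constraint_set_eq_range: "C = range graph_point"
proof -
  have "x \<in> qp_space idx \<Longrightarrow> S *v (x + lam x) = graph_point x" for x
    by (simp add: graph_point_def lift_def qp_space_iff)
  moreover have "graph_point x = S *v (\<P> x + lam (\<P> x))" "\<P> x \<in> qp_space idx" for x
    by (simp_all add: graph_point_def lift_def qp_space_iff)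
  ultimately show ?thesis
    unfolding graph_eq_constraint_set[symmetric] multiplier_graph_def by blast
qed

lemma graph_point_in_constraint_set [simp]: "graph_point x \<in> C"
  by (simp add: constraint_set_eq_range)

lemma graph_point_qp [simp]: "z \<in> C \<Longrightarrow> graph_point (qp z) = z"
  by (auto simp: constraint_set_eq_range)

lemma smooth_lift: "smooth lift"
  unfolding lift_def[abs_def]
  by (intro smooth_add smooth_lam smooth_bounded_linear bounded_linear_qp_part)

lemma smooth_graph_point: "smooth graph_point"
  unfolding graph_point_def[abs_def]
  by (rule smooth_compose[OF smooth_bounded_linear[OF bounded_linear_matrix_vector_mult] smooth_lift])

lemma smooth_H_coords: "smooth H_coords"
  unfolding H_coords_def[abs_def]
  by (rule smooth_compose[OF smooth_H smooth_bounded_linear[OF bounded_linear_matrix_vector_mult]])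

lemma smooth_H_red: "smooth H_red"
  unfolding H_red_def[abs_def] by (rule smooth_compose[OF smooth_H_coords smooth_lift])

lemma smooth_reduced_field: "smooth reduced_field"
proof -
  have "reduced_field = (\<lambda>x. - \<J> *v grad H_red x)"
    by (simp add: reduced_field_def fun_eq_iff vec_eq_iff matrix_vector_mult_def sum_negf)
  then show ?thesis
    using smooth_compose[OF smooth_bounded_linear[OF bounded_linear_matrix_vector_mult] smooth_grad[OF smooth_H_red]]
    by simp
qed

lemma qp_part_reduced_field [simp]: "\<P> (reduced_field x) = reduced_field x"
  by (simp add: reduced_field_def linear_neg[OF bounded_linear.linear[OF bounded_linear_qp_part]])

lemma grad_H_coords: "grad H_coords w = transpose S *v grad H (S *v w)"
proof (rule grad_eqI)
  have "(H_coords has_derivative (\<lambda>v. frechet_derivative H (at (S *v w)) (S *v v))) (at w)"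
    unfolding H_coords_def[abs_def]
    by (rule has_derivative_compose[OF bounded_linear_imp_has_derivative[OF bounded_linear_matrix_vector_mult]
        smooth_has_derivative[OF smooth_H]])
  then show "(H_coords has_derivative (\<lambda>v. (transpose S *v grad H (S *v w)) \<bullet> v)) (at w)"
    by (simp add: frechet_derivative_grad[OF smooth_H] dot_lmul_matrix)
qed

lemma H_lambda_vanishes_iff: "H_lambda_vanishes H idx S w \<longleftrightarrow> \<P> (grad H_coords w) = grad H_coords w"
  unfolding H_lambda_vanishes_def H_coords_def[abs_def] qp_part_def by (auto simp: vec_eq_iff)

lemma grad_H_coords_lift: "\<P> (grad H_coords (lift x)) = grad H_coords (lift x)"
proof -
  have "\<P> x \<in> qp_space idx"
    by (simp add: qp_space_iff)
  then have "H_lambda_vanishes H idx S (lift x)"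
    using index1 lam_in_lambda_space[of x] unfolding index_one_def lift_def by blast
  then show ?thesis
    by (simp add: H_lambda_vanishes_iff)
qed

text \<open>The multiplier drops out of the chain rule because \<open>H\<^sub>\<lambda>\<close> vanishes on the constraint set.\<close>

lemma grad_H_red: "grad H_red x = grad H_coords (lift x)"
proof (rule grad_eqI)
  let ?g = "grad H_coords (lift x)"
  have P_lift: "(\<lambda>x. \<P> (lift x)) = \<P>"
    by (simp add: fun_eq_iff lift_def linear_add[OF bounded_linear.linear[OF bounded_linear_qp_part]]
        qp_part_lambda_space[OF lam_in_lambda_space])
  have P_deriv: "(\<P> has_derivative (\<lambda>v. \<P> (frechet_derivative lift (at x) v))) (at x)"
    using bounded_linear.has_derivative[OF bounded_linear_qp_part[of idx] smooth_has_derivative[OF smooth_lift, of x]]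
    unfolding P_lift .
  have lift': "\<P> (frechet_derivative lift (at x) v) = \<P> v" for v
    using has_derivative_unique[OF P_deriv bounded_linear_imp_has_derivative[OF bounded_linear_qp_part]]
    by (rule fun_cong)
  have "(H_red has_derivative (\<lambda>v. ?g \<bullet> frechet_derivative lift (at x) v)) (at x)"
    unfolding H_red_def[abs_def]
    using has_derivative_compose[OF smooth_has_derivative[OF smooth_lift] smooth_has_derivative[OF smooth_H_coords]]
    by (simp add: frechet_derivative_grad[OF smooth_H_coords])
  moreover have "?g \<bullet> frechet_derivative lift (at x) v = ?g \<bullet> v" for v
  proof -
    have "?g \<bullet> frechet_derivative lift (at x) v = ?g \<bullet> \<P> (frechet_derivative lift (at x) v)"
      by (metis grad_H_coords_lift qp_part_inner)
    also have "\<dots> = ?g \<bullet> v"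
      unfolding lift' by (metis grad_H_coords_lift qp_part_inner)
    finally show ?thesis .
  qed
  ultimately show "(H_red has_derivative (\<lambda>v. ?g \<bullet> v)) (at x)"
    by simp
qed

lemma qp_part_grad_H_red: "\<P> (grad H_red x) = grad H_red x"
  by (simp add: grad_H_red grad_H_coords_lift)

lemma transpose_S_J: "transpose S *v (J *v v) = \<J> *v (matrix_inv S *v v)"
  by (simp add: S_J_S[symmetric] matrix_vector_mul_assoc[symmetric])

lemma transpose_S_inj: "transpose S *v u = transpose S *v v \<longleftrightarrow> u = v"
proof -
  have "transpose (matrix_inv S) ** transpose S = mat 1"
    unfolding matrix_transpose_mul[symmetric] matrix_inv_S by (rule transpose_mat)
  then have "transpose (matrix_inv S) *v (transpose S *v u) = u" for u
    by (simp only: matrix_vector_mul_assoc matrix_vector_mul_lid)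
  then show ?thesis
    by metis
qed

text \<open>\<open>J\<close> forgets exactly the multiplier components.\<close>

lemma J_eq_iff: "J *v u = J *v v \<longleftrightarrow> qp u = qp v"
proof -
  have "J *v u = J *v v \<longleftrightarrow> \<J> *v (matrix_inv S *v u) = \<J> *v (matrix_inv S *v v)"
    by (metis transpose_S_J transpose_S_inj)
  also have "\<dots> \<longleftrightarrow> qp u = qp v"
    unfolding qp_def by (metis canonical_J_square canonical_J_qp_part neg_equal_iff_equal)
  finally show ?thesis .
qed

text \<open>Solvability of \<open>J F = \<nabla>H(Z)\<close> for \<open>F\<close> forces \<open>H\<^sub>\<lambda> = 0\<close> at \<open>Z\<close>. This is why stages and solutions
  lie on the constraint set; the remaining part of the equation is the reduced field.\<close>

lemma J_eq_grad_iff: "J *v F = grad H Z \<longleftrightarrow> Z \<in> C \<and> qp F = reduced_field (qp Z)"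
proof -
  let ?w = "matrix_inv S *v Z" and ?f = "matrix_inv S *v F"
  have "J *v F = grad H Z \<longleftrightarrow> transpose S *v (J *v F) = transpose S *v grad H (S *v ?w)"
    unfolding transpose_S_inj by simp
  also have "\<dots> \<longleftrightarrow> \<J> *v ?f = grad H_coords ?w"
    by (simp only: transpose_S_J grad_H_coords)
  also have "\<dots> \<longleftrightarrow> Z \<in> C \<and> qp F = reduced_field (qp Z)"
  proof
    assume F: "\<J> *v ?f = grad H_coords ?w"
    have "H_lambda_vanishes H idx S ?w"
      unfolding H_lambda_vanishes_iff F[symmetric] by simp
    then have Z: "Z \<in> C"
      unfolding constraint_set_def using S_inv(1)[of Z] by force
    have "lift (qp Z) = ?w"
      using graph_point_qp[OF Z] S_inv(2)[of "lift (qp Z)"] unfolding graph_point_def by simp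
    then have "reduced_field (qp Z) = - (\<J> *v (\<J> *v ?f))"
      by (simp add: reduced_field_def grad_H_red F)
    then show "Z \<in> C \<and> qp F = reduced_field (qp Z)"
      using Z by (simp add: canonical_J_square qp_def)
  next
    assume F: "Z \<in> C \<and> qp F = reduced_field (qp Z)"
    then have "lift (qp Z) = ?w"
      using graph_point_qp[of Z] S_inv(2)[of "lift (qp Z)"] unfolding graph_point_def by simp
    then have grad: "grad H_red (qp Z) = grad H_coords ?w"
      by (simp add: grad_H_red)
    have "\<J> *v ?f = \<J> *v qp F"
      by (simp add: qp_def)
    also have "\<dots> = grad H_red (qp Z)"
      using F by (simp add: reduced_field_def canonical_J_minus canonical_J_square qp_part_grad_H_red)
    finally show "\<J> *v ?f = grad H_coords ?w"
      by (simp add: grad)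
  qed
  finally show ?thesis .
qed

text \<open>Both sides of the update equations are images under \<open>J\<close>, so that these equations are equivalent to
  their \<open>(q, p)\<close> parts. The slopes enter through \<open>qp (F j)\<close>, which are values of the reduced field, and
  stages and end point are recovered from their \<open>(q, p)\<close> parts because they lie on the graph.\<close>

lemma rk_solution_iff:
  fixes A :: "real^'s^'s"
  assumes "z0 \<in> C"
  shows "rk_solution J H (multiplier_graph idx S lam) A b r h z0 Z z1 \<longleftrightarrow>
    (\<forall>i. dist (Z i) z0 < r) \<and>
    (\<exists>X. X = diag (qp z0) + h *\<^sub>R stage_slopes A reduced_field X \<and> (\<forall>i. Z i = graph_point (X $ i)) \<and>
       z1 = graph_point (qp z0 + h *\<^sub>R weighted_slope b reduced_field X))"
    (is "?L \<longleftrightarrow> _ \<and> (\<exists>X. ?R X)")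
proof -
  have J_step: "J *v z = J *v z0 + h *\<^sub>R (\<Sum>j\<in>UNIV. c $ j *\<^sub>R (J *v F j)) \<longleftrightarrow>
      qp z = qp z0 + h *\<^sub>R (\<Sum>j\<in>UNIV. c $ j *\<^sub>R qp (F j))" for z and c :: "real^'s" and F
  proof -
    note J_lin = matrix_vector_mul_linear[of J]
    have "J *v z0 + h *\<^sub>R (\<Sum>j\<in>UNIV. c $ j *\<^sub>R (J *v F j)) = J *v (z0 + h *\<^sub>R (\<Sum>j\<in>UNIV. c $ j *\<^sub>R F j))"
      by (simp add: linear_add[OF J_lin] linear_scale[OF J_lin] linear_sum[OF J_lin])
    moreover have "qp z0 + h *\<^sub>R (\<Sum>j\<in>UNIV. c $ j *\<^sub>R qp (F j)) = qp (z0 + h *\<^sub>R (\<Sum>j\<in>UNIV. c $ j *\<^sub>R F j))"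
      by (simp add: linear_add[OF qp_linear] linear_scale[OF qp_linear] linear_sum[OF qp_linear])
    ultimately show ?thesis
      by (simp add: J_eq_iff)
  qed
  have field_lin: "\<P> (x + h *\<^sub>R (\<Sum>j\<in>UNIV. c $ j *\<^sub>R reduced_field (X j))) = \<P> x + h *\<^sub>R (\<Sum>j\<in>UNIV. c $ j *\<^sub>R reduced_field (X j))"
    for x and c :: "real^'s" and X
    using bounded_linear.linear[OF bounded_linear_qp_part[of idx]]
    by (simp add: linear_add linear_scale linear_sum)
  have "?L \<longleftrightarrow> (\<forall>i. dist (Z i) z0 < r) \<and> z1 \<in> C \<and> (\<exists>F. (\<forall>j. Z j \<in> C \<and> qp (F j) = reduced_field (qp (Z j))) \<and>
      (\<forall>i. qp (Z i) = qp z0 + h *\<^sub>R (\<Sum>j\<in>UNIV. A $ i $ j *\<^sub>R qp (F j))) \<and>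
      qp z1 = qp z0 + h *\<^sub>R (\<Sum>j\<in>UNIV. b $ j *\<^sub>R qp (F j)))"
    unfolding rk_solution_def rk_equations_def J_step J_eq_grad_iff graph_eq_constraint_set by blast
  also have "\<dots> \<longleftrightarrow> (\<forall>i. dist (Z i) z0 < r) \<and> z1 \<in> C \<and> (\<forall>j. Z j \<in> C) \<and>
      (\<forall>i. qp (Z i) = qp z0 + h *\<^sub>R (\<Sum>j\<in>UNIV. A $ i $ j *\<^sub>R reduced_field (qp (Z j)))) \<and>
      qp z1 = qp z0 + h *\<^sub>R (\<Sum>j\<in>UNIV. b $ j *\<^sub>R reduced_field (qp (Z j)))" (is "_ \<longleftrightarrow> ?near \<and> ?M")
  proof -
    have slopes: "(\<exists>F. (\<forall>j. Z j \<in> C \<and> qp (F j) = reduced_field (qp (Z j))) \<and> Q (\<lambda>j. qp (F j))) \<longleftrightarrow>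
        (\<forall>j. Z j \<in> C) \<and> Q (\<lambda>j. reduced_field (qp (Z j)))" (is "?l \<longleftrightarrow> ?r") for Q
    proof
      assume ?l
      then obtain F where F: "\<forall>j. Z j \<in> C \<and> qp (F j) = reduced_field (qp (Z j))" "Q (\<lambda>j. qp (F j))"
        by blast
      moreover have "(\<lambda>j. qp (F j)) = (\<lambda>j. reduced_field (qp (Z j)))"
        using F(1) by simp
      ultimately show ?r
        by simp
    next
      assume ?r
      moreover have "qp (S *v reduced_field (qp (Z j))) = reduced_field (qp (Z j))" for j
        by (simp add: qp_def)
      ultimately show ?l
        by (intro exI[of _ "\<lambda>j. S *v reduced_field (qp (Z j))"]) simp
    qed
    show ?thesis
      by (simp only: slopes[of "\<lambda>g. (\<forall>i. qp (Z i) = qp z0 + h *\<^sub>R (\<Sum>j\<in>UNIV. A $ i $ j *\<^sub>R g j)) \<and>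
          qp z1 = qp z0 + h *\<^sub>R (\<Sum>j\<in>UNIV. b $ j *\<^sub>R g j)"])
  qed
  also have "?M \<longleftrightarrow> (\<exists>X. ?R X)"
  proof
    assume M: ?M
    let ?X = "\<chi> i. qp (Z i)"
    from M have M1: "z1 \<in> C" "\<And>j. Z j \<in> C"
      and M2: "\<forall>i. qp (Z i) = qp z0 + h *\<^sub>R (\<Sum>j\<in>UNIV. A $ i $ j *\<^sub>R reduced_field (qp (Z j)))"
      and M3: "qp z1 = qp z0 + h *\<^sub>R (\<Sum>j\<in>UNIV. b $ j *\<^sub>R reduced_field (qp (Z j)))"
      by blast+
    have "\<forall>i. ?X $ i = (diag (qp z0) + h *\<^sub>R stage_slopes A reduced_field ?X) $ i"
      unfolding stage_slopes_def vec_lambda_beta vector_add_component vector_scaleR_component diag_nth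
      by (rule M2)
    then have "?X = diag (qp z0) + h *\<^sub>R stage_slopes A reduced_field ?X"
      by (rule vec_eq_iff[THEN iffD2])
    moreover have "graph_point (qp z0 + h *\<^sub>R weighted_slope b reduced_field ?X) = graph_point (qp z1)"
      unfolding M3 weighted_slope_def vec_lambda_beta ..
    ultimately show "\<exists>X. ?R X"
      using M1 by (intro exI[of _ ?X] conjI) auto
  next
    assume "\<exists>X. ?R X"
    then obtain X where X: "X = diag (qp z0) + h *\<^sub>R stage_slopes A reduced_field X"
      "\<And>i. Z i = graph_point (X $ i)" "z1 = graph_point (qp z0 + h *\<^sub>R weighted_slope b reduced_field X)"
      by blast
    have comp: "X $ i = qp z0 + h *\<^sub>R (\<Sum>j\<in>UNIV. A $ i $ j *\<^sub>R reduced_field (X $ j))" for i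
      using arg_cong[OF X(1), of "\<lambda>X. X $ i"] by (simp add: stage_slopes_def)
    have "\<P> (qp z0 + h *\<^sub>R (\<Sum>j\<in>UNIV. A $ i $ j *\<^sub>R reduced_field (X $ j))) =
        qp z0 + h *\<^sub>R (\<Sum>j\<in>UNIV. A $ i $ j *\<^sub>R reduced_field (X $ j))" for i
      by (simp add: field_lin)
    then have X_qp: "\<P> (X $ i) = X $ i" for i
      unfolding comp[symmetric] .
    show ?M
    proof (intro conjI allI)
      show "qp (Z i) = qp z0 + h *\<^sub>R (\<Sum>j\<in>UNIV. A $ i $ j *\<^sub>R reduced_field (qp (Z j)))" for i
        unfolding X(2) qp_graph_point X_qp by (rule comp)
      show "qp z1 = qp z0 + h *\<^sub>R (\<Sum>j\<in>UNIV. b $ j *\<^sub>R reduced_field (qp (Z j)))"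
        unfolding X(2,3) qp_graph_point X_qp weighted_slope_def by (simp add: field_lin)
    qed (simp_all add: X(2,3))
  qed
  finally show ?thesis .
qed

section \<open>Well-definedness and symplecticity\<close>

text \<open>Like \<open>J\<close>, the form only sees the \<open>(q, p)\<close> parts; on the constraint set, where these are
  coordinates, it is the canonical symplectic form up to sign.\<close>

lemma J_form_eq: "J_form J u v = qp u \<bullet> (\<J> *v qp v)"
proof -
  let ?u = "matrix_inv S *v u" and ?v = "matrix_inv S *v v"
  have "J_form J u v = (S *v ?u) \<bullet> (J *v v)"
    by (simp add: J_form_antisymmetric[OF antisym])
  also have "\<dots> = ?u \<bullet> (transpose S *v (J *v v))"
    unfolding transpose_matrix_vector by (metis dot_lmul_matrix inner_commute)
  also have "\<dots> = ?u \<bullet> (\<J> *v ?v)"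
    by (simp only: transpose_S_J)
  also have "\<dots> = ?u \<bullet> \<P> (\<J> *v \<P> ?v)"
    by simp
  finally show ?thesis
    unfolding qp_part_inner[symmetric] qp_def by simp
qed

text \<open>The reduced field is infinitesimally symplectic because the Hessian of the reduced Hamiltonian
  is symmetric.\<close>

lemma reduced_field_derivative_skew:
  "frechet_derivative reduced_field (at x) u \<bullet> (\<J> *v v) + u \<bullet> (\<J> *v frechet_derivative reduced_field (at x) v) = 0"
proof -
  let ?g' = "frechet_derivative (grad H_red) (at x)"
  have g': "(grad H_red has_derivative ?g') (at x)"
    by (rule smooth_has_derivative[OF smooth_grad[OF smooth_H_red]])
  have "(reduced_field has_derivative (\<lambda>v. - (\<J> *v ?g' v))) (at x)"
    unfolding reduced_field_def[abs_def]
    by (intro has_derivative_minus bounded_linear.has_derivative[OF bounded_linear_matrix_vector_mult] g')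
  then have reduced_field': "frechet_derivative reduced_field (at x) = (\<lambda>v. - (\<J> *v ?g' v))"
    by (rule frechet_derivative_at[symmetric])
  have "((\<lambda>x. \<P> (grad H_red x)) has_derivative (\<lambda>v. \<P> (?g' v))) (at x)"
    by (rule bounded_linear.has_derivative[OF bounded_linear_qp_part g'])
  then have "(grad H_red has_derivative (\<lambda>v. \<P> (?g' v))) (at x)"
    by (simp add: qp_part_grad_H_red)
  from has_derivative_unique[OF this g'] have qp_g': "\<P> (?g' v) = ?g' v" for v
    by (rule fun_cong)
  have "frechet_derivative reduced_field (at x) u \<bullet> (\<J> *v v) = - (?g' u \<bullet> v)"
  proof -
    have "frechet_derivative reduced_field (at x) u \<bullet> (\<J> *v v) = ?g' u \<bullet> (\<J> *v (\<J> *v v))"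
      by (simp add: reduced_field' canonical_J_inner)
    also have "\<dots> = - (\<P> (?g' u) \<bullet> v)"
      by (simp add: canonical_J_square qp_part_inner)
    finally show ?thesis
      by (simp add: qp_g')
  qed
  moreover have "u \<bullet> (\<J> *v frechet_derivative reduced_field (at x) v) = ?g' v \<bullet> u"
    by (simp add: reduced_field' canonical_J_minus canonical_J_square qp_g' inner_commute)
  ultimately show ?thesis
    using frechet_grad_symmetric[OF smooth_H_red, of x u v] by simp
qed

lemma bilinear_canonical_form: "bilinear (\<lambda>u v. u \<bullet> (\<J> *v v))"
  unfolding bilinear_def
  by (auto intro!: linearI simp: inner_add_left inner_add_right matrix_vector_right_distrib
      matrix_vector_mult_scaleR)

lemma qp_bound:
  obtains B where "0 < B" "\<And>v. norm (qp v) \<le> B * norm v"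
  using bounded_linear.pos_bounded[OF bounded_linear_qp] by (metis mult.commute)

text \<open>Since \<open>qp\<close> is bounded and linear, the distance of the stages from \<open>z0\<close> controls the distance of
  their \<open>(q, p)\<close> parts. This transfers uniqueness from the reduced stage equations to stages near \<open>z0\<close>.\<close>

lemma stages_near:
  fixes X :: "(real^'m)^'s"
  assumes B: "\<And>v. norm (qp v) \<le> B * norm v" "0 < B"
    and X: "X = diag (qp z0) + h *\<^sub>R stage_slopes A reduced_field X" "\<And>i. dist (graph_point (X $ i)) z0 < r" and "r \<le> 1"
  shows "norm (X - diag (qp z0)) \<le> real CARD('s) * B"
proof (rule norm_vec_le)
  fix i
  have lin: "linear \<P>"
    by (rule bounded_linear.linear[OF bounded_linear_qp_part])
  have comp: "X $ i = qp z0 + h *\<^sub>R (\<Sum>j\<in>UNIV. A $ i $ j *\<^sub>R reduced_field (X $ j))"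
    using arg_cong[OF X(1), of "\<lambda>X. X $ i"] by (simp add: stage_slopes_def)
  have "\<P> (qp z0 + h *\<^sub>R (\<Sum>j\<in>UNIV. A $ i $ j *\<^sub>R reduced_field (X $ j))) =
      qp z0 + h *\<^sub>R (\<Sum>j\<in>UNIV. A $ i $ j *\<^sub>R reduced_field (X $ j))"
    by (simp add: linear_add[OF lin] linear_scale[OF lin] linear_sum[OF lin])
  then have "\<P> (X $ i) = X $ i"
    unfolding comp[symmetric] .
  then have "(X - diag (qp z0)) $ i = qp (graph_point (X $ i) - z0)"
    by (simp add: linear_diff[OF qp_linear])
  then have "norm ((X - diag (qp z0)) $ i) \<le> B * norm (graph_point (X $ i) - z0)"
    using B(1) by simp
  also have "\<dots> \<le> B * 1"
    using X(2)[of i] \<open>r \<le> 1\<close> B(2) by (intro mult_left_mono) (auto simp: dist_norm)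
  finally show "norm ((X - diag (qp z0)) $ i) \<le> B"
    by simp
qed

text \<open>Conversely, \<open>graph_point\<close> is Lipschitz on bounded sets, so that reduced stages within a suitable
  distance \<open>\<rho>\<close> of the initial value give stages within distance \<open>r\<close> of \<open>z0\<close>.\<close>

lemma nearby_stages_exist:
  fixes A :: "real^'s^'s"
  assumes "0 < r"
  obtains h0 \<rho> where "0 < h0" "0 < \<rho>" "\<rho> \<le> 1"
    "\<And>h c. \<lbrakk>0 \<le> h; h < h0; norm c \<le> real CARD('s) * R\<rbrakk> \<Longrightarrow>
      \<exists>X. norm (X - c) \<le> \<rho> \<and> X = c + h *\<^sub>R stage_slopes A reduced_field X"
    "\<And>(X :: (real^'m)^'s) z0 i. \<lbrakk>z0 \<in> C; norm (qp z0) \<le> R; norm (X - diag (qp z0)) \<le> \<rho>\<rbrakk>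
      \<Longrightarrow> dist (graph_point (X $ i)) z0 < r"
proof -
  obtain L where L: "0 < L"
    "\<And>x y. norm x \<le> R + 1 \<Longrightarrow> norm y \<le> R + 1 \<Longrightarrow> norm (graph_point x - graph_point y) \<le> L * norm (x - y)"
    using smooth_lipschitz_on_cball[OF smooth_graph_point, where R = "R + 1"] by metis
  define \<rho> where "\<rho> = min 1 (r / (2 * L))"
  have \<rho>: "0 < \<rho>" "\<rho> \<le> 1" "L * \<rho> < r"
    using assms L(1) by (auto simp: \<rho>_def min_def field_simps)
  obtain h0 where h0: "0 < h0"
    "\<And>h c. 0 \<le> h \<Longrightarrow> h < h0 \<Longrightarrow> norm c \<le> real CARD('s) * R \<Longrightarrow>
      \<exists>X. norm (X - c) \<le> \<rho> \<and> X = c + h *\<^sub>R stage_slopes A reduced_field X"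
    using implicit_equation_exists[OF smooth_stage_slopes[OF smooth_reduced_field] \<rho>(1), where R = "real CARD('s) * R"]
    by metis
  show ?thesis
  proof
    show "0 < h0" "0 < \<rho>" "\<rho> \<le> 1"
      by (fact h0 \<rho>)+
    show "\<exists>X. norm (X - c) \<le> \<rho> \<and> X = c + h *\<^sub>R stage_slopes A reduced_field X"
      if "0 \<le> h" "h < h0" "norm c \<le> real CARD('s) * R" for h c
      using that by (rule h0(2))
    show "dist (graph_point (X $ i)) z0 < r" if "z0 \<in> C" "norm (qp z0) \<le> R" "norm (X - diag (qp z0)) \<le> \<rho>"
      for X :: "(real^'m)^'s" and z0 i
    proof -
      have near: "norm (X $ i - qp z0) \<le> \<rho>"
        using Finite_Cartesian_Product.norm_nth_le[of "X - diag (qp z0)" i] that(3) by simp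
      then have "norm (X $ i) \<le> R + 1"
        using that(2) \<rho>(2) norm_triangle_ineq2[of "X $ i" "qp z0"] by simp
      then have "norm (graph_point (X $ i) - graph_point (qp z0)) \<le> L * norm (X $ i - qp z0)"
        using that(2) by (intro L(2)) auto
      also have "\<dots> \<le> L * \<rho>"
        using near L(1) by simp
      finally show ?thesis
        using \<rho>(3) that(1) by (simp add: dist_norm)
    qed
  qed
qed

lemma graph_point_derivative_qp: "qp (frechet_derivative graph_point (at x) v) = \<P> v"
proof -
  have "((\<lambda>x. qp (graph_point x)) has_derivative (\<lambda>v. qp (frechet_derivative graph_point (at x) v))) (at x)"
    by (rule bounded_linear.has_derivative[OF bounded_linear_qp smooth_has_derivative[OF smooth_graph_point]])
  then have "(\<P> has_derivative (\<lambda>v. qp (frechet_derivative graph_point (at x) v))) (at x)"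
    by (simp add: fun_eq_iff)
  from has_derivative_unique[OF this bounded_linear_imp_has_derivative[OF bounded_linear_qp_part]]
  show ?thesis
    by (rule fun_cong)
qed

text \<open>The factorisation through \<open>(q, p)\<close> extends \<open>\<Phi>\<close> beyond the constraint set to a map with values in the
  constraint set, so that curves in the constraint set are mapped to such curves. In the form only the
  derivative of \<open>\<phi>\<close> survives, because \<open>qp\<close> after \<open>graph_point\<close> is the projection to \<open>(q, p)\<close>.\<close>

lemma preserves_form_atI:
  assumes "open U" and "x \<in> U \<inter> C"
    and \<Phi>: "\<And>y. y \<in> U \<inter> C \<Longrightarrow> \<Phi> y = graph_point (\<phi> (qp y))"
    and \<phi>: "(\<phi> has_derivative D) (at (qp x))"
    and D: "\<And>u v. D u \<bullet> (\<J> *v D v) = u \<bullet> (\<J> *v v)"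
  shows "preserves_form_at J C \<Phi> x"
proof -
  define E where "E v = frechet_derivative graph_point (at (\<phi> (qp x))) (D (qp v))" for v
  define \<Psi> where "\<Psi> y = graph_point (\<phi> (qp y))" for y
  have \<Psi>: "(\<Psi> has_derivative E) (at x)"
  proof -
    have "((\<lambda>y. \<phi> (qp y)) has_derivative (\<lambda>v. D (qp v))) (at x)"
      by (rule has_derivative_compose[OF bounded_linear_imp_has_derivative[OF bounded_linear_qp] \<phi>])
    then show ?thesis
      unfolding \<Psi>_def[abs_def] E_def[abs_def]
      by (rule has_derivative_compose[OF _ smooth_has_derivative[OF smooth_graph_point]])
  qed
  obtain d where d: "0 < d" "ball x d \<subseteq> U"
    using assms(1,2) open_contains_ball by blast
  have "(\<Phi> has_derivative E) (at x within C)"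
  proof (rule has_derivative_transform_within[OF has_derivative_at_withinI[OF \<Psi>] d(1)])
    show "x \<in> C"
      using assms(2) by simp
    show "\<Psi> y = \<Phi> y" if "y \<in> C" "dist y x < d" for y
    proof -
      have "y \<in> U \<inter> C"
        using that d(2) by (auto simp: dist_commute)
      then show ?thesis
        by (simp add: \<Phi> \<Psi>_def)
    qed
  qed
  moreover have "E u \<in> tangent_space C (\<Phi> x)" if u: "u \<in> tangent_space C x" for u
  proof -
    obtain \<gamma> where \<gamma>: "\<gamma> 0 = x" "(\<gamma> has_vector_derivative u) (at (0 :: real))"
      using u unfolding tangent_space_def by blast
    have "((\<lambda>t. \<Psi> (\<gamma> t)) has_derivative (\<lambda>t. E (t *\<^sub>R u))) (at 0)"
      using has_derivative_compose[OF \<gamma>(2)[unfolded has_vector_derivative_def], of \<Psi> E] \<Psi> \<gamma>(1) by simp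
    then have "((\<lambda>t. \<Psi> (\<gamma> t)) has_vector_derivative E u) (at 0)"
      unfolding has_vector_derivative_def
      by (simp add: linear_scale[OF has_derivative_linear[OF \<Psi>]])
    moreover have "\<Psi> (\<gamma> 0) = \<Phi> x"
      using assms(2) by (simp add: \<gamma>(1) \<Phi> \<Psi>_def)
    moreover have "\<Psi> (\<gamma> t) \<in> C" for t
      by (simp add: \<Psi>_def)
    ultimately show ?thesis
      unfolding tangent_space_def by (auto intro!: exI[of _ "\<lambda>t. \<Psi> (\<gamma> t)"])
  qed
  moreover have "J_form J (E u) (E v) = J_form J u v" for u v
  proof -
    have "J_form J (E u) (E v) = D (qp u) \<bullet> \<P> (\<J> *v \<P> (D (qp v)))"
      by (simp only: J_form_eq E_def graph_point_derivative_qp qp_part_inner)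
    also have "\<dots> = qp u \<bullet> (\<J> *v qp v)"
      by (simp add: D)
    finally show ?thesis
      by (simp add: J_form_eq)
  qed
  ultimately show ?thesis
    unfolding preserves_form_at_def by blast
qed

text \<open>By the reduction to \<open>(q, p)\<close>, the method on the constraint set is conjugate to a step of the
  method for the reduced field, whose derivative is given by linearised stages.\<close>

lemma rk_well_defined_and_symplectic:
  fixes A :: "real^'s^'s"
  assumes symplectic: "symplectic_rk A b" and z: "z \<in> C" and r: "0 < r" "r \<le> 1"
  shows "\<exists>h0>0. \<exists>U. open U \<and> z \<in> U \<and> (\<forall>h. 0 < h \<and> h < h0 \<longrightarrow> (\<forall>x\<in>U \<inter> C.
    (\<exists>!sol. case sol of (Z, z1) \<Rightarrow> rk_solution J H (multiplier_graph idx S lam) A b r h x Z z1) \<and>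
    preserves_form_at J C (rk_map J H (multiplier_graph idx S lam) A b r h) x))"
proof -
  let ?G = "stage_slopes A reduced_field" and ?W = "weighted_slope b reduced_field"
  let ?sol = "rk_solution J H (multiplier_graph idx S lam) A b r"
  note smooth_G = smooth_stage_slopes[OF smooth_reduced_field, of A]
  define R where "R = norm (qp z) + 1"
  obtain B where B: "0 < B" "\<And>v. norm (qp v) \<le> B * norm v"
    using qp_bound by metis
  \<comment> \<open>The bound \<open>K\<close> covers both the stages constructed below, at distance at most \<open>1\<close> from the diagonal,
    and all competing stages with \<open>Z i\<close> within distance \<open>r\<close> of the initial point.\<close>
  define K where "K = real CARD('s) * R + (real CARD('s) * B + 1)"
  obtain h1 \<rho> where h1: "0 < h1" "0 < \<rho>" "\<rho> \<le> 1"
    "\<And>h c. \<lbrakk>0 \<le> h; h < h1; norm c \<le> real CARD('s) * R\<rbrakk> \<Longrightarrow>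
      \<exists>X. norm (X - c) \<le> \<rho> \<and> X = c + h *\<^sub>R ?G X"
    "\<And>(X :: (real^'m)^'s) z0 i. \<lbrakk>z0 \<in> C; norm (qp z0) \<le> R; norm (X - diag (qp z0)) \<le> \<rho>\<rbrakk>
      \<Longrightarrow> dist (graph_point (X $ i)) z0 < r"
    using nearby_stages_exist[OF r(1), where R = R and A = A] by metis
  obtain h2 where h2: "0 < h2"
    "\<And>h c c' X Y. \<lbrakk>0 \<le> h; h < h2; norm X \<le> K; norm Y \<le> K; X = c + h *\<^sub>R ?G X; Y = c' + h *\<^sub>R ?G Y\<rbrakk>
       \<Longrightarrow> norm (X - Y) \<le> 2 * norm (c - c')"
    using implicit_equation_stable[OF smooth_G, where R = K] by metis
  obtain h3 where h3: "0 < h3"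
    "\<And>h g T c. \<lbrakk>0 \<le> h; h < h3; open T; c \<in> T; \<And>c'. c' \<in> T \<Longrightarrow> norm (g c') \<le> K;
       \<And>c'. c' \<in> T \<Longrightarrow> g c' = c' + h *\<^sub>R ?G (g c')\<rbrakk>
     \<Longrightarrow> \<exists>D. (g has_derivative D) (at c) \<and> (\<forall>v. D v = v + h *\<^sub>R frechet_derivative ?G (at (g c)) (D v))"
    using implicit_equation_derivative[OF smooth_G, where R = K] by metis
  define U where "U = {x. norm (qp x) < R}"
  have "open U"
    unfolding U_def
    by (intro open_Collect_less continuous_on_norm linear_continuous_on bounded_linear_qp continuous_on_const)
  moreover have "z \<in> U"
    by (simp add: U_def R_def)
  moreover have "(\<exists>!sol. case sol of (Z, z1) \<Rightarrow> ?sol h x Z z1) \<and>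
      preserves_form_at J C (rk_map J H (multiplier_graph idx S lam) A b r h) x"
    if h: "0 < h" "h < min (min h1 h2) h3" and x: "x \<in> U \<inter> C" for h x
  proof -
    \<comment> \<open>The solution operator is taken on a ball of right-hand sides \<open>c\<close> of the stage equations,
      an open set on which it can be differentiated, and not only on the diagonal ones.\<close>
    define g where "g c = (SOME X. norm (X - c) \<le> \<rho> \<and> X = c + h *\<^sub>R ?G X)" for c :: "(real^'m)^'s"
    have g: "norm (g c - c) \<le> \<rho>" "g c = c + h *\<^sub>R ?G (g c)" "norm (g c) \<le> K" if "norm c \<le> real CARD('s) * R" for c
    proof -
      have "norm (g c - c) \<le> \<rho> \<and> g c = c + h *\<^sub>R ?G (g c)"
        unfolding g_def by (rule someI_ex[OF h1(4)]) (use h that in auto)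
      then show "norm (g c - c) \<le> \<rho>" "g c = c + h *\<^sub>R ?G (g c)"
        by blast+
      then show "norm (g c) \<le> K"
        using that h1(3) B(1) norm_triangle_ineq2[of "g c" c]
          mult_nonneg_nonneg[of "real CARD('s)" B] unfolding K_def by linarith
    qed
    have diag_bound: "norm (diag (qp y) :: (real^'m)^'s) \<le> real CARD('s) * R" if "y \<in> U" for y
      using that by (intro norm_vec_le) (simp add: U_def)
    have sol_iff: "?sol h y Z z1 \<longleftrightarrow> Z = (\<lambda>i. graph_point (g (diag (qp y)) $ i)) \<and>
        z1 = graph_point (qp y + h *\<^sub>R ?W (g (diag (qp y))))" if y: "y \<in> U \<inter> C" for y Z z1
    proof -
      let ?c = "diag (qp y) :: (real^'m)^'s"
      have c: "norm ?c \<le> real CARD('s) * R"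
        using diag_bound y by blast
      have "?sol h y Z z1 \<longleftrightarrow> (\<exists>X. X = ?c + h *\<^sub>R ?G X \<and> (\<forall>i. dist (graph_point (X $ i)) y < r) \<and>
          (\<forall>i. Z i = graph_point (X $ i)) \<and> z1 = graph_point (qp y + h *\<^sub>R ?W X))"
        using rk_solution_iff[of y A b r h Z z1] y by auto
      also have "\<dots> \<longleftrightarrow> (\<exists>X. X = g ?c \<and> (\<forall>i. Z i = graph_point (X $ i)) \<and> z1 = graph_point (qp y + h *\<^sub>R ?W X))"
      proof -
        have "X = ?c + h *\<^sub>R ?G X \<and> (\<forall>i. dist (graph_point (X $ i)) y < r) \<longleftrightarrow> X = g ?c" for X
        proof
          assume X: "X = ?c + h *\<^sub>R ?G X \<and> (\<forall>i. dist (graph_point (X $ i)) y < r)"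
          then have "norm (X - ?c) \<le> real CARD('s) * B"
            using r(2) B by (intro stages_near[where r = r]) auto
          then have "norm X \<le> K"
            using c norm_triangle_ineq2[of X ?c] unfolding K_def by linarith
          then have "norm (X - g ?c) \<le> 2 * norm (?c - ?c)"
            using h X g[OF c] by (intro h2(2)) auto
          then show "X = g ?c"
            by simp
        next
          assume X: "X = g ?c"
          have "norm (qp y) \<le> R"
            using y by (simp add: U_def)
          then show "X = ?c + h *\<^sub>R ?G X \<and> (\<forall>i. dist (graph_point (X $ i)) y < r)"
            using g(1,2)[OF c] h1(5) y unfolding X by blast
        qed
        then show ?thesis
          by (metis (no_types, lifting))
      qed
      also have "\<dots> \<longleftrightarrow> Z = (\<lambda>i. graph_point (g ?c $ i)) \<and> z1 = graph_point (qp y + h *\<^sub>R ?W (g ?c))"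
        by (auto simp: fun_eq_iff)
      finally show ?thesis .
    qed
    define \<phi> where "\<phi> v = v + h *\<^sub>R ?W (g (diag v))" for v
    have map: "rk_map J H (multiplier_graph idx S lam) A b r h y = graph_point (\<phi> (qp y))" if "y \<in> U \<inter> C" for y
      unfolding rk_map_def sol_iff[OF that] \<phi>_def by simp
    let ?c = "diag (qp x) :: (real^'m)^'s"
    let ?X = "g ?c"
    have "norm ?c < real CARD('s) * R"
    proof -
      have "norm ?c \<le> real CARD('s) * norm (qp x)"
        by (rule norm_diag_le)
      also have "\<dots> < real CARD('s) * R"
        using x by (simp add: U_def)
      finally show ?thesis .
    qed
    then obtain D where D: "(g has_derivative D) (at ?c)"
      "\<And>V. D V = V + h *\<^sub>R frechet_derivative ?G (at ?X) (D V)"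
      using h3(2)[of h "ball 0 (real CARD('s) * R)" ?c g] g(2,3) h by auto
    define \<phi>' where "\<phi>' v = v + h *\<^sub>R frechet_derivative ?W (at ?X) (D (diag v))" for v
    have "(\<phi> has_derivative \<phi>') (at (qp x))"
    proof -
      have "((\<lambda>v. g (diag v)) has_derivative (\<lambda>v. D (diag v))) (at (qp x))"
        by (rule has_derivative_compose[OF bounded_linear_imp_has_derivative[OF bounded_linear_diag] D(1)])
      then have "((\<lambda>v. ?W (g (diag v))) has_derivative (\<lambda>v. frechet_derivative ?W (at ?X) (D (diag v)))) (at (qp x))"
        by (rule has_derivative_compose[OF _ smooth_has_derivative[OF smooth_weighted_slope[OF smooth_reduced_field]]])
      then show ?thesis
        unfolding \<phi>_def[abs_def] \<phi>'_def[abs_def]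
        by (intro has_derivative_add has_derivative_ident has_derivative_scaleR_right)
    qed
    moreover have "\<phi>' u \<bullet> (\<J> *v \<phi>' v) = u \<bullet> (\<J> *v v)" for u v
    proof -
      have stage: "D (diag w) $ i = w + h *\<^sub>R (\<Sum>j\<in>UNIV. A $ i $ j *\<^sub>R
          frechet_derivative reduced_field (at (?X $ j)) (D (diag w) $ j))" for w i
        using arg_cong[OF D(2)[of "diag w"], of "\<lambda>V. V $ i"] by (simp add: frechet_stage_slopes[OF smooth_reduced_field])
      show ?thesis
        unfolding \<phi>'_def frechet_weighted_slope[OF smooth_reduced_field]
        by (rule symplectic_rk_preserves_bilinear[OF symplectic bilinear_canonical_form reduced_field_derivative_skew
              stage stage])
    qed
    ultimately have "preserves_form_at J C (rk_map J H (multiplier_graph idx S lam) A b r h) x"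
      using \<open>open U\<close> x map by (intro preserves_form_atI[where U = U and \<phi> = \<phi> and D = \<phi>'])
    moreover have "\<exists>!sol. case sol of (Z, z1) \<Rightarrow> ?sol h x Z z1"
      unfolding sol_iff[OF x] by (auto simp: case_prod_unfold prod_eq_iff intro!: ex1I)
    ultimately show ?thesis
      by blast
  qed
  ultimately show ?thesis
    using h1(1) h2(1) h3(1)
    by (intro exI[of _ "min (min h1 h2) h3"] exI[of _ U] conjI) auto
qed

section \<open>Convergence\<close>

lemma solution_reduces:
  assumes "gen_hamiltonian_solution J H T z" and t: "t \<in> {0..T}"
  shows "z t \<in> C" "((\<lambda>t. qp (z t)) has_vector_derivative reduced_field (qp (z t))) (at t within {0..T})"
proof -
  obtain z' where z': "(z has_vector_derivative z') (at t within {0..T})" "J *v z' = grad H (z t)"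
    using assms unfolding gen_hamiltonian_solution_def by blast
  then show "z t \<in> C"
    by (simp add: J_eq_grad_iff)
  have "((\<lambda>t. qp (z t)) has_vector_derivative qp z') (at t within {0..T})"
    by (rule bounded_linear.has_vector_derivative[OF bounded_linear_qp z'(1)])
  then show "((\<lambda>t. qp (z t)) has_vector_derivative reduced_field (qp (z t))) (at t within {0..T})"
    using z'(2) by (simp add: J_eq_grad_iff)
qed

text \<open>The \<open>(q, p)\<close> parts of a numerical trajectory form a trajectory of the method for the reduced
  field. The global error bound keeps them bounded, so that another step exists, and is carried back
  to the constraint set by the Lipschitz map \<open>graph_point\<close>.\<close>

lemma rk_converges:
  fixes A :: "real^'s^'s"
  assumes "1 \<le> p" and order: "rk_has_order A b p" and T: "0 < T"
    and z: "gen_hamiltonian_solution J H T z" and r: "0 < r" "r \<le> 1"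
  shows "\<exists>h0>0. \<exists>M. \<forall>h N. 0 < h \<and> h < h0 \<and> real N * h \<le> T \<longrightarrow>
    (\<exists>w. rk_trajectory J H (multiplier_graph idx S lam) A b r h (z 0) N w) \<and>
    (\<forall>w. rk_trajectory J H (multiplier_graph idx S lam) A b r h (z 0) N w \<longrightarrow>
       (\<forall>k\<le>N. norm (w k - z (real k * h)) \<le> M * h ^ p))"
proof -
  let ?G = "stage_slopes A reduced_field" and ?W = "weighted_slope b reduced_field"
  let ?sol = "rk_solution J H (multiplier_graph idx S lam) A b r"
  let ?traj = "\<lambda>h. rk_trajectory J H (multiplier_graph idx S lam) A b r h (z 0)"
  define x where "x t = qp (z t)" for t
  note z_C = solution_reduces(1)[OF z]
  have sol: "(x has_vector_derivative reduced_field (x t)) (at t within {0..T})" if "t \<in> {0..T}" for t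
    unfolding x_def by (rule solution_reduces(2)[OF z that])
  have "continuous_on {0..T} x"
    unfolding continuous_on_eq_continuous_within using sol has_vector_derivative_continuous by blast
  then have "bounded (x ` {0..T})"
    by (intro compact_imp_bounded compact_continuous_image) auto
  then obtain R where R: "\<And>t. t \<in> {0..T} \<Longrightarrow> norm (x t) \<le> R"
    unfolding bounded_iff by blast
  obtain B where B: "0 < B" "\<And>v. norm (qp v) \<le> B * norm v"
    using qp_bound by metis
  obtain h1 M where h1: "0 < h1" "0 < M"
    "\<And>h N y X. \<lbrakk>0 < h; h < h1; real N * h \<le> T; y 0 = x 0;
       \<And>k. k < N \<Longrightarrow> norm (X k - diag (y k)) \<le> real CARD('s) * B;
       \<And>k. k < N \<Longrightarrow> X k = diag (y k) + h *\<^sub>R ?G (X k);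
       \<And>k. k < N \<Longrightarrow> y (Suc k) = y k + h *\<^sub>R ?W (X k)\<rbrakk>
      \<Longrightarrow> \<forall>k\<le>N. norm (y k - x (real k * h)) \<le> M * h ^ p \<and> norm (y k - x (real k * h)) \<le> 1"
    using rk_global_error[OF smooth_reduced_field order assms(1) T sol R, where \<kappa> = "real CARD('s) * B"] by metis
  obtain h2 \<rho> where h2: "0 < h2" "0 < \<rho>" "\<rho> \<le> 1"
    "\<And>h c. \<lbrakk>0 \<le> h; h < h2; norm c \<le> real CARD('s) * (R + 1)\<rbrakk> \<Longrightarrow>
      \<exists>X. norm (X - c) \<le> \<rho> \<and> X = c + h *\<^sub>R ?G X"
    "\<And>(X :: (real^'m)^'s) z0 i. \<lbrakk>z0 \<in> C; norm (qp z0) \<le> R + 1; norm (X - diag (qp z0)) \<le> \<rho>\<rbrakk>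
      \<Longrightarrow> dist (graph_point (X $ i)) z0 < r"
    using nearby_stages_exist[OF r(1), where R = "R + 1" and A = A] by metis
  obtain L where L: "0 < L"
    "\<And>x y. norm x \<le> R + 1 \<Longrightarrow> norm y \<le> R + 1 \<Longrightarrow> norm (graph_point x - graph_point y) \<le> L * norm (x - y)"
    using smooth_lipschitz_on_cball[OF smooth_graph_point, where R = "R + 1"] by metis
  have time: "real k * h \<in> {0..T}" if "k \<le> N" "0 < h" "real N * h \<le> T" for k N h
  proof -
    have "real k * h \<le> real N * h"
      using that by (intro mult_right_mono) auto
    from order_trans[OF this that(3)] show ?thesis
      using that(2) by simp
  qed
  have trajectory: "w k \<in> C \<and> norm (qp (w k) - x (real k * h)) \<le> M * h ^ p \<and>
      norm (qp (w k) - x (real k * h)) \<le> 1 \<and> norm (qp (w k)) \<le> R + 1"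
    if h: "0 < h" "h < h1" "real N * h \<le> T" and w: "?traj h N w" and k: "k \<le> N" for h N w k
  proof -
    have w0: "w 0 = z 0" and "\<forall>k<N. \<exists>Z. ?sol h (w k) Z (w (Suc k))"
      using w by (auto simp: rk_trajectory_def)
    then obtain Z where Z: "\<And>k. k < N \<Longrightarrow> ?sol h (w k) (Z k) (w (Suc k))"
      by metis
    have w_C: "w k \<in> C" if "k \<le> N" for k
    proof (cases k)
      case 0
      then show ?thesis
        using w0 z_C[of 0] T by simp
    next
      case (Suc l)
      then show ?thesis
        using Z[of l] that by (simp add: rk_solution_def graph_eq_constraint_set)
    qed
    have "\<exists>X. X = diag (qp (w k)) + h *\<^sub>R ?G X \<and> (\<forall>i. dist (graph_point (X $ i)) (w k) < r) \<and>
        w (Suc k) = graph_point (qp (w k) + h *\<^sub>R ?W X)" if "k < N" for k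
      using Z[OF that] rk_solution_iff[of "w k" A b r h "Z k" "w (Suc k)"] w_C[of k] that by auto
    then obtain X where X: "\<And>k. k < N \<Longrightarrow> X k = diag (qp (w k)) + h *\<^sub>R ?G (X k)"
      "\<And>k i. k < N \<Longrightarrow> dist (graph_point (X k $ i)) (w k) < r"
      "\<And>k. k < N \<Longrightarrow> w (Suc k) = graph_point (qp (w k) + h *\<^sub>R ?W (X k))"
      by metis
    have step: "qp (w (Suc k)) = qp (w k) + h *\<^sub>R ?W (X k)" if "k < N" for k
      using bounded_linear.linear[OF bounded_linear_qp_part[of idx]]
      by (simp add: X(3)[OF that] weighted_slope_def linear_add linear_scale linear_sum)
    have near: "norm (X k - diag (qp (w k))) \<le> real CARD('s) * B" if "k < N" for k
      by (rule stages_near[OF B(2,1) X(1)[OF that] X(2)[OF that] r(2)])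
    have error: "norm (qp (w k) - x (real k * h)) \<le> M * h ^ p" "norm (qp (w k) - x (real k * h)) \<le> 1"
      using h1(3)[of h N "\<lambda>k. qp (w k)" X] h near X(1) step k by (auto simp: w0 x_def)
    moreover have "norm (qp (w k)) \<le> R + 1"
      using error(2) R[OF time[OF k h(1,3)]] norm_triangle_ineq2[of "qp (w k)" "x (real k * h)"] by simp
    ultimately show ?thesis
      using w_C[OF k] by blast
  qed
  have exists: "\<exists>w. ?traj h N w" if h: "0 < h" "h < min h1 h2" and "real N * h \<le> T" for h N
    using that(3)
  proof (induction N)
    case 0
    show ?case
      by (auto simp: rk_trajectory_def)
  next
    case (Suc N)
    have N: "real N * h \<le> T"
      using Suc.prems h(1) by (simp add: algebra_simps)
    then obtain w where w: "?traj h N w"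
      using Suc.IH by blast
    have wN: "w N \<in> C" "norm (qp (w N)) \<le> R + 1"
      using trajectory[OF _ _ N w, of N] h by auto
    obtain X where X: "norm (X - diag (qp (w N))) \<le> \<rho>" "X = diag (qp (w N)) + h *\<^sub>R ?G X"
      using h2(4)[of h "diag (qp (w N))"] norm_vec_le[of "diag (qp (w N))" "R + 1"] wN h by auto
    have "?sol h (w N) (\<lambda>i. graph_point (X $ i)) (graph_point (qp (w N) + h *\<^sub>R ?W X))"
      unfolding rk_solution_iff[OF wN(1)] using h2(5)[OF wN X(1)] X(2) by blast
    then have "?traj h (Suc N) (w(Suc N := graph_point (qp (w N) + h *\<^sub>R ?W X)))"
      using w unfolding rk_trajectory_def by (auto simp: less_Suc_eq)
    then show ?case
      by blast
  qed
  have error: "norm (w k - z (real k * h)) \<le> (L * M) * h ^ p"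
    if h: "0 < h" "h < h1" "real N * h \<le> T" and w: "?traj h N w" and k: "k \<le> N" for h N w k
  proof -
    note tr = trajectory[OF h w k]
    have t: "real k * h \<in> {0..T}"
      by (rule time[OF k h(1,3)])
    have "norm (w k - z (real k * h)) = norm (graph_point (qp (w k)) - graph_point (x (real k * h)))"
      using tr z_C[OF t] by (simp add: x_def)
    also have "\<dots> \<le> L * norm (qp (w k) - x (real k * h))"
      using tr R[OF t] by (intro L(2)) auto
    also have "\<dots> \<le> L * (M * h ^ p)"
      using tr L(1) by (intro mult_left_mono) auto
    finally show ?thesis
      by (simp add: mult.assoc)
  qed
  show ?thesis
    using exists error h1(1) h2(1)
    by (intro exI[of _ "min h1 h2"] conjI exI[of _ "L * M"]) auto
qed

end

theorem proposition4:
  fixes J S :: "real^'m^'m"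
    and H :: "real^'m \<Rightarrow> real"
    and n k :: nat
    and idx :: "'m \<Rightarrow> darboux_index"
    and lam :: "real^'m \<Rightarrow> real^'m"
    and A :: "real^'s^'s"
    and b :: "real^'s"
  assumes antisym: "transpose J = - J"
    and smooth_H: "smooth H"
    and darboux: "darboux_coordinates J n k idx S"
    and index1: "index_one H idx S lam"
    and smooth_lam: "smooth (\<lambda>w. lam (qp_part idx w))"
    and symplectic: "symplectic_rk A b"
  shows
    \<comment> \<open>well defined, and symplectic on the constraint set\<close>
    "(\<forall>z\<in>constraint_set H idx S. \<exists>r0>0. \<forall>r. 0 < r \<and> r \<le> r0 \<longrightarrow>
        (\<exists>h0>0. \<exists>U. open U \<and> z \<in> U \<and>
          (\<forall>h. 0 < h \<and> h < h0 \<longrightarrow>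
            (\<forall>x\<in>U \<inter> constraint_set H idx S.
              (\<exists>!sol. case sol of (Z, z1) \<Rightarrow>
                 rk_solution J H (multiplier_graph idx S lam) A b r h x Z z1) \<and>
              preserves_form_at J (constraint_set H idx S)
                (rk_map J H (multiplier_graph idx S lam) A b r h) x))))
     \<comment> \<open>convergent of the order of the method\<close>
     \<and> (\<forall>p\<ge>1. rk_has_order A b p \<longrightarrow>
          rk_convergent J H (constraint_set H idx S) (multiplier_graph idx S lam) A b p)
     \<comment> \<open>preserves the constraint set\<close>
     \<and> (\<forall>r h z0 Z z1. z0 \<in> constraint_set H idx S \<and>
          rk_solution J H (multiplier_graph idx S lam) A b r h z0 Z z1 \<longrightarrow>
          z1 \<in> constraint_set H idx S \<and> (\<forall>i. Z i \<in> constraint_set H idx S))"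
proof -
  interpret index_one_system n k idx J S H lam
    using assms by unfold_locales (auto simp: darboux_coordinates_def)
  show ?thesis
  proof (intro conjI ballI allI impI)
    fix z assume "z \<in> C"
    from rk_well_defined_and_symplectic[OF symplectic this]
    show "\<exists>r0>0. \<forall>r. 0 < r \<and> r \<le> r0 \<longrightarrow> (\<exists>h0>0. \<exists>U. open U \<and> z \<in> U \<and>
        (\<forall>h. 0 < h \<and> h < h0 \<longrightarrow> (\<forall>x\<in>U \<inter> C.
          (\<exists>!sol. case sol of (Z, z1) \<Rightarrow> rk_solution J H (multiplier_graph idx S lam) A b r h x Z z1) \<and>
          preserves_form_at J C (rk_map J H (multiplier_graph idx S lam) A b r h) x)))"
      by (intro exI[of _ 1]) simp
  next
    fix p :: nat assume p: "1 \<le> p" "rk_has_order A b p"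
    show "rk_convergent J H C (multiplier_graph idx S lam) A b p"
      unfolding rk_convergent_def
    proof (intro allI impI, elim conjE)
      fix T z assume "0 < T" "gen_hamiltonian_solution J H T z"
      from rk_converges[OF p this]
      show "\<exists>r0>0. \<forall>r. 0 < r \<and> r \<le> r0 \<longrightarrow> (\<exists>h0>0. \<exists>M. \<forall>h N. 0 < h \<and> h < h0 \<and> real N * h \<le> T \<longrightarrow>
          (\<exists>w. rk_trajectory J H (multiplier_graph idx S lam) A b r h (z 0) N w) \<and>
          (\<forall>w. rk_trajectory J H (multiplier_graph idx S lam) A b r h (z 0) N w \<longrightarrow>
            (\<forall>k\<le>N. norm (w k - z (real k * h)) \<le> M * h ^ p)))"
        by (intro exI[of _ 1]) simp
    qed
  next
    fix r h z0 Z z1 i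
    assume "z0 \<in> C \<and> rk_solution J H (multiplier_graph idx S lam) A b r h z0 Z z1"
    then show "z1 \<in> C" "Z i \<in> C"
      by (auto simp: rk_solution_def rk_equations_def J_eq_grad_iff graph_eq_constraint_set)
  qed
qed

end
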